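(* Let $G$ be a locally compact second countable amenable group. Any Følner sequence in $G$ admits a subsequence which is an admissible Følner sequence.
   Context: Let $r$ be a right-invariant Haar measure on $G$ and $|E|=r(E)$. For $K\subset G$ compact, $\varepsilon>0$ and $E\subset G$ of finite measure: $E$ is $(\varepsilon,K)$-invariant if $|EK\setminus E|\le\varepsilon|E|$ and $|EK^{-1}\setminus E|\le\varepsilon|E|$; the $K$-boundary $\partial_K(E)$ is the union of all left translates $gK$ ($g\in G$) that intersect both $E$ and $G\setminus E$; $E$ is $(\varepsilon,K)$-boundary-invariant if $|\partial_K(E)|\le\varepsilon|E|$. A Følner sequence is a sequence $(F_n)_{n\ge0}$ of compact subsets of $G$ (of positive measure) such that for every $\varepsilon>0$ and compact $K\subset G$, $F_n$ is $(\varepsilon,K)$-boundary-invariant for all sufficiently large $n$. $G$ is amenable if it admits a Følner sequence. The (lower) Banach density of $E\subset G$ is $\underline{\mathrm B}(E)=\sup_{K}\inf_{g\in G}\frac{|gK\cap E|}{|gK|}$, the supremum being over compact subsets $K\subset G$ of positive measure. An atomic filtration $(\mathcal P_n)_{n\ge0}$ on $G$ is a sequence of partitions of $G$ into measurable sets (atoms) $A$ with $0<|A|<\infty$, such that for all $m\ge n\ge0$ and $A\in\mathcal P_n$ there is $B\in\mathcal P_m$ with $A\subset B$. A filtered Følner sequence is a triple $\mathcal S=((F_n)_{n\ge0},(B_n)_{n\ge0},(\mathcal P_n)_{n\ge0})$ where $(F_n)$ is a Følner sequence, $(B_n)$ is a sequence of compact subsets of $G$ and $(\mathcal P_n)$ is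 an atomic filtration on $G$ such that (i) for any $n\ge0$ and $A\in\mathcal P_n$ there is $\gamma\in G$ with $A\subset\gamma B_n$; (ii) for any $n\ge k$, $F_n$ is $(2^{k-n},B_k)$-boundary-invariant. An atom $A\in\mathcal P_k$ is admissible if $A$ is $(2^{n-k},F_n)$-invariant for every $n<k$; $\mathcal P_k^a$ is the family of admissible atoms of $\mathcal P_k$, and $\mathrm{Adm}(\mathcal S)=\bigcap_{k\ge0}\bigcup_{A\in\mathcal P_k^a}A$. $\mathcal S$ is $c$-admissible, for $c\in(0,1)$, if $\underline{\mathrm B}(\mathrm{Adm}(\mathcal S))\ge1-c$, and admissible if it is $c$-admissible for some $c\in(0,1)$. A Følner sequence $(F_n)$ is called admissible if it can be completed into an admissible triple $((F_n),(B_n),(\mathcal P_n))$. *)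

theory Defs
  imports "HOL-Analysis.Analysis" "HOL-Library.Set_Algebras" "HOL-Library.Disjoint_Sets"
begin

text \<open>
  The topological group is the library class \<^class>\<open>topological_group_add\<close>. It extends
  \<^class>\<open>group_add\<close>, so the group is not assumed to be commutative although it is written
  additively: \<open>x + y\<close> is the product of \<open>x\<close> and \<open>y\<close> in this order, and \<open>- x\<close> is the inverse of \<open>x\<close>.
  For sets, \<open>E + K\<close> is the product set \<open>EK\<close>; the set of inverses is \<open>uminus ` K\<close>,
  since \<open>- K\<close> denotes the complement.
\<close>

abbreviation left_translate :: "'a::group_add \<Rightarrow> 'a set \<Rightarrow> 'a set" where
  "left_translate g K \<equiv> (\<lambda>x. g + x) ` K"

abbreviation right_translate :: "'a::group_add set \<Rightarrow> 'a \<Rightarrow> 'a set" where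
  "right_translate E g \<equiv> (\<lambda>x. x + g) ` E"

text \<open>
  No regularity is required below: on a locally compact second countable Hausdorff space every
  Borel measure that is finite on compact sets is regular.
\<close>

definition right_haar_measure :: "'a::topological_group_add measure \<Rightarrow> bool" where
  "right_haar_measure r \<longleftrightarrow>
     sets r = sets borel \<and>
     emeasure r UNIV \<noteq> 0 \<and>
     (\<forall>K. compact K \<longrightarrow> emeasure r K < \<infinity>) \<and>
     (\<forall>E\<in>sets borel. \<forall>g. emeasure r (right_translate E g) = emeasure r E)"

text \<open>
  For a Borel set \<open>E\<close> and a compact set \<open>K\<close>, the sets \<open>EK\<close> and \<open>\<partial>\<^sub>K E\<close> are analytic, hence measurable
  for the completion of \<open>r\<close>, but need not be Borel, and \<^const>\<open>emeasure\<close> is \<open>0\<close> outside the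
  sigma-algebra. The outer measure agrees with \<open>r\<close> on Borel sets and with the completion of
  \<open>r\<close> on all sets measurable for it.
\<close>

abbreviation vol :: "'a measure \<Rightarrow> 'a set \<Rightarrow> ennreal" where
  "vol r E \<equiv> outer_measure_of r E"

definition invariant_set :: "'a::group_add measure \<Rightarrow> real \<Rightarrow> 'a set \<Rightarrow> 'a set \<Rightarrow> bool" where
  "invariant_set r \<epsilon> K E \<longleftrightarrow>
     vol r ((E + K) - E) \<le> ennreal \<epsilon> * vol r E \<and>
     vol r ((E + uminus ` K) - E) \<le> ennreal \<epsilon> * vol r E"

definition K_boundary :: "'a::group_add set \<Rightarrow> 'a set \<Rightarrow> 'a set" where
  "K_boundary K E =
     \<Union> {left_translate g K | g. left_translate g K \<inter> E \<noteq> {} \<and> left_translate g K \<inter> (UNIV - E) \<noteq> {}}"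

definition boundary_invariant :: "'a::group_add measure \<Rightarrow> real \<Rightarrow> 'a set \<Rightarrow> 'a set \<Rightarrow> bool" where
  "boundary_invariant r \<epsilon> K E \<longleftrightarrow> vol r (K_boundary K E) \<le> ennreal \<epsilon> * vol r E"

definition folner_sequence :: "'a::topological_group_add measure \<Rightarrow> (nat \<Rightarrow> 'a set) \<Rightarrow> bool" where
  "folner_sequence r F \<longleftrightarrow>
     (\<forall>n. compact (F n) \<and> vol r (F n) > 0) \<and>
     (\<forall>\<epsilon>>0. \<forall>K. compact K \<longrightarrow> (\<forall>\<^sub>F n in sequentially. boundary_invariant r \<epsilon> K (F n)))"

definition amenable :: "'a::topological_group_add measure \<Rightarrow> bool" where
  "amenable r \<longleftrightarrow> (\<exists>F. folner_sequence r F)"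

definition lower_banach_density :: "'a::topological_group_add measure \<Rightarrow> 'a set \<Rightarrow> ennreal" where
  "lower_banach_density r E =
     (SUP K \<in> {K. compact K \<and> vol r K > 0}.
        INF g. vol r (left_translate g K \<inter> E) / vol r (left_translate g K))"

definition atomic_filtration ::
    "'a::topological_group_add measure \<Rightarrow> (nat \<Rightarrow> 'a set set) \<Rightarrow> bool" where
  "atomic_filtration r P \<longleftrightarrow>
     (\<forall>n. partition_on UNIV (P n) \<and> (\<forall>A\<in>P n. A \<in> sets r \<and> 0 < vol r A \<and> vol r A < \<infinity>)) \<and>
     (\<forall>n m. n \<le> m \<longrightarrow> (\<forall>A\<in>P n. \<exists>B\<in>P m. A \<subseteq> B))"

definition filtered_folner_sequence ::
    "'a::topological_group_add measure \<Rightarrow> (nat \<Rightarrow> 'a set) \<Rightarrow> (nat \<Rightarrow> 'a set) \<Rightarrow> (nat \<Rightarrow> 'a set set) \<Rightarrow> bool"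
  where
  "filtered_folner_sequence r F B P \<longleftrightarrow>
     folner_sequence r F \<and> (\<forall>n. compact (B n)) \<and> atomic_filtration r P \<and>
     (\<forall>n. \<forall>A\<in>P n. \<exists>\<gamma>. A \<subseteq> left_translate \<gamma> (B n)) \<and>
     (\<forall>n k. k \<le> n \<longrightarrow> boundary_invariant r (2 powi (int k - int n)) (B k) (F n))"

definition admissible_atoms ::
    "'a::group_add measure \<Rightarrow> (nat \<Rightarrow> 'a set) \<Rightarrow> (nat \<Rightarrow> 'a set set) \<Rightarrow> nat \<Rightarrow> 'a set set" where
  "admissible_atoms r F P k =
     {A \<in> P k. \<forall>n<k. invariant_set r (2 powi (int n - int k)) (F n) A}"

definition Adm ::
    "'a::group_add measure \<Rightarrow> (nat \<Rightarrow> 'a set) \<Rightarrow> (nat \<Rightarrow> 'a set set) \<Rightarrow> 'a set" where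
  "Adm r F P = (\<Inter>k. \<Union> (admissible_atoms r F P k))"

definition c_admissible ::
    "'a::topological_group_add measure \<Rightarrow> real \<Rightarrow> (nat \<Rightarrow> 'a set) \<Rightarrow> (nat \<Rightarrow> 'a set) \<Rightarrow> (nat \<Rightarrow> 'a set set) \<Rightarrow> bool"
  where
  "c_admissible r c F B P \<longleftrightarrow>
     filtered_folner_sequence r F B P \<and> lower_banach_density r (Adm r F P) \<ge> ennreal (1 - c)"

definition admissible ::
    "'a::topological_group_add measure \<Rightarrow> (nat \<Rightarrow> 'a set) \<Rightarrow> (nat \<Rightarrow> 'a set) \<Rightarrow> (nat \<Rightarrow> 'a set set) \<Rightarrow> bool"
  where
  "admissible r F B P \<longleftrightarrow> (\<exists>c. 0 < c \<and> c < 1 \<and> c_admissible r c F B P)"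

definition admissible_folner_sequence ::
    "'a::topological_group_add measure \<Rightarrow> (nat \<Rightarrow> 'a set) \<Rightarrow> bool" where
  "admissible_folner_sequence r F \<longleftrightarrow> folner_sequence r F \<and> (\<exists>B P. admissible r F B P)"

end

theory Submission
  imports Defs
begin

text \<open>
  All atoms can be made admissible. The key step coarsens a partition into bounded atoms to one
  all of whose atoms are bounded and almost invariant. First carve with translates of one Folner set: an averaging
  argument chooses each translate so that it cuts little of what is still uncovered. A configuration
  minimising the total measure of bad atoms in a large finite region then has small bad density in
  every Folner window. Averaging over windows gives a fractional assignment of the bad atoms to
  nearby good classes, which Hall's theorem makes integral; to keep single atoms small compared with
  the class absorbing them, the target window is shifted towards larger values of the modular
  function. Tychonoff's theorem passes from finite regions to the group. Iterating, with the
  Folner indices chosen alternately with the partitions, yields the filtration.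
\<close>

section \<open>Uniqueness of right Haar measure\<close>

text \<open>Outside unimodular groups the measure of a left translate depends on its position, so no
  absolute lower bound on atoms is available. The factor \<open>modular\<close> scales atoms,
  windows and boundaries alike, and every estimate is made relative to the local mass. The size
  condition in \<open>tame\<close> expresses this; its constant survives coarsening because atoms
  only grow, which makes the iteration possible.

  Carving a finite region bounds only the total of the bad atoms, while absorption needs them to be
  sparse around every single bad atom. Minimisation turns the global bound into a local one: a
  window with many bad atoms could be recarved so as to lower the total. Absorbed atoms may all
  count as boundary of the absorbing class, so only their total weight matters.

  Product sets that are not Borel do no harm, since they are covered by whole atoms. Tychonoff's
  theorem applies because the bound on the extent of the classes does not depend on the finite
  region. A compact group has no arbitrarily large compact sets and is treated apart, with a single
  atom.\<close>

lemma compact_set_plus: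
  fixes A B :: "'a::topological_monoid_add set"
  assumes "compact A" "compact B"
  shows "compact (A + B)"
proof -
  have "A + B = (\<lambda>z. fst z + snd z) ` (A \<times> B)"
    by (force simp: set_plus_def)
  moreover have "continuous_on (A \<times> B) (\<lambda>z. fst z + snd z)"
    by (intro continuous_intros)
  ultimately show ?thesis
    using compact_continuous_image compact_Times assms by metis
qed

lemma compact_uminus_image:
  fixes A :: "'a::topological_group_add set"
  assumes "compact A"
  shows "compact (uminus ` A)"
  by (intro compact_continuous_image continuous_intros assms)

lemma compact_left_translate:
  fixes A :: "'a::topological_group_add set"
  assumes "compact A"
  shows "compact (left_translate g A)"
  by (intro compact_continuous_image continuous_intros assms)

lemma left_translate_eq_vimage:
  "left_translate g A = {x. - g + x \<in> (A :: 'a::group_add set)}"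
proof (intro set_eqI iffI)
  fix x assume "x \<in> {x. - g + x \<in> A}"
  then have "- g + x \<in> A" "x = g + (- g + x)" by (simp_all add: add.assoc[symmetric])
  then show "x \<in> left_translate g A" by (rule rev_image_eqI)
qed (auto simp: add.assoc[symmetric])

lemma right_translate_eq_vimage:
  "right_translate A g = {x. x + - g \<in> (A :: 'a::group_add set)}"
proof (intro set_eqI iffI)
  fix x assume "x \<in> {x. x + - g \<in> A}"
  then have "x + - g \<in> A" "x = (x + - g) + g" by (simp_all add: add.assoc)
  then show "x \<in> right_translate A g" by (rule rev_image_eqI)
qed (auto simp: add.assoc)

text \<open>Sigma-finiteness stands in for finiteness on compact sets: it is what Fubini needs, and
  it is quickly checked for the left-translated measure to which uniqueness is applied.\<close>

definition right_invariant :: "'a::{topological_group_add, second_countable_topology} measure \<Rightarrow> bool" where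
  "right_invariant \<mu> \<longleftrightarrow> sets \<mu> = sets borel \<and> sigma_finite_measure \<mu> \<and>
     (\<forall>E\<in>sets borel. \<forall>p. emeasure \<mu> {x. x + p \<in> E} = emeasure \<mu> E)"

lemma right_invariant_nn_integral:
  fixes \<mu> :: "'a::{topological_group_add, second_countable_topology} measure"
  assumes "right_invariant \<mu>" and f[measurable]: "f \<in> borel_measurable borel"
  shows "(\<integral>\<^sup>+x. f (x + p) \<partial>\<mu>) = (\<integral>\<^sup>+x. f x \<partial>\<mu>)"
proof -
  have s[measurable_cong]: "sets \<mu> = sets borel" using assms by (simp add: right_invariant_def)
  have sp: "space \<mu> = UNIV" using sets_eq_imp_space_eq[OF s] by simp
  have "distr \<mu> borel (\<lambda>x. x + p) = \<mu>"
  proof (rule measure_eqI)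
    fix E assume "E \<in> sets (distr \<mu> borel (\<lambda>x. x + p))"
    then have [measurable]: "E \<in> sets borel" by simp
    have "emeasure (distr \<mu> borel (\<lambda>x. x + p)) E = emeasure \<mu> {x. x + p \<in> E}"
      by (subst emeasure_distr) (auto simp: sp vimage_def)
    then show "emeasure (distr \<mu> borel (\<lambda>x. x + p)) E = emeasure \<mu> E"
      using assms by (simp add: right_invariant_def)
  qed (simp add: s)
  then have "(\<integral>\<^sup>+x. f x \<partial>\<mu>) = (\<integral>\<^sup>+x. f x \<partial>distr \<mu> borel (\<lambda>x. x + p))" by simp
  also have "\<dots> = (\<integral>\<^sup>+x. f (x + p) \<partial>\<mu>)" by (subst nn_integral_distr) auto
  finally show ?thesis by simp
qed

text \<open>
  The right-hand side depends on \<open>\<mu>\<close> only through the factor \<open>\<mu> E\<close>; with \<open>\<nu>\<close> fixed this is the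
  uniqueness of right Haar measure. The substitutions amount to the change of variables
  \<open>(x, y) \<mapsto> (x + y, - x)\<close>, which preserves the product of two right-invariant measures.
\<close>
lemma right_invariant_representation:
  fixes \<mu> \<nu> :: "'a::{topological_group_add, second_countable_topology} measure"
  assumes mu: "right_invariant \<mu>" and nu: "right_invariant \<nu>"
    and E[measurable]: "E \<in> sets borel" and H[measurable]: "H \<in> sets borel"
    and pos: "\<And>x. 0 < emeasure \<nu> {y. x + y \<in> E}" "\<And>x. emeasure \<nu> {y. x + y \<in> E} < \<infinity>"
  shows "emeasure \<mu> H = emeasure \<mu> E *
    (\<integral>\<^sup>+y. indicator H (- y) / emeasure \<nu> {z. - y + z \<in> E} \<partial>\<nu>)"
proof -
  have smu[measurable_cong]: "sets \<mu> = sets borel" and snu[measurable_cong]: "sets \<nu> = sets borel"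
    using mu nu by (auto simp: right_invariant_def)
  interpret M: sigma_finite_measure \<mu> using mu by (simp add: right_invariant_def)
  interpret N: sigma_finite_measure \<nu> using nu by (simp add: right_invariant_def)
  interpret MN: pair_sigma_finite \<mu> \<nu> ..
  have spn: "space \<nu> = UNIV" using sets_eq_imp_space_eq[OF snu] by simp
  have spm: "space \<mu> = UNIV" using sets_eq_imp_space_eq[OF smu] by simp
  have [measurable]: "uminus \<in> borel_measurable (borel :: 'a measure)"
    by (intro borel_measurable_continuous_onI continuous_intros)
  define q where "q x = emeasure \<nu> {y. x + y \<in> E}" for x
  have [measurable]: "{p::'a\<times>'a. fst p + snd p \<in> E} \<in> sets (borel \<Otimes>\<^sub>M borel)"
  proof -
    have "(\<lambda>p::'a\<times>'a. fst p + snd p) -` E \<inter> space (borel \<Otimes>\<^sub>M borel) \<in> sets (borel \<Otimes>\<^sub>M borel)"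
      by measurable
    then show ?thesis by (simp add: vimage_def space_pair_measure)
  qed
  have q[measurable]: "q \<in> borel_measurable borel"
  proof -
    have "(\<lambda>x. emeasure \<nu> (Pair x -` {p::'a\<times>'a. fst p + snd p \<in> E})) \<in> borel_measurable borel"
      by (rule N.measurable_emeasure_Pair) (simp add: sets_pair_measure_cong[OF refl snu])
    then show ?thesis by (simp add: q_def[abs_def] vimage_def)
  qed
  \<comment> \<open>A factor one is inserted as an average over \<open>y\<close>; the later steps
    only move it by Fubini and by translations.\<close>
  have 1: "(\<integral>\<^sup>+y. indicator H x * indicator E (x + y) / q x \<partial>\<nu>) = indicator H x" for x
  proof -
    have "{y. x + y \<in> E} \<in> sets \<nu>"
    proof -
      have "(\<lambda>y. x + y) -` E \<inter> space borel \<in> sets borel" by measurable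
      then show ?thesis by (simp add: vimage_def snu)
    qed
    then have "(\<integral>\<^sup>+y. indicator {y. x + y \<in> E} y \<partial>\<nu>) = q x" by (simp add: q_def)
    then have "(\<integral>\<^sup>+y. (indicator H x / q x) * indicator E (x + y) \<partial>\<nu>) = (indicator H x / q x) * q x"
      by (subst nn_integral_cmult) (auto simp: indicator_def)
    moreover have "(indicator H x / q x) * q x = indicator H x"
    proof -
      have "q x \<noteq> 0" "q x \<noteq> \<infinity>" using pos[of x] by (auto simp: q_def)
      then show ?thesis by (metis ennreal_divide_times ennreal_mult_divide_eq ennreal_times_divide infinity_ennreal_def)
    qed
    moreover have "indicator H x * indicator E (x + y) / q x = (indicator H x / q x) * indicator E (x + y)" for y
      by (simp add: divide_ennreal_def mult_ac)
    ultimately show ?thesis by simp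
  qed
  have "emeasure \<mu> H = (\<integral>\<^sup>+x. \<integral>\<^sup>+y. indicator H x * indicator E (x + y) / q x \<partial>\<nu> \<partial>\<mu>)"
    unfolding 1 using H smu by (simp add: nn_integral_indicator)
  also have "\<dots> = (\<integral>\<^sup>+y. \<integral>\<^sup>+x. indicator H x * indicator E (x + y) / q x \<partial>\<mu> \<partial>\<nu>)"
    by (rule MN.Fubini'[symmetric]) measurable
  also have "\<dots> = (\<integral>\<^sup>+y. \<integral>\<^sup>+x. indicator H (x + - y) * indicator E x / q (x + - y) \<partial>\<mu> \<partial>\<nu>)"
  proof (rule nn_integral_cong)
    fix y
    have "(\<integral>\<^sup>+x. (\<lambda>x. indicator H x * indicator E (x + y) / q x) (x + - y) \<partial>\<mu>)
       = (\<integral>\<^sup>+x. (\<lambda>x. indicator H x * indicator E (x + y) / q x) x \<partial>\<mu>)"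
      by (rule right_invariant_nn_integral[OF mu]) measurable
    then show "(\<integral>\<^sup>+x. indicator H x * indicator E (x + y) / q x \<partial>\<mu>) =
      (\<integral>\<^sup>+x. indicator H (x + - y) * indicator E x / q (x + - y) \<partial>\<mu>)"
      by (simp add: add.assoc)
  qed
  also have "\<dots> = (\<integral>\<^sup>+x. \<integral>\<^sup>+y. indicator H (x + - y) * indicator E x / q (x + - y) \<partial>\<nu> \<partial>\<mu>)"
    by (rule MN.Fubini') measurable
  \<comment> \<open>For fixed \<open>x\<close>, replacing \<open>y\<close> by \<open>y + x\<close>
    removes \<open>x\<close> from the arguments of \<open>H\<close> and \<open>q\<close>, so the
    double integral factors.\<close>
  also have "\<dots> = (\<integral>\<^sup>+x. \<integral>\<^sup>+y. indicator H (- y) * indicator E x / q (- y) \<partial>\<nu> \<partial>\<mu>)"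
  proof (rule nn_integral_cong)
    fix x
    have "(\<integral>\<^sup>+y. (\<lambda>y. indicator H (x + - y) * indicator E x / q (x + - y)) (y + x) \<partial>\<nu>)
       = (\<integral>\<^sup>+y. (\<lambda>y. indicator H (x + - y) * indicator E x / q (x + - y)) y \<partial>\<nu>)"
      by (rule right_invariant_nn_integral[OF nu]) measurable
    moreover have "x + - (y + x) = - y" for y
      by (metis add_uminus_conv_diff diff_add_eq_diff_diff_swap diff_self diff_0)
    ultimately show "(\<integral>\<^sup>+y. indicator H (x + - y) * indicator E x / q (x + - y) \<partial>\<nu>) =
      (\<integral>\<^sup>+y. indicator H (- y) * indicator E x / q (- y) \<partial>\<nu>)"
      by simp
  qed
  also have "\<dots> = (\<integral>\<^sup>+x. indicator E x * (\<integral>\<^sup>+y. indicator H (- y) / q (- y) \<partial>\<nu>) \<partial>\<mu>)"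
    by (subst nn_integral_cmult[symmetric]) (auto simp: ennreal_times_divide mult.commute)
  also have "\<dots> = emeasure \<mu> E * (\<integral>\<^sup>+y. indicator H (- y) / q (- y) \<partial>\<nu>)"
    by (subst nn_integral_multc) (auto simp: smu)
  finally show ?thesis by (simp add: q_def)
qed

section \<open>The modular function\<close>

locale lc_haar =
  fixes r :: "'a::{topological_group_add, t2_space, second_countable_topology} measure"
  assumes lc: "locally_compact_space (euclidean :: 'a topology)"
    and haar: "right_haar_measure r"
begin

lemma sets_r [measurable_cong, simp]: "sets r = sets borel"
  using haar by (simp add: right_haar_measure_def)

lemma space_r [simp]: "space r = UNIV"
  using sets_eq_imp_space_eq[OF sets_r] by simp

lemma borel_compact: "compact K \<Longrightarrow> K \<in> sets (borel :: 'a measure)"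
  by (simp add: borel_closed compact_imp_closed)

lemma emeasure_compact_finite: "compact K \<Longrightarrow> emeasure r K < \<infinity>"
  using haar by (simp add: right_haar_measure_def)

lemma emeasure_right_vimage:
  assumes "E \<in> sets borel"
  shows "emeasure r {x. x + p \<in> E} = emeasure r E"
proof -
  have "emeasure r (right_translate E (- p)) = emeasure r E"
    using haar assms unfolding right_haar_measure_def by blast
  then show ?thesis by (simp only: right_translate_eq_vimage minus_minus)
qed

lemma borel_right_vimage:
  assumes "E \<in> sets (borel :: 'a measure)"
  shows "{x. x + p \<in> E} \<in> sets borel"
proof -
  have "(\<lambda>x. x + p) -` E \<inter> space borel \<in> sets borel" using assms by measurable
  then show ?thesis by (simp add: vimage_def)
qed

lemma borel_left_vimage:
  assumes "E \<in> sets (borel :: 'a measure)"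
  shows "{x. p + x \<in> E} \<in> sets borel"
proof -
  have "(\<lambda>x. p + x) -` E \<inter> space borel \<in> sets borel" using assms by measurable
  then show ?thesis by (simp add: vimage_def)
qed

lemma borel_left_translate:
  assumes "E \<in> sets (borel :: 'a measure)"
  shows "left_translate g E \<in> sets borel"
  using borel_left_vimage[OF assms, of "- g"] by (simp add: left_translate_eq_vimage)

section \<open>Positivity on open sets and sigma-finiteness\<close>

lemma ex_unit_nbhd: "\<exists>W U :: 'a set. open W \<and> compact U \<and> 0 \<in> W \<and> W \<subseteq> U"
  using lc unfolding locally_compact_space_def by auto

text \<open>Lindelof's theorem makes the cover countable. Right translates are used because
  \<open>r\<close> takes the same value on all of them.\<close>

lemma right_cover:
  assumes "open W" "(0::'a) \<in> W"
  obtains N where "countable N" "(\<Union>p\<in>N. {x. x + p \<in> W}) = UNIV"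
proof -
  define \<F> where "\<F> = (\<lambda>p. {x. x + p \<in> W}) ` (UNIV :: 'a set)"
  have "open S" if "S \<in> \<F>" for S
  proof -
    have "open ((\<lambda>x. x + p) -` W)" for p
      by (intro open_vimage assms continuous_intros)
    then show ?thesis using that by (auto simp: \<F>_def vimage_def)
  qed
  from Lindelof[OF this] obtain \<F>' where "\<F>' \<subseteq> \<F>" "countable \<F>'" "\<Union>\<F>' = \<Union>\<F>"
    by metis
  then obtain N where N: "countable N" "\<F>' = (\<lambda>p. {x. x + p \<in> W}) ` N"
    unfolding \<F>_def by (metis countable_subset_image)
  have "x \<in> \<Union>\<F>" for x
  proof -
    have "x \<in> {y. y + - x \<in> W}" using assms by simp
    then show ?thesis unfolding \<F>_def by blast
  qed
  then have "\<Union>\<F>' = UNIV" using \<open>\<Union>\<F>' = \<Union>\<F>\<close> by auto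
  then show ?thesis using that[OF N(1)] N(2) by auto
qed

text \<open>Otherwise the group would be a countable union of right translates of a null
  set.\<close>

lemma emeasure_open_pos:
  assumes "open W" "w \<in> (W::'a set)"
  shows "emeasure r W > 0"
proof (rule ccontr)
  define W0 where "W0 = {x. x + w \<in> W}"
  have o: "open W0"
  proof -
    have "open ((\<lambda>x. x + w) -` W)" by (intro open_vimage assms continuous_intros)
    then show ?thesis by (simp add: W0_def vimage_def)
  qed
  have "0 \<in> W0" using assms by (simp add: W0_def)
  from right_cover[OF o this] obtain N where N: "countable N" "(\<Union>p\<in>N. {x. x + p \<in> W0}) = UNIV" .
  assume "\<not> emeasure r W > 0"
  then have "emeasure r W0 = 0"
    using emeasure_right_vimage[of W w] assms by (simp add: W0_def borel_open)
  then have "emeasure r {x. x + p \<in> W0} = 0" for p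
    using emeasure_right_vimage[of W0 p] o by (simp add: borel_open)
  then have "{x. x + p \<in> W0} \<in> null_sets r" for p
    using o by (auto simp: null_sets_def intro!: borel_right_vimage)
  then have "(\<Union>p\<in>N. {x. x + p \<in> W0}) \<in> null_sets r"
    by (intro null_sets_UN' N)
  then show False using N(2) haar by (simp add: right_haar_measure_def null_sets_def)
qed

lemma right_invariant_r: "right_invariant r"
proof -
  obtain W U :: "'a set" where WU: "open W" "compact U" "0 \<in> W" "W \<subseteq> U" using ex_unit_nbhd by blast
  from right_cover[OF WU(1,3)] obtain N where N: "countable N" "(\<Union>p\<in>N. {x. x + p \<in> W}) = UNIV" .
  have "emeasure r W \<le> emeasure r U"
    using WU by (intro emeasure_mono) (simp_all add: borel_compact)
  also have "\<dots> < \<infinity>" by (rule emeasure_compact_finite[OF WU(2)])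
  finally have "emeasure r {x. x + p \<in> W} \<noteq> \<infinity>" for p
    using emeasure_right_vimage[of W p] WU(1) by (simp add: borel_open less_top)
  moreover have "{x. x + p \<in> W} \<in> sets borel" for p
    using WU by (intro borel_right_vimage) (simp add: borel_open)
  ultimately have "sigma_finite_measure r"
    unfolding sigma_finite_measure_def
    by (intro exI[of _ "(\<lambda>p. {x. x + p \<in> W}) ` N"]) (use N in \<open>simp add: image_subset_iff\<close>)
  then show ?thesis by (simp add: right_invariant_def emeasure_right_vimage)
qed

lemma emeasure_left_translate_compact:
  assumes "compact U"
  shows "emeasure r (left_translate g U) < \<infinity>"
  using emeasure_compact_finite compact_left_translate assms by blast

lemma left_translate_pos:
  assumes "open W" "0 \<in> W" "W \<subseteq> U" "U \<in> sets borel"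
  shows "emeasure r (left_translate g U) > 0"
proof -
  have "open ((\<lambda>x. - g + x) -` W)" by (intro open_vimage assms continuous_intros)
  then have "open (left_translate g W)" by (simp only: left_translate_eq_vimage vimage_def)
  moreover have "g + 0 \<in> left_translate g W" using assms by blast
  ultimately have "0 < emeasure r (left_translate g W)" using emeasure_open_pos by blast
  also have "\<dots> \<le> emeasure r (left_translate g U)"
    by (rule emeasure_mono) (use assms in \<open>auto intro: borel_left_translate\<close>)
  finally show ?thesis .
qed

definition unit_nbhd :: "'a set" where
  "unit_nbhd = (SOME U. compact U \<and> (\<exists>W. open W \<and> 0 \<in> W \<and> W \<subseteq> U))"

lemma unit_nbhd: "compact unit_nbhd" "\<exists>W. open W \<and> 0 \<in> W \<and> W \<subseteq> unit_nbhd"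
proof -
  have "\<exists>U::'a set. compact U \<and> (\<exists>W. open W \<and> 0 \<in> W \<and> W \<subseteq> U)" using ex_unit_nbhd by blast
  from someI_ex[OF this] show "compact unit_nbhd" "\<exists>W. open W \<and> 0 \<in> W \<and> W \<subseteq> unit_nbhd"
    unfolding unit_nbhd_def by blast+
qed

lemma unit_nbhd_translate:
  "0 < emeasure r (left_translate g unit_nbhd)" "emeasure r (left_translate g unit_nbhd) < \<infinity>"
proof -
  obtain W where "open W" "0 \<in> W" "W \<subseteq> unit_nbhd" using unit_nbhd(2) by blast
  then show "0 < emeasure r (left_translate g unit_nbhd)"
    using left_translate_pos borel_compact unit_nbhd(1) by blast
  show "emeasure r (left_translate g unit_nbhd) < \<infinity>"
    using emeasure_left_translate_compact unit_nbhd(1) by blast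
qed

text \<open>This is the modular function (or its inverse, conventions differ), read off from one
  reference set. That the same factor works for every Borel set is
  \<open>emeasure_left_translate\<close>.\<close>

definition modular :: "'a \<Rightarrow> real" where
  "modular g = measure r (left_translate g unit_nbhd) / measure r unit_nbhd"

lemma left_translate_add: "left_translate g (left_translate h E) = left_translate (g + h :: 'a) E"
  by (simp add: image_image add.assoc)

lemma emeasure_unit_nbhd: "emeasure r (left_translate g unit_nbhd) = ennreal (measure r (left_translate g unit_nbhd))"
  using unit_nbhd_translate[of g] by (simp add: emeasure_eq_ennreal_measure)

lemma measure_unit_nbhd_pos: "0 < measure r (left_translate g unit_nbhd)"
  using unit_nbhd_translate[of g] by (metis emeasure_unit_nbhd ennreal_0 ennreal_neg less_irrefl not_le_imp_less)

lemma modular_pos: "0 < modular g"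
  using measure_unit_nbhd_pos[of g] measure_unit_nbhd_pos[of 0] by (simp add: modular_def)

text \<open>Left and right translations commute, so the left-translated measure \<mu> is again right
  invariant. By the representation formula with \<open>r\<close> as second measure, \<mu> and
  \<open>r\<close> both equal their value on \<open>unit_nbhd\<close> times the same
  integral.\<close>

lemma emeasure_left_translate:
  assumes E: "E \<in> sets borel"
  shows "emeasure r (left_translate g E) = ennreal (modular g) * emeasure r E"
proof -
  define \<mu> where "\<mu> = distr r borel (\<lambda>x. - g + x)"
  have mu: "emeasure \<mu> H = emeasure r (left_translate g H)" if "H \<in> sets borel" for H
    unfolding \<mu>_def left_translate_eq_vimage using that
    by (subst emeasure_distr) (auto simp: vimage_def)
  have "right_invariant \<mu>"
    unfolding right_invariant_def
  proof (intro conjI ballI allI)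
    show "sets \<mu> = sets borel" by (simp add: \<mu>_def)
    show "emeasure \<mu> {x. x + p \<in> H} = emeasure \<mu> H" if H: "H \<in> sets borel" for H p
    proof -
      have "left_translate g {x. x + p \<in> H} = {x. x + p \<in> left_translate g H}"
        by (simp add: left_translate_eq_vimage add.assoc)
      then show ?thesis
        using H emeasure_right_vimage[of "left_translate g H"]
        by (simp add: mu borel_right_vimage borel_left_translate)
    qed
    obtain A where A: "countable A" "A \<subseteq> sets r" "\<Union>A = space r" "\<forall>a\<in>A. emeasure r a \<noteq> \<infinity>"
      using right_invariant_r unfolding right_invariant_def by (metis sigma_finite_measure.sigma_finite_countable)
    show "sigma_finite_measure \<mu>"
    proof (intro sigma_finite_measure.intro exI[of _ "(\<lambda>a. left_translate (- g) a) ` A"] conjI ballI)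
      show "countable (left_translate (- g) ` A)" using A by blast
      show "left_translate (- g) ` A \<subseteq> sets \<mu>"
        using A by (auto simp: \<mu>_def intro!: borel_left_translate)
      have "x \<in> \<Union> (left_translate (- g) ` A)" for x
      proof -
        obtain a where "a \<in> A" "g + x \<in> a" using A(3) by (metis UNIV_I UnionE space_r)
        then have "- g + (g + x) \<in> left_translate (- g) a" by blast
        then show ?thesis using \<open>a \<in> A\<close> by (auto simp: add.assoc[symmetric])
      qed
      then show "\<Union> (left_translate (- g) ` A) = space \<mu>" by (auto simp: \<mu>_def)
      show "emeasure \<mu> a \<noteq> \<infinity>" if a: "a \<in> left_translate (- g) ` A" for a
      proof -
        obtain b where b: "b \<in> A" "a = left_translate (- g) b" using a by blast
        then have "emeasure \<mu> a = emeasure r b"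
          using A by (subst mu) (auto intro!: borel_left_translate simp: image_image add.assoc[symmetric])
        then show ?thesis using A b by auto
      qed
    qed
  qed
  moreover have pos: "0 < emeasure r {y. x + y \<in> unit_nbhd}" "emeasure r {y. x + y \<in> unit_nbhd} < \<infinity>" for x
    using unit_nbhd_translate[of "- x"] by (simp_all only: left_translate_eq_vimage minus_minus)
  ultimately have rep: "emeasure \<mu> E = emeasure \<mu> unit_nbhd *
      (\<integral>\<^sup>+y. indicator E (- y) / emeasure r {z. - y + z \<in> unit_nbhd} \<partial>r)"
    using right_invariant_representation[of \<mu> r unit_nbhd E] right_invariant_r E unit_nbhd(1)
    by (auto intro: borel_compact)
  have rep': "emeasure r E = emeasure r unit_nbhd *
      (\<integral>\<^sup>+y. indicator E (- y) / emeasure r {z. - y + z \<in> unit_nbhd} \<partial>r)"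
    using right_invariant_representation[of r r unit_nbhd E] right_invariant_r E unit_nbhd(1) pos
    by (auto intro: borel_compact)
  have "emeasure \<mu> unit_nbhd = ennreal (modular g) * emeasure r unit_nbhd"
  proof -
    have "emeasure \<mu> unit_nbhd = emeasure r (left_translate g unit_nbhd)"
      using mu unit_nbhd(1) borel_compact by blast
    also have "\<dots> = ennreal (modular g * measure r unit_nbhd)"
      using measure_unit_nbhd_pos[of 0] by (simp add: emeasure_unit_nbhd modular_def)
    also have "\<dots> = ennreal (modular g) * emeasure r unit_nbhd"
      using emeasure_unit_nbhd[of 0] modular_pos[of g] by (simp add: ennreal_mult)
    finally show ?thesis .
  qed
  then show ?thesis using rep rep' mu[OF E] by (simp add: mult.assoc)
qed

section \<open>The modular function as a homomorphism, and its bounds on compact sets\<close>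

lemma modular_add: "modular (g + h) = modular g * modular h"
proof -
  have "emeasure r (left_translate (g + h) unit_nbhd)
      = ennreal (modular g) * (ennreal (modular h) * emeasure r unit_nbhd)"
    unfolding left_translate_add[symmetric]
    using unit_nbhd(1) by (simp add: emeasure_left_translate borel_left_translate borel_compact)
  then have "ennreal (modular (g + h)) * emeasure r unit_nbhd = ennreal (modular g * modular h) * emeasure r unit_nbhd"
    using unit_nbhd(1) modular_pos[THEN less_imp_le]
    by (simp add: emeasure_left_translate borel_compact ennreal_mult mult.assoc)
  then have "ennreal (modular (g + h) * measure r unit_nbhd) = ennreal ((modular g * modular h) * measure r unit_nbhd)"
    using emeasure_unit_nbhd[of 0] modular_pos[THEN less_imp_le] by (simp add: ennreal_mult)
  then show ?thesis
    using measure_unit_nbhd_pos[of 0] modular_pos[THEN less_imp_le]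
    by (subst (asm) ennreal_inj) auto
qed

lemma modular_0 [simp]: "modular 0 = 1"
  using measure_unit_nbhd_pos[of 0] by (simp add: modular_def)

lemma modular_uminus: "modular (- g) = inverse (modular g)"
  using modular_add[of g "- g"] modular_pos[of g] by (simp add: field_simps)

text \<open>Comparing measures replaces continuity: for \<open>g\<close> in \<open>C\<close> the
  translate of \<open>unit_nbhd\<close> lies in the compact set \<open>C + unit_nbhd\<close>. The
  added \<open>1\<close> keeps the bound positive when \<open>C\<close> is empty.\<close>

lemma modular_bounded:
  assumes "compact C"
  obtains M where "M > 0" "\<And>g. g \<in> C \<Longrightarrow> modular g \<le> M"
proof
  let ?R = "measure r (C + unit_nbhd) / measure r unit_nbhd"
  have c: "compact (C + unit_nbhd)" using assms unit_nbhd(1) by (rule compact_set_plus)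
  show "?R + 1 > 0" by (simp add: add_nonneg_pos)
  fix g assume "g \<in> C"
  then have "left_translate g unit_nbhd \<subseteq> C + unit_nbhd" by (auto intro: set_plus_intro)
  then have "measure r (left_translate g unit_nbhd) \<le> measure r (C + unit_nbhd)"
    using emeasure_compact_finite[OF c]
    by (intro measure_mono_fmeasurable fmeasurableI)
      (auto simp: borel_compact c unit_nbhd compact_left_translate)
  then show "modular g \<le> ?R + 1"
    unfolding modular_def by (meson divide_right_mono measure_nonneg less_add_one order_trans less_imp_le)
qed

text \<open>The sets in question need not be Borel, so the estimate passes through a Borel hull. The
  one-sided form suffices for bounding boundaries from above.\<close>

lemma vol_left_translate_le: "vol r (left_translate g E) \<le> ennreal (modular g) * vol r E"
proof -
  obtain E' where E': "E' \<in> sets r" "E \<subseteq> E'" "vol r E = emeasure r E'"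
    using outer_measure_of_attain[of E r] by auto
  have "vol r (left_translate g E) \<le> vol r (left_translate g E')"
    by (intro outer_measure_of_mono image_mono E')
  also have "\<dots> = ennreal (modular g) * emeasure r E'"
    using E' by (simp add: emeasure_left_translate borel_left_translate)
  finally show ?thesis using E' by simp
qed

lemma vol_right_vimage_le: "vol r {x. x + p \<in> E} \<le> vol r E"
proof -
  obtain E' where E': "E' \<in> sets r" "E \<subseteq> E'" "vol r E = emeasure r E'"
    using outer_measure_of_attain[of E r] by auto
  have "vol r {x. x + p \<in> E} \<le> vol r {x. x + p \<in> E'}"
    using E' by (intro outer_measure_of_mono) auto
  also have "\<dots> = emeasure r E'"
    using E' by (simp add: emeasure_right_vimage borel_right_vimage)
  finally show ?thesis using E' by simp
qed

text \<open>For a non-unimodular group the powers of a suitable element do this.\<close>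
lemma modular_dominating:
  assumes "compact V"
  obtains h where "\<And>k k'. k \<in> V \<Longrightarrow> k' \<in> V \<Longrightarrow> modular k \<le> modular h * modular k'"
proof (cases "\<exists>g. modular g \<noteq> 1")
  case False
  then show ?thesis using that[of 0] by auto
next
  case True
  then obtain g0 where "modular g0 \<noteq> 1" by blast
  then obtain g where g: "modular g > 1"
    using modular_uminus[of g0] modular_pos[of g0]
    by (metis inverse_inverse_eq linorder_neqE_linordered_idom one_less_inverse)
  obtain M where M: "M > 0" "\<And>k. k \<in> V \<Longrightarrow> modular k \<le> M" using modular_bounded[OF assms] by blast
  obtain M' where M': "M' > 0" "\<And>k. k \<in> uminus ` V \<Longrightarrow> modular k \<le> M'"
    using modular_bounded[OF compact_uminus_image[OF assms]] by blast
  \<comment> \<open>\<open>M'\<close> bounds the inverse of \<open>modular k'\<close>, so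
    \<open>M * M'\<close> bounds all quotients \<open>modular k / modular k'\<close>.\<close>
  obtain n where n: "M * M' < modular g ^ n" using real_arch_pow[OF g] by blast
  have "\<exists>h. modular h = modular g ^ n"
  proof (induction n)
    case 0 show ?case by (intro exI[of _ 0]) simp
  next
    case (Suc n) then show ?case by (metis modular_add power_Suc)
  qed
  then obtain h where h: "modular h = modular g ^ n" by blast
  show ?thesis
  proof (rule that)
    fix k k' assume k: "k \<in> V" "k' \<in> V"
    have "modular (- k') \<le> M'" using M'(2) k by blast
    then have "1 \<le> M' * modular k'"
      using modular_pos[of k'] by (simp add: modular_uminus field_simps)
    then have "modular k \<le> M * (M' * modular k')"
      using M k by (metis mult.right_neutral mult_left_mono order_trans less_imp_le)
    also have "\<dots> \<le> modular h * modular k'"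
      using n h modular_pos[of k'] by (simp add: mult.assoc[symmetric])
    finally show "modular k \<le> modular h * modular k'" .
  qed
qed

end

section \<open>Assignment, rounding and compactness\<close>

text \<open>The induction of Halmos and Vaughan: either split at a proper tight set, or every proper
  nonempty subset has a spare neighbour, and then any \<open>x\<close> may take any partner.\<close>

lemma hall_marriage:
  assumes "finite X" "\<And>x. x \<in> X \<Longrightarrow> finite (N x)"
    and "\<And>S. S \<subseteq> X \<Longrightarrow> card S \<le> card (\<Union>(N ` S))"
  shows "\<exists>f. inj_on f X \<and> (\<forall>x\<in>X. f x \<in> N x)"
  using assms
proof (induction "card X" arbitrary: X N rule: less_induct)
  case less
  note hall = less.prems(3) and finN = less.prems(2)
  show ?case
  proof (cases "X = {}")
    case False
    then obtain x where x: "x \<in> X" by blast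
    show ?thesis
    proof (cases "\<exists>S. S \<noteq> {} \<and> S \<subset> X \<and> card S = card (\<Union>(N ` S))")
      case True
      then obtain S where S: "S \<noteq> {}" "S \<subset> X" "card S = card (\<Union>(N ` S))" by blast
      have finS: "finite S" using S less.prems(1) by (meson finite_subset psubset_imp_subset)
      have finNS: "finite (\<Union>(N ` S))" using S finS finN by auto
      have "card S < card X" using S(2) less.prems(1) psubset_card_mono by blast
      then have "\<exists>f. inj_on f S \<and> (\<forall>x\<in>S. f x \<in> N x)"
        using S by (intro less.hyps) (auto intro!: hall finN finS)
      then obtain f where f: "inj_on f S" "\<forall>x\<in>S. f x \<in> N x" by blast
      define N' where "N' y = N y - \<Union>(N ` S)" for y
      \<comment> \<open>Hall's condition survives the removal of the neighbours of \<open>S\<close>: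
        apply it to \<open>T \<union> S\<close> and cancel the tight set \<open>S\<close>.\<close>
      have "\<exists>g. inj_on g (X - S) \<and> (\<forall>x\<in>X - S. g x \<in> N' x)"
      proof (rule less.hyps)
        show "card (X - S) < card X"
          using S less.prems(1) by (intro psubset_card_mono) auto
        show "finite (X - S)" "\<And>x. x \<in> X - S \<Longrightarrow> finite (N' x)"
          using less.prems(1) finN by (auto simp: N'_def)
        fix T assume T: "T \<subseteq> X - S"
        have finT: "finite T" using T less.prems(1) by (meson finite_Diff finite_subset)
        have "card T + card S = card (T \<union> S)"
          using T finT finS by (subst card_Un_disjoint) auto
        also have "\<dots> \<le> card (\<Union>(N ` (T \<union> S)))" using T S by (intro hall) auto
        also have "\<Union>(N ` (T \<union> S)) = \<Union>(N' ` T) \<union> \<Union>(N ` S)" by (auto simp: N'_def)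
        also have "card \<dots> \<le> card (\<Union>(N' ` T)) + card (\<Union>(N ` S))" by (rule card_Un_le)
        finally show "card T \<le> card (\<Union>(N' ` T))" using S by simp
      qed
      then obtain g where g: "inj_on g (X - S)" "\<forall>x\<in>X - S. g x \<in> N' x" by blast
      define h where "h y = (if y \<in> S then f y else g y)" for y
      have "f a \<noteq> g b" if "a \<in> S" "b \<in> X - S" for a b
        using f(2) g(2) that by (metis DiffD2 N'_def UN_I)
      then have "inj_on h X"
        using f(1) g(1) unfolding h_def inj_on_def by (metis DiffI)
      moreover have "\<forall>x\<in>X. h x \<in> N x" using f g by (auto simp: h_def N'_def)
      ultimately show ?thesis by blast
    next
      case False
      have "card {x} \<le> card (\<Union>(N ` {x}))" using x by (intro hall) auto
      then obtain y where y: "y \<in> N x" by fastforce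
      define N' where "N' z = N z - {y}" for z
      have "\<exists>g. inj_on g (X - {x}) \<and> (\<forall>z\<in>X - {x}. g z \<in> N' z)"
      proof (rule less.hyps)
        show "card (X - {x}) < card X" using x less.prems(1) by (rule card_Diff1_less[rotated])
        show "finite (X - {x})" "\<And>z. z \<in> X - {x} \<Longrightarrow> finite (N' z)"
          using less.prems(1) finN by (auto simp: N'_def)
        fix T assume T: "T \<subseteq> X - {x}"
        show "card T \<le> card (\<Union>(N' ` T))"
        proof (cases "T = {}")
          case nonempty: False
          have "T \<subset> X" using T x by auto
          then have "card T \<noteq> card (\<Union>(N ` T))" "card T \<le> card (\<Union>(N ` T))"
            using False nonempty hall[of T] by auto
          moreover have "\<Union>(N' ` T) = \<Union>(N ` T) - {y}" by (auto simp: N'_def)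
          then have "card (\<Union>(N ` T)) \<le> card (\<Union>(N' ` T)) + 1"
            by (simp add: card_Diff_singleton_if) linarith
          ultimately show ?thesis by linarith
        qed simp
      qed
      then obtain g where g: "inj_on g (X - {x})" "\<forall>z\<in>X - {x}. g z \<in> N' z" by blast
      have "inj_on (g(x := y)) X"
        using g by (auto simp: inj_on_def N'_def)
      moreover have "\<forall>z\<in>X. (g(x := y)) z \<in> N z" using g y by (auto simp: N'_def)
      ultimately show ?thesis by blast
    qed
  qed simp
qed

text \<open>Each \<open>y\<close> gets as many slots as its fractional load rounded up, which is the
  origin of the \<open>+ 1\<close>. Hall's condition holds because the items in \<open>S\<close>
  carry total share \<open>card S\<close>, and all of it lands on the neighbours of
  \<open>S\<close>, within their slots.\<close>

lemma fractional_assignment_rounding: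
  fixes \<phi> :: "'x \<Rightarrow> 'y \<Rightarrow> real"
  assumes fin: "finite X" "finite Y"
    and nonneg: "\<And>x y. x \<in> X \<Longrightarrow> y \<in> Y \<Longrightarrow> 0 \<le> \<phi> x y"
    and total: "\<And>x. x \<in> X \<Longrightarrow> (\<Sum>y\<in>Y. \<phi> x y) = 1"
  shows "\<exists>f. (\<forall>x\<in>X. f x \<in> Y \<and> 0 < \<phi> x (f x)) \<and>
    (\<forall>y\<in>Y. real (card {x \<in> X. f x = y}) \<le> (\<Sum>x\<in>X. \<phi> x y) + 1)"
proof -
  define n where "n y = nat \<lceil>\<Sum>x\<in>X. \<phi> x y\<rceil>" for y
  define Z where "Z S = {y \<in> Y. \<exists>x\<in>S. 0 < \<phi> x y}" for S
  define N where "N x = Sigma (Z {x}) (\<lambda>y. {..<n y})" for x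
  have finZ: "finite (Z S)" for S using fin by (simp add: Z_def)
  have "\<exists>f. inj_on f X \<and> (\<forall>x\<in>X. f x \<in> N x)"
  proof (rule hall_marriage)
    show "finite X" "\<And>x. finite (N x)" using fin finZ by (auto simp: N_def)
    fix S assume S: "S \<subseteq> X"
    have "\<Union>(N ` S) = Sigma (Z S) (\<lambda>y. {..<n y})"
      by (auto simp: N_def Z_def)
    then have c: "card (\<Union>(N ` S)) = (\<Sum>y\<in>Z S. n y)" using finZ by simp
    have "real (card S) = (\<Sum>x\<in>S. \<Sum>y\<in>Y. \<phi> x y)" using S by (simp add: total subset_iff)
    also have "\<dots> = (\<Sum>y\<in>Y. \<Sum>x\<in>S. \<phi> x y)" by (rule sum.swap)
    also have "\<dots> = (\<Sum>y\<in>Z S. \<Sum>x\<in>S. \<phi> x y)"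
    proof (rule sum.mono_neutral_right)
      show "\<forall>y\<in>Y - Z S. (\<Sum>x\<in>S. \<phi> x y) = 0"
      proof (intro ballI sum.neutral)
        fix y x assume y: "y \<in> Y - Z S" and x: "x \<in> S"
        then have "\<not> 0 < \<phi> x y" by (auto simp: Z_def)
        moreover have "0 \<le> \<phi> x y" using nonneg S x y by blast
        ultimately show "\<phi> x y = 0" by simp
      qed
    qed (use fin in \<open>auto simp: Z_def\<close>)
    also have "\<dots> \<le> (\<Sum>y\<in>Z S. real (n y))"
    proof (rule sum_mono)
      fix y assume "y \<in> Z S"
      then have "(\<Sum>x\<in>S. \<phi> x y) \<le> (\<Sum>x\<in>X. \<phi> x y)"
        using S fin nonneg by (intro sum_mono2) (auto simp: Z_def)
      also have "\<dots> \<le> real (n y)" unfolding n_def by linarith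
      finally show "(\<Sum>x\<in>S. \<phi> x y) \<le> real (n y)" .
    qed
    finally show "card S \<le> card (\<Union>(N ` S))" unfolding c by (metis of_nat_sum of_nat_le_iff)
  qed
  then obtain f where f: "inj_on f X" "\<And>x. x \<in> X \<Longrightarrow> f x \<in> N x" by blast
  have "real (card {x \<in> X. fst (f x) = y}) \<le> (\<Sum>x\<in>X. \<phi> x y) + 1" if "y \<in> Y" for y
  proof -
    have "card {x \<in> X. fst (f x) = y} = card (f ` {x \<in> X. fst (f x) = y})"
      using f(1) by (intro card_image[symmetric]) (auto simp: inj_on_def)
    also have "\<dots> \<le> card ({y} \<times> {..<n y})"
    proof (rule card_mono)
      show "f ` {x \<in> X. fst (f x) = y} \<subseteq> {y} \<times> {..<n y}"
      proof
        fix z assume "z \<in> f ` {x \<in> X. fst (f x) = y}"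
        then obtain x where x: "x \<in> X" "z = f x" "fst z = y" by auto
        then have "z \<in> N x" using f(2) by simp
        then show "z \<in> {y} \<times> {..<n y}" using x(3) by (auto simp: N_def)
      qed
    qed simp
    also have "\<dots> = n y" by simp
    finally have "real (card {x \<in> X. fst (f x) = y}) \<le> real (n y)" by simp
    moreover have "0 \<le> (\<Sum>x\<in>X. \<phi> x y)" using that nonneg by (intro sum_nonneg) auto
    ultimately show ?thesis unfolding n_def by linarith
  qed
  moreover have "fst (f x) \<in> Y \<and> 0 < \<phi> x (fst (f x))" if "x \<in> X" for x
    using f(2)[OF that] by (auto simp: N_def Z_def)
  ultimately show ?thesis by (intro exI[of _ "\<lambda>x. fst (f x)"]) auto
qed

text \<open>The exponents are integers, so below the largest exponent \<open>m\<close> all powers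
  are at most \<open>2 powr m / 2\<close>; the induction hypothesis with this bound makes the rest
  sum to at most \<open>2 powr m\<close>.\<close>

lemma sum_distinct_powers_of_two:
  fixes J :: "int set" and b :: real
  assumes "finite J" "\<And>j. j \<in> J \<Longrightarrow> 2 powr j \<le> b" "0 \<le> b"
  shows "(\<Sum>j\<in>J. 2 powr j) \<le> 2 * b"
  using assms
proof (induction J arbitrary: b rule: finite_linorder_max_induct)
  case (insert m A)
  have "(\<Sum>j\<in>A. 2 powr real_of_int j) \<le> 2 * (2 powr m / 2)"
  proof (rule insert.IH)
    fix j assume "j \<in> A"
    then have "real_of_int j \<le> real_of_int m - 1" using insert.hyps(2) by fastforce
    then have "2 powr real_of_int j \<le> 2 powr (real_of_int m - 1)" by simp
    then show "2 powr real_of_int j \<le> 2 powr m / 2" by (simp add: powr_diff)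
  qed simp
  moreover have "2 powr m \<le> b" using insert.prems(1) by simp
  ultimately show ?case using insert.hyps by auto
qed simp

text \<open>
  Rounding within each dyadic weight class costs one extra item per class; the classes that can
  reach \<open>y\<close> contribute a geometric sum bounded by \<open>b y\<close>.
\<close>
lemma weighted_assignment_rounding:
  fixes \<phi> :: "'x \<Rightarrow> 'y \<Rightarrow> real" and w :: "'x \<Rightarrow> real"
  assumes fin: "finite X" "finite Y"
    and nonneg: "\<And>x y. x \<in> X \<Longrightarrow> y \<in> Y \<Longrightarrow> 0 \<le> \<phi> x y"
    and total: "\<And>x. x \<in> X \<Longrightarrow> (\<Sum>y\<in>Y. \<phi> x y) = 1"
    and w: "\<And>x. x \<in> X \<Longrightarrow> 0 < w x"
    and b: "\<And>x y. x \<in> X \<Longrightarrow> y \<in> Y \<Longrightarrow> 0 < \<phi> x y \<Longrightarrow> w x \<le> b y"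
      "\<And>y. y \<in> Y \<Longrightarrow> 0 \<le> b y"
  shows "\<exists>f. (\<forall>x\<in>X. f x \<in> Y \<and> 0 < \<phi> x (f x)) \<and>
    (\<forall>y\<in>Y. (\<Sum>x\<in>{x \<in> X. f x = y}. w x) \<le> 2 * (\<Sum>x\<in>X. w x * \<phi> x y) + 4 * b y)"
proof -
  define c where "c x = \<lfloor>log 2 (w x)\<rfloor>" for x
  define Xc where "Xc j = {x \<in> X. c x = j}" for j
  have lo: "2 powr c x \<le> w x" and hi: "w x \<le> 2 * 2 powr c x" if "x \<in> X" for x
  proof -
    have l: "2 powr log 2 (w x) = w x" using w[OF that] by simp
    have "2 powr c x \<le> 2 powr log 2 (w x)" unfolding c_def by simp
    then show "2 powr c x \<le> w x" using l by simp
    have "2 powr log 2 (w x) \<le> 2 powr (1 + real_of_int (c x))"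
      unfolding c_def by (intro powr_mono) linarith+
    then show "w x \<le> 2 * 2 powr c x" using l by (simp add: powr_add)
  qed
  have "\<forall>j. \<exists>f. (\<forall>x\<in>Xc j. f x \<in> Y \<and> 0 < \<phi> x (f x)) \<and>
    (\<forall>y\<in>Y. real (card {x \<in> Xc j. f x = y}) \<le> (\<Sum>x\<in>Xc j. \<phi> x y) + 1)"
  proof
    fix j
    have "finite (Xc j)" "Xc j \<subseteq> X" using fin by (auto simp: Xc_def)
    then show "\<exists>f. (\<forall>x\<in>Xc j. f x \<in> Y \<and> 0 < \<phi> x (f x)) \<and>
      (\<forall>y\<in>Y. real (card {x \<in> Xc j. f x = y}) \<le> (\<Sum>x\<in>Xc j. \<phi> x y) + 1)"
      using fin nonneg total by (intro fractional_assignment_rounding) (simp_all add: subset_iff)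
  qed
  from choice[OF this] obtain F where "\<forall>j. (\<forall>x\<in>Xc j. F j x \<in> Y \<and> 0 < \<phi> x (F j x)) \<and>
    (\<forall>y\<in>Y. real (card {x \<in> Xc j. F j x = y}) \<le> (\<Sum>x\<in>Xc j. \<phi> x y) + 1)" ..
  then have F: "\<And>j x. x \<in> Xc j \<Longrightarrow> F j x \<in> Y \<and> 0 < \<phi> x (F j x)"
    "\<And>j y. y \<in> Y \<Longrightarrow> real (card {x \<in> Xc j. F j x = y}) \<le> (\<Sum>x\<in>Xc j. \<phi> x y) + 1"
    by blast+
  define f where "f x = F (c x) x" for x
  have f: "f x \<in> Y \<and> 0 < \<phi> x (f x)" if "x \<in> X" for x
    using F(1)[of x "c x"] that by (simp add: f_def Xc_def)
  have "(\<Sum>x\<in>{x \<in> X. f x = y}. w x) \<le> 2 * (\<Sum>x\<in>X. w x * \<phi> x y) + 4 * b y" if y: "y \<in> Y" for y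
  proof -
    define J where "J = c ` {x \<in> X. f x = y}"
    have finJ: "finite J" using fin by (simp add: J_def)
    have "(\<Sum>x\<in>{x \<in> X. f x = y}. w x) = (\<Sum>j\<in>J. \<Sum>x\<in>{x \<in> {x \<in> X. f x = y}. c x = j}. w x)"
      using fin unfolding J_def by (intro sum.image_gen) auto
    also have "\<dots> \<le> (\<Sum>j\<in>J. 2 * (\<Sum>x\<in>Xc j. w x * \<phi> x y) + 2 * 2 powr j)"
    proof (rule sum_mono)
      fix j assume "j \<in> J"
      have eq: "{x \<in> {x \<in> X. f x = y}. c x = j} = {x \<in> Xc j. F j x = y}"
        by (auto simp: Xc_def f_def)
      have "(\<Sum>x\<in>{x \<in> Xc j. F j x = y}. w x) \<le> (\<Sum>x\<in>{x \<in> Xc j. F j x = y}. 2 * 2 powr j)"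
        using hi by (intro sum_mono) (auto simp: Xc_def)
      also have "\<dots> = real (card {x \<in> Xc j. F j x = y}) * (2 * 2 powr j)" by simp
      also have "\<dots> \<le> ((\<Sum>x\<in>Xc j. \<phi> x y) + 1) * (2 * 2 powr j)"
        using F(2)[OF y] by (intro mult_right_mono) auto
      also have "\<dots> = 2 * (\<Sum>x\<in>Xc j. 2 powr j * \<phi> x y) + 2 * 2 powr j"
        by (simp add: algebra_simps sum_distrib_left)
      also have "\<dots> \<le> 2 * (\<Sum>x\<in>Xc j. w x * \<phi> x y) + 2 * 2 powr j"
        using lo nonneg y by (auto intro!: sum_mono mult_right_mono simp: Xc_def)
      finally show "(\<Sum>x\<in>{x \<in> {x \<in> X. f x = y}. c x = j}. w x) \<le> 2 * (\<Sum>x\<in>Xc j. w x * \<phi> x y) + 2 * 2 powr j"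
        unfolding eq .
    qed
    also have "\<dots> = 2 * (\<Sum>j\<in>J. \<Sum>x\<in>Xc j. w x * \<phi> x y) + 2 * (\<Sum>j\<in>J. 2 powr j)"
      by (simp add: sum.distrib sum_distrib_left)
    also have "(\<Sum>j\<in>J. \<Sum>x\<in>Xc j. w x * \<phi> x y) \<le> (\<Sum>x\<in>X. w x * \<phi> x y)"
    proof -
      have "(\<Sum>j\<in>J. \<Sum>x\<in>Xc j. w x * \<phi> x y) \<le> (\<Sum>j\<in>c ` X. \<Sum>x\<in>Xc j. w x * \<phi> x y)"
        using fin nonneg w y
        by (intro sum_mono2 sum_nonneg mult_nonneg_nonneg) (auto simp: J_def Xc_def less_imp_le)
      also have "\<dots> = (\<Sum>x\<in>X. w x * \<phi> x y)"
        unfolding Xc_def using fin by (intro sum.image_gen[symmetric])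
      finally show ?thesis .
    qed
    \<comment> \<open>Every class in \<open>J\<close> contains an item sent to \<open>y\<close>, so
      its power is at most \<open>b y\<close>. The sum is doubled once more because a weight may
      reach twice the power of its class; hence \<open>4 * b y\<close>.\<close>
    also have "(\<Sum>j\<in>J. 2 powr j) \<le> 2 * b y"
    proof (rule sum_distinct_powers_of_two[OF finJ _ b(2)[OF y]])
      fix j assume "j \<in> J"
      then obtain x where x: "x \<in> X" "f x = y" "j = c x" by (auto simp: J_def)
      then have "w x \<le> b y" using f b(1) y by blast
      then show "2 powr j \<le> b y" using lo[OF x(1)] x(3) by simp
    qed
    finally show ?thesis by simp
  qed
  then show ?thesis using f by blast
qed

text \<open>In a power of the two-point discrete space, a constraint that depends on finitely many
  coordinates defines a closed set. Finite satisfiability is then the finite intersection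
  property.\<close>

lemma boolean_compactness:
  fixes Q :: "'i \<Rightarrow> ('j \<Rightarrow> bool) \<Rightarrow> bool"
  assumes det: "\<And>i. i \<in> I \<Longrightarrow> \<exists>J. finite J \<and> (\<forall>f g. (\<forall>j\<in>J. f j = g j) \<longrightarrow> Q i f \<longrightarrow> Q i g)"
    and fin: "\<And>I0. finite I0 \<Longrightarrow> I0 \<subseteq> I \<Longrightarrow> \<exists>f. \<forall>i\<in>I0. Q i f"
  shows "\<exists>f. \<forall>i\<in>I. Q i f"
proof -
  define T where "T = product_topology (\<lambda>_::'j. discrete_topology (UNIV :: bool set)) UNIV"
  have "compact_space T"
    unfolding T_def by (auto simp: compact_space_product_topology compact_space_discrete_topology)
  have sp: "topspace T = UNIV" by (simp add: T_def)
  define C where "C i = {f. Q i f}" for i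
  have "closedin T (C i)" if i: "i \<in> I" for i
  proof -
    from det[OF i] obtain J
      where J: "finite J" "\<forall>f g. (\<forall>j\<in>J. f j = g j) \<longrightarrow> Q i f \<longrightarrow> Q i g" by (elim exE conjE)
    have "openin T (- C i)"
      unfolding T_def openin_product_topology_alt
    proof (intro ballI)
      fix f assume f: "f \<in> - C i"
      define U where "U j = (if j \<in> J then {f j} else UNIV)" for j
      have "{j. U j \<noteq> UNIV} \<subseteq> J" by (auto simp: U_def)
      then have "finite {j. U j \<noteq> UNIV}" using J(1) finite_subset by blast
      moreover have "f \<in> Pi\<^sub>E UNIV U" by (auto simp: U_def)
      moreover have "Pi\<^sub>E UNIV U \<subseteq> - C i"
      proof
        fix g assume "g \<in> Pi\<^sub>E UNIV U"
        then have "\<forall>j. g j \<in> U j" by auto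
        then have "\<forall>j\<in>J. g j = f j" by (metis U_def singletonD)
        then show "g \<in> - C i" using J(2)[rule_format, of g f] f by (auto simp: C_def)
      qed
      ultimately show "\<exists>U. finite {j \<in> UNIV. U j \<noteq> topspace (discrete_topology UNIV)} \<and>
          (\<forall>j\<in>UNIV. openin (discrete_topology UNIV) (U j)) \<and> f \<in> Pi\<^sub>E UNIV U \<and> Pi\<^sub>E UNIV U \<subseteq> - C i"
        by (intro exI[of _ U]) simp
    qed
    then show ?thesis by (simp add: closedin_def sp Compl_eq_Diff_UNIV)
  qed
  moreover have "\<Inter>\<F> \<noteq> {}" if \<F>: "finite \<F>" "\<F> \<subseteq> C ` I" for \<F>
  proof -
    obtain I0 where I0: "finite I0" "I0 \<subseteq> I" "\<F> = C ` I0" using finite_subset_image[OF \<F>] by auto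
    from fin[OF I0(1,2)] obtain f where "\<forall>i\<in>I0. Q i f" by blast
    then have "f \<in> \<Inter>\<F>" by (simp add: I0(3) C_def)
    then show ?thesis by blast
  qed
  ultimately have "\<Inter>(C ` I) \<noteq> {}"
    using \<open>compact_space T\<close> unfolding compact_space_fip by (metis (no_types, lifting) imageE)
  then show ?thesis by (auto simp: C_def)
qed

section \<open>Partitions into uniformly large bounded atoms\<close>

context lc_haar
begin

lemma borel_left_translate_compact: "compact K \<Longrightarrow> left_translate g K \<in> sets (borel :: 'a measure)"
  by (intro borel_compact compact_left_translate)

text \<open>
  Left translation by \<open>p\<close> multiplies the measure by \<open>modular p\<close>, so the last condition says that the
  atoms are uniformly large relative to their position.
\<close>
definition tame :: "'a set set \<Rightarrow> 'a set \<Rightarrow> real \<Rightarrow> bool" where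
  "tame P B C \<longleftrightarrow> partition_on UNIV P \<and> compact B \<and> 0 < C \<and>
     (\<forall>A\<in>P. A \<in> sets borel \<and>
       (\<forall>p\<in>A. A \<subseteq> left_translate p B \<and> modular p \<le> C * measure r A))"

end

locale tame_partition = lc_haar r
  for r :: "'a::{topological_group_add, t2_space, second_countable_topology} measure" +
  fixes P :: "'a set set" and B :: "'a set" and C :: real
  assumes tame: "tame P B C"
begin

lemma partition_P: "partition_on UNIV P" and compact_B: "compact B" and C_pos: "0 < C"
  and borel_P: "A \<in> P \<Longrightarrow> A \<in> sets borel"
  and modular_le: "A \<in> P \<Longrightarrow> p \<in> A \<Longrightarrow> modular p \<le> C * measure r A"
  using tame by (auto simp: tame_def)

lemma atom_sub: "A \<in> P \<Longrightarrow> p \<in> A \<Longrightarrow> A \<subseteq> left_translate p B"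
  using tame unfolding tame_def by blast

lemma diff_in_B:
  assumes "A \<in> P" "p \<in> A" "q \<in> A"
  shows "- p + q \<in> B"
proof -
  have "q \<in> left_translate p B" using atom_sub[OF assms(1,2)] assms(3) by (rule subsetD)
  then show ?thesis by (simp only: left_translate_eq_vimage mem_Collect_eq)
qed

text \<open>Positions of atoms are measured at base points: \<open>rep A\<close> alone decides
  whether \<open>A\<close> belongs to a window, and \<open>B\<close> controls the resulting
  error.\<close>

definition rep :: "'a set \<Rightarrow> 'a" where
  "rep A = (SOME x. x \<in> A)"

lemma rep_in: "A \<in> P \<Longrightarrow> rep A \<in> A"
  using partition_P unfolding rep_def by (metis partition_onD3 some_in_eq)

lemma zero_in_B: "0 \<in> B"
proof -
  obtain A where "A \<in> P" using partition_P partition_onD1 by blast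
  then show ?thesis using diff_in_B[of A "rep A" "rep A"] rep_in by simp
qed

lemma atom_disjoint: "A \<in> P \<Longrightarrow> A' \<in> P \<Longrightarrow> x \<in> A \<Longrightarrow> x \<in> A' \<Longrightarrow> A = A'"
  using partition_onD2[OF partition_P] by (auto simp: disjoint_def)

lemma atom_cover: obtains A where "A \<in> P" "x \<in> A"
  using partition_onD1[OF partition_P] by blast

lemma atom_finite: "A \<in> P \<Longrightarrow> emeasure r A < \<infinity>"
proof -
  assume A: "A \<in> P"
  have "A \<subseteq> left_translate (rep A) B" using A rep_in[OF A] by (rule atom_sub)
  then have "emeasure r A \<le> emeasure r (left_translate (rep A) B)"
    by (rule emeasure_mono) (simp only: sets_r borel_left_translate_compact compact_B)
  also have "\<dots> < \<infinity>" using compact_B by (rule emeasure_left_translate_compact)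
  finally show ?thesis .
qed

lemma emeasure_atom: "A \<in> P \<Longrightarrow> emeasure r A = ennreal (measure r A)"
  using atom_finite[of A] by (simp add: emeasure_eq_ennreal_measure)

lemma atom_pos: "A \<in> P \<Longrightarrow> 0 < measure r A"
  using less_le_trans[OF modular_pos modular_le[of A "rep A"]] rep_in C_pos
  by (simp add: zero_less_mult_iff)

definition weight :: "'a set set \<Rightarrow> real" where
  "weight T = (\<Sum>A\<in>T. measure r A)"

lemma weight_nonneg: "0 \<le> weight T"
  by (simp add: weight_def sum_nonneg)

lemma weight_mono: "finite T \<Longrightarrow> S \<subseteq> T \<Longrightarrow> weight S \<le> weight T"
  unfolding weight_def by (intro sum_mono2) auto

lemma weight_Un_le: "finite S \<Longrightarrow> finite T \<Longrightarrow> weight (S \<union> T) \<le> weight S + weight T"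
  unfolding weight_def by (subst sum.union_inter[symmetric]) (auto intro!: sum_nonneg)

lemma weight_Un_disjoint: "finite S \<Longrightarrow> finite T \<Longrightarrow> S \<inter> T = {} \<Longrightarrow> weight (S \<union> T) = weight S + weight T"
  unfolding weight_def by (rule sum.union_disjoint)

lemma weight_pos: "finite T \<Longrightarrow> T \<subseteq> P \<Longrightarrow> T \<noteq> {} \<Longrightarrow> 0 < weight T"
  unfolding weight_def by (intro sum_pos) (auto intro: atom_pos)

lemma emeasure_Union:
  assumes "finite T" "T \<subseteq> P"
  shows "emeasure r (\<Union>T) = ennreal (weight T)"
proof -
  have "disjoint_family_on (\<lambda>A. A) T"
    unfolding disjoint_family_on_def using atom_disjoint assms(2) by blast
  moreover have "(\<lambda>A. A) ` T \<subseteq> sets r" using assms(2) borel_P by auto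
  ultimately have "emeasure r (\<Union>T) = (\<Sum>A\<in>T. emeasure r A)"
    using sum_emeasure[of "\<lambda>A. A" T r] assms(1) by simp
  also have "\<dots> = (\<Sum>A\<in>T. ennreal (measure r A))" using assms by (intro sum.cong) (auto simp: emeasure_atom)
  finally show ?thesis by (simp add: weight_def)
qed

lemma borel_Union: "finite T \<Longrightarrow> T \<subseteq> P \<Longrightarrow> \<Union>T \<in> sets borel"
  using borel_P by (intro sets.finite_Union) auto

lemma weight_le_vol:
  assumes "finite T" "T \<subseteq> P" "\<Union>T \<subseteq> E"
  shows "ennreal (weight T) \<le> vol r E"
proof -
  have "ennreal (weight T) = vol r (\<Union>T)" using assms by (simp add: emeasure_Union borel_Union)
  also have "\<dots> \<le> vol r E" by (rule outer_measure_of_mono) (rule assms)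
  finally show ?thesis .
qed

lemma weight_le_measure:
  assumes "finite T" "T \<subseteq> P" "\<Union>T \<subseteq> E" "compact E"
  shows "weight T \<le> measure r E"
proof -
  have "ennreal (weight T) \<le> ennreal (measure r E)"
    using weight_le_vol[OF assms(1-3)] emeasure_compact_finite[OF assms(4)] assms(4)
    by (simp add: borel_compact emeasure_eq_ennreal_measure)
  then show ?thesis by simp
qed

text \<open>A lower bound for \<open>modular\<close> on \<open>Q\<close> makes each such atom
  uniformly large, and all of them lie in \<open>Q + B\<close>, which has finite measure.\<close>

lemma atoms_hitting_compact_finite:
  assumes Q: "compact Q"
  shows "finite {A \<in> P. A \<inter> Q \<noteq> {}}"
proof -
  obtain M where M: "M > 0" "\<And>g. g \<in> uminus ` Q \<Longrightarrow> modular g \<le> M"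
    using modular_bounded[OF compact_uminus_image[OF Q]] by blast
  have QB: "compact (Q + B)" using Q compact_B by (rule compact_set_plus)
  have "card T \<le> nat \<lceil>C * M * measure r (Q + B)\<rceil>" if T: "T \<subseteq> {A \<in> P. A \<inter> Q \<noteq> {}}" "finite T" for T
  proof -
    have lower: "1 \<le> C * M * measure r A" if A: "A \<in> T" for A
    proof -
      obtain p where p: "p \<in> A" "p \<in> Q" "A \<in> P" using T A by blast
      have "modular (- p) \<le> M" using M(2) p by blast
      then have "1 \<le> M * modular p" using modular_pos[of p] by (simp add: modular_uminus field_simps)
      also have "\<dots> \<le> M * (C * measure r A)" using M(1) p by (intro mult_left_mono modular_le) auto
      finally show ?thesis by (simp add: ac_simps)
    qed
    have "\<Union>T \<subseteq> Q + B"
    proof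
      fix x assume "x \<in> \<Union>T"
      then obtain A where A: "A \<in> T" "x \<in> A" by blast
      then obtain p where p: "p \<in> A" "p \<in> Q" "A \<in> P" using T by blast
      then have "- p + x \<in> B" using A diff_in_B by blast
      then have "p + (- p + x) \<in> Q + B" using p by blast
      then show "x \<in> Q + B" by (simp add: add.assoc[symmetric])
    qed
    then have "weight T \<le> measure r (Q + B)" using T QB by (intro weight_le_measure) auto
    moreover have "real (card T) \<le> (\<Sum>A\<in>T. C * M * measure r A)"
      using sum_mono[OF lower, of T] by simp
    then have "real (card T) \<le> C * M * weight T" by (simp add: weight_def sum_distrib_left)
    ultimately have "real (card T) \<le> C * M * measure r (Q + B)"
      using C_pos M(1) by (meson mult_left_mono mult_pos_pos less_imp_le order_trans)
    then show ?thesis by linarith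
  qed
  then show ?thesis using finite_if_finite_subsets_card_bdd by blast
qed

text \<open>These are the atoms based in the left translate of \<open>V\<close> by
  \<open>- y\<close>. With this parameter, the positions \<open>y\<close> that catch a fixed atom
  form a right translate of \<open>V\<close>, whose measure is the same for all atoms; averaging
  over \<open>y\<close> rests on this.\<close>

definition window :: "'a set \<Rightarrow> 'a \<Rightarrow> 'a set set" where
  "window V y = {A \<in> P. y + rep A \<in> V}"

lemma finite_window:
  assumes "compact V" shows "finite (window V y)"
proof (rule finite_subset)
  show "finite {A \<in> P. A \<inter> left_translate (- y) V \<noteq> {}}"
    by (intro atoms_hitting_compact_finite compact_left_translate assms)
  show "window V y \<subseteq> {A \<in> P. A \<inter> left_translate (- y) V \<noteq> {}}"
    using rep_in by (fastforce simp: window_def left_translate_eq_vimage)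
qed

lemma window_subset: "window V y \<subseteq> P" by (auto simp: window_def)

lemma near_finite:
  assumes "compact D"
  shows "finite {A' \<in> P. - rep A + rep A' \<in> D}"
  using finite_window[OF assms, of "- rep A"] by (simp add: window_def)

text \<open>Both orders of the difference occur because \<open>invariant_set\<close> moves by
  \<open>K\<close> and by its inverse.\<close>

definition adjacent :: "'a set \<Rightarrow> 'a set \<Rightarrow> 'a set \<Rightarrow> bool" where
  "adjacent K A A' \<longleftrightarrow> (\<exists>a\<in>A. \<exists>a'\<in>A'. - a + a' \<in> K \<or> - a' + a \<in> K)"

text \<open>From a point to the contact point of its atom, across by \<open>K\<close> or its
  inverse, then to a point of the other atom: this contains every difference between points of
  adjacent atoms.\<close>

definition reach :: "'a set \<Rightarrow> 'a set" where
  "reach K = B + (K \<union> uminus ` K) + B"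

lemma compact_reach: "compact K \<Longrightarrow> compact (reach K)"
  unfolding reach_def by (intro compact_set_plus compact_B compact_Un compact_uminus_image)

lemma adjacent_sub_reach:
  assumes "A \<in> P" "A' \<in> P" "adjacent K A A'" "x \<in> A" "y \<in> A'"
  shows "- x + y \<in> reach K"
proof -
  obtain a a' where a: "a \<in> A" "a' \<in> A'" "- a + a' \<in> K \<or> - a' + a \<in> K"
    using assms(3) by (auto simp: adjacent_def)
  then have "- a + a' \<in> K \<union> uminus ` K"
    by (metis UnI1 UnI2 image_eqI minus_add minus_minus)
  moreover have "- x + a \<in> B" "- a' + y \<in> B" using diff_in_B a assms by auto
  ultimately have "(- x + a) + (- a + a') + (- a' + y) \<in> reach K"
    unfolding reach_def by (intro set_plus_intro)
  moreover have "(- x + a) + (- a + a') + (- a' + y) = - x + y"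
    by (metis add.assoc add_minus_cancel)
  ultimately show ?thesis by simp
qed

lemma adjacent_reach:
  assumes "A \<in> P" "A' \<in> P" "adjacent K A A'"
  shows "- rep A + rep A' \<in> reach K"
  using adjacent_sub_reach[OF assms] rep_in assms by blast

definition inner_boundary :: "'a set \<Rightarrow> 'a set set \<Rightarrow> 'a set set" where
  "inner_boundary K T = {A \<in> T. \<exists>A'\<in>P - T. adjacent K A A'}"

definition outer_boundary :: "'a set \<Rightarrow> 'a set set \<Rightarrow> 'a set set" where
  "outer_boundary K T = {A' \<in> P - T. \<exists>A\<in>T. adjacent K A A'}"

lemma adjacent_finite: "A \<in> P \<Longrightarrow> compact K \<Longrightarrow> finite {A' \<in> P. adjacent K A A'}"
  by (rule finite_subset[OF _ near_finite[OF compact_reach, of K A]]) (auto intro: adjacent_reach)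

text \<open>Here tameness cancels the position: the neighbours lie in a translate of
  \<open>reach K\<close> of measure \<open>modular (rep A) * measure r (reach K)\<close>, and
  \<open>modular (rep A)\<close> is at most \<open>C * measure r A\<close>.\<close>

lemma weight_adjacent:
  assumes "A \<in> P" "compact K"
  shows "weight {A' \<in> P. adjacent K A A'} \<le> C * measure r (reach K) * measure r A"
proof -
  have c: "compact (left_translate (rep A) (reach K))"
    using assms by (intro compact_left_translate compact_reach)
  have "\<Union>{A' \<in> P. adjacent K A A'} \<subseteq> left_translate (rep A) (reach K)"
  proof
    fix x assume "x \<in> \<Union>{A' \<in> P. adjacent K A A'}"
    then obtain A' where "A' \<in> P" "adjacent K A A'" "x \<in> A'" by blast
    then have "- rep A + x \<in> reach K" using adjacent_sub_reach assms rep_in by blast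
    then show "x \<in> left_translate (rep A) (reach K)" by (simp add: left_translate_eq_vimage)
  qed
  then have "weight {A' \<in> P. adjacent K A A'} \<le> measure r (left_translate (rep A) (reach K))"
    using adjacent_finite assms c by (intro weight_le_measure) auto
  also have "\<dots> = modular (rep A) * measure r (reach K)"
    using emeasure_left_translate[of "reach K" "rep A"] compact_reach[OF assms(2)] modular_pos[of "rep A"]
    by (simp add: measure_def borel_compact enn2real_mult)
  also have "\<dots> \<le> C * measure r A * measure r (reach K)"
    using assms rep_in by (intro mult_right_mono modular_le) auto
  finally show ?thesis by (simp add: ac_simps)
qed

lemma outer_boundary_finite:
  assumes "finite T" "T \<subseteq> P" "compact K"
  shows "finite (outer_boundary K T)"
proof (rule finite_subset)
  show "outer_boundary K T \<subseteq> (\<Union>A\<in>T. {A' \<in> P. adjacent K A A'})" by (auto simp: outer_boundary_def)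
  show "finite (\<Union>A\<in>T. {A' \<in> P. adjacent K A A'})" using assms adjacent_finite by auto
qed

text \<open>Each atom of the outer boundary touches one of the inner boundary, so the neighbour
  bound can be summed over the latter. The inner boundary is the easier one to control when
  carving.\<close>

lemma weight_outer_boundary:
  assumes "finite T" "T \<subseteq> P" "compact K"
  shows "weight (outer_boundary K T) \<le> C * measure r (reach K) * weight (inner_boundary K T)"
proof -
  have fin: "finite (inner_boundary K T)" "inner_boundary K T \<subseteq> P" using assms by (auto simp: inner_boundary_def)
  have "outer_boundary K T \<subseteq> (\<Union>A\<in>inner_boundary K T. {A' \<in> P. adjacent K A A'})" by (auto simp: outer_boundary_def inner_boundary_def)
  moreover have "finite (\<Union>A\<in>inner_boundary K T. {A' \<in> P. adjacent K A A'})" using fin adjacent_finite assms by auto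
  ultimately have "weight (outer_boundary K T) \<le> weight (\<Union>A\<in>inner_boundary K T. {A' \<in> P. adjacent K A A'})" by (rule weight_mono[rotated])
  also have "\<dots> \<le> (\<Sum>A\<in>inner_boundary K T. weight {A' \<in> P. adjacent K A A'})"
    using fin
  proof (induction rule: finite_induct)
    case (insert A S)
    then have "finite (\<Union>A\<in>S. {A' \<in> P. adjacent K A A'})" "finite {A' \<in> P. adjacent K A A'}"
      using adjacent_finite assms by auto
    then show ?case using insert weight_Un_le[of "{A' \<in> P. adjacent K A A'}" "\<Union>A\<in>S. {A' \<in> P. adjacent K A A'}"] by simp
  qed (simp add: weight_def)
  also have "\<dots> \<le> (\<Sum>A\<in>inner_boundary K T. C * measure r (reach K) * measure r A)"
    using fin assms by (intro sum_mono weight_adjacent) auto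
  finally show ?thesis by (simp add: weight_def sum_distrib_left)
qed

text \<open>Any point reached from \<open>T\<close> by \<open>K\<close> or its inverse lies in
  \<open>T\<close> or in an atom of the outer boundary. Covering by whole atoms bounds the outer
  measure by a finite Borel sum.\<close>

lemma invariant_set_Union:
  assumes T: "finite T" "T \<subseteq> P" and K: "compact K"
    and small: "C * measure r (reach K) * weight (inner_boundary K T) \<le> \<epsilon> * weight T" and "0 \<le> \<epsilon>"
  shows "invariant_set r \<epsilon> K (\<Union>T)"
proof -
  have "vol r E \<le> ennreal \<epsilon> * vol r (\<Union>T)" if E: "E \<subseteq> \<Union>(outer_boundary K T)" for E
  proof -
    have "vol r E \<le> vol r (\<Union>(outer_boundary K T))" using E by (rule outer_measure_of_mono)
    also have "\<dots> = ennreal (weight (outer_boundary K T))"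
      using outer_boundary_finite[OF T K] by (subst outer_measure_of_eq)
        (auto intro!: emeasure_Union borel_Union simp: outer_boundary_def)
    also have "\<dots> \<le> ennreal (\<epsilon> * weight T)" using weight_outer_boundary[OF T K] small by (intro ennreal_leI) linarith
    also have "\<dots> = ennreal \<epsilon> * vol r (\<Union>T)"
      using T \<open>0 \<le> \<epsilon>\<close> by (simp add: borel_Union emeasure_Union ennreal_mult weight_nonneg)
    finally show ?thesis .
  qed
  moreover have "(\<Union>T + K) - \<Union>T \<subseteq> \<Union>(outer_boundary K T)"
  proof
    fix x assume x: "x \<in> (\<Union>T + K) - \<Union>T"
    then obtain A a k where a: "A \<in> T" "a \<in> A" "k \<in> K" "x = a + k" by (auto simp: set_plus_def)
    obtain A' where A': "A' \<in> P" "x \<in> A'" using atom_cover by blast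
    have "- a + x \<in> K" using a by (simp add: add.assoc[symmetric])
    then have "adjacent K A A'" using a A' unfolding adjacent_def by blast
    then show "x \<in> \<Union>(outer_boundary K T)" using x a A' by (auto simp: outer_boundary_def)
  qed
  moreover have "(\<Union>T + uminus ` K) - \<Union>T \<subseteq> \<Union>(outer_boundary K T)"
  proof
    fix x assume x: "x \<in> (\<Union>T + uminus ` K) - \<Union>T"
    then obtain A a k where a: "A \<in> T" "a \<in> A" "k \<in> K" "x = a + - k" by (auto simp: set_plus_def)
    obtain A' where A': "A' \<in> P" "x \<in> A'" using atom_cover by blast
    have "- x + a \<in> K" using a by (simp add: minus_add add.assoc)
    then have "adjacent K A A'" using a A' unfolding adjacent_def by blast
    then show "x \<in> \<Union>(outer_boundary K T)" using x a A' by (auto simp: outer_boundary_def)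
  qed
  ultimately show ?thesis by (simp add: invariant_set_def)
qed

text \<open>An almost invariant union of atoms is large, since it nearly contains translates of \<open>K\<close>.\<close>
lemma weight_ge_of_small_inner_boundary:
  assumes T: "finite T" "T \<subseteq> P" and K: "compact K" and A: "A \<in> T"
    and small: "C * measure r (reach K) * weight (inner_boundary K T) \<le> weight T"
  shows "modular (rep A) * measure r K \<le> 2 * weight T"
proof -
  have c: "compact (left_translate (rep A) K)" using K by (rule compact_left_translate)
  have "left_translate (rep A) K \<subseteq> \<Union>(T \<union> outer_boundary K T)"
  proof
    fix x assume "x \<in> left_translate (rep A) K"
    then have "- rep A + x \<in> K" by (simp add: left_translate_eq_vimage)
    moreover obtain A' where A': "A' \<in> P" "x \<in> A'" using atom_cover by blast
    ultimately have "adjacent K A A'" using rep_in A T unfolding adjacent_def by blast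
    then show "x \<in> \<Union>(T \<union> outer_boundary K T)" using A A' by (auto simp: outer_boundary_def)
  qed
  moreover have fin: "finite (T \<union> outer_boundary K T)" "T \<union> outer_boundary K T \<subseteq> P"
    using T outer_boundary_finite[OF T K] by (auto simp: outer_boundary_def)
  ultimately have "emeasure r (left_translate (rep A) K) \<le> emeasure r (\<Union>(T \<union> outer_boundary K T))"
    by (intro emeasure_mono) (simp_all only: sets_r borel_Union)
  also have "\<dots> = ennreal (weight (T \<union> outer_boundary K T))" using fin by (rule emeasure_Union)
  finally have "ennreal (modular (rep A) * measure r K) \<le> ennreal (weight (T \<union> outer_boundary K T))"
    using emeasure_left_translate[OF borel_compact[OF K], of "rep A"] emeasure_compact_finite[OF K] modular_pos[of "rep A"]
    by (simp add: ennreal_mult emeasure_eq_ennreal_measure)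
  then have "modular (rep A) * measure r K \<le> weight (T \<union> outer_boundary K T)" by (simp add: weight_nonneg)
  also have "\<dots> \<le> weight T + weight (outer_boundary K T)" using fin by (intro weight_Un_le) auto
  also have "\<dots> \<le> 2 * weight T" using weight_outer_boundary[OF T K] small by simp
  finally show ?thesis .
qed

end

section \<open>Windows and carving\<close>

lemma sum_times_indicator:
  fixes f :: "'y \<Rightarrow> real"
  assumes "finite Y"
  shows "(\<Sum>y\<in>Y. f y * indicator (D y) g) = (\<Sum>y\<in>{y\<in>Y. g \<in> D y}. f y)"
  using assms by (intro sum.mono_neutral_cong_right) (auto simp: indicator_def)

text \<open>At a position \<open>g\<close>, every \<open>x\<close> with \<open>g \<in> E x\<close>
  spreads itself over the \<open>y\<close> with \<open>g \<in> D y\<close> in proportion to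
  \<open>m' y\<close>; \<open>\<psi> x y\<close> averages these shares over \<open>E x\<close>. All
  \<open>E x\<close> have measure \<open>a\<close>, so the shares sum to one. At a single
  \<open>g\<close> the load arriving at \<open>y\<close> is at most \<open>\<kappa> * m' y\<close>,
  and it arrives only for \<open>g\<close> in \<open>D y\<close>.\<close>

lemma fractional_transport:
  fixes M :: "'g measure" and m :: "'x \<Rightarrow> real" and m' :: "'y \<Rightarrow> real"
  assumes fin: "finite X" "finite Y"
    and E: "\<And>x. x \<in> X \<Longrightarrow> E x \<in> fmeasurable M" "\<And>x. x \<in> X \<Longrightarrow> measure M (E x) = a"
    and D: "\<And>y. y \<in> Y \<Longrightarrow> D y \<in> fmeasurable M"
    and m: "\<And>x. x \<in> X \<Longrightarrow> 0 < m x" "\<And>y. y \<in> Y \<Longrightarrow> 0 < m' y"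
    and a: "0 < a" and \<kappa>: "0 \<le> \<kappa>"
    and R_pos: "\<And>g x. x \<in> X \<Longrightarrow> g \<in> E x \<Longrightarrow> 0 < (\<Sum>y\<in>{y\<in>Y. g \<in> D y}. m' y)"
    and load: "\<And>g x. x \<in> X \<Longrightarrow> g \<in> E x \<Longrightarrow>
      (\<Sum>x\<in>{x\<in>X. g \<in> E x}. m x) \<le> \<kappa> * (\<Sum>y\<in>{y\<in>Y. g \<in> D y}. m' y)"
  obtains \<psi> :: "'x \<Rightarrow> 'y \<Rightarrow> real" where
    "\<And>x y. x \<in> X \<Longrightarrow> y \<in> Y \<Longrightarrow> 0 \<le> \<psi> x y"
    "\<And>x. x \<in> X \<Longrightarrow> (\<Sum>y\<in>Y. \<psi> x y) = 1"
    "\<And>y. y \<in> Y \<Longrightarrow> (\<Sum>x\<in>X. m x * \<psi> x y) \<le> \<kappa> * m' y * measure M (D y) / a"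
    "\<And>x y. x \<in> X \<Longrightarrow> y \<in> Y \<Longrightarrow> 0 < \<psi> x y \<Longrightarrow> E x \<inter> D y \<noteq> {}"
proof -
  define R where "R g = (\<Sum>y\<in>Y. m' y * indicator (D y) g)" for g
  have R_eq: "R g = (\<Sum>y\<in>{y\<in>Y. g \<in> D y}. m' y)" for g
    unfolding R_def using fin by (simp add: sum_times_indicator)
  have meas[measurable]: "\<And>x. x \<in> X \<Longrightarrow> E x \<in> sets M" "\<And>y. y \<in> Y \<Longrightarrow> D y \<in> sets M"
    using E D by auto
  have R_meas[measurable]: "R \<in> borel_measurable M"
    unfolding R_def by (intro borel_measurable_sum borel_measurable_times) auto
  define k where "k x y g = indicator (E x) g * indicator (D y) g * m' y / R g" for x y g
  have R_ge: "m' y \<le> R g" if "y \<in> Y" "g \<in> D y" for y g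
    unfolding R_eq using that fin m(2) by (intro member_le_sum) (auto intro: less_imp_le)
  have R_nonneg: "0 \<le> R g" for g
    unfolding R_eq using m(2) by (intro sum_nonneg) (auto intro: less_imp_le)
  have k_nonneg: "0 \<le> k x y g" if "y \<in> Y" for x y g
    using m(2)[OF that] R_nonneg by (simp add: k_def)
  have k_le: "k x y g \<le> indicator (E x) g" if "y \<in> Y" for x y g
  proof (cases "g \<in> D y")
    case True
    then have "0 < R g" "m' y \<le> R g" using R_ge[OF that True] m(2)[OF that] by auto
    then show ?thesis by (simp add: k_def indicator_def)
  qed (simp add: k_def)
  have k_int: "integrable M (k x y)" if "x \<in> X" "y \<in> Y" for x y
  proof (rule Bochner_Integration.integrable_bound)
    show "integrable M (indicator (E x) :: 'g \<Rightarrow> real)"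
      using E(1)[OF that(1)] by (simp add: fmeasurable_def)
    show "k x y \<in> borel_measurable M" unfolding k_def using that meas by measurable
    show "AE g in M. norm (k x y g) \<le> norm (indicator (E x) g :: real)"
      using k_nonneg[OF that(2)] k_le[OF that(2)] by (intro AE_I2) simp
  qed
  define \<psi> where "\<psi> x y = (\<integral>g. k x y g \<partial>M) / a" for x y
  show ?thesis
  proof (rule that)
    fix x y assume x: "x \<in> X" and y: "y \<in> Y"
    show "0 \<le> \<psi> x y" unfolding \<psi>_def using a k_nonneg[OF y]
      by (intro divide_nonneg_pos Bochner_Integration.integral_nonneg)
    show "E x \<inter> D y \<noteq> {}" if "0 < \<psi> x y"
    proof
      assume "E x \<inter> D y = {}"
      then have "k x y = (\<lambda>g. 0)" by (auto simp: k_def indicator_def fun_eq_iff)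
      then show False using that by (simp add: \<psi>_def)
    qed
  next
    fix x assume x: "x \<in> X"
    have "(\<Sum>y\<in>Y. \<psi> x y) = (\<integral>g. (\<Sum>y\<in>Y. k x y g) \<partial>M) / a"
      unfolding \<psi>_def using k_int[OF x] by (simp add: sum_divide_distrib)
    also have "(\<lambda>g. \<Sum>y\<in>Y. k x y g) = indicator (E x)"
    proof
      fix g
      have "(\<Sum>y\<in>Y. k x y g) = (\<Sum>y\<in>Y. indicator (E x) g / R g * (m' y * indicator (D y) g))"
        by (intro sum.cong) (simp_all add: k_def)
      also have "\<dots> = indicator (E x) g / R g * R g"
        by (simp only: R_def sum_distrib_left)
      finally show "(\<Sum>y\<in>Y. k x y g) = indicator (E x) g"
        using R_pos[OF x, of g] by (cases "g \<in> E x") (auto simp: R_eq)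
    qed
    also have "(\<integral>g. indicator (E x) g \<partial>M) = a"
      using E[OF x] fmeasurableD[OF E(1)[OF x]] sets.sets_into_space by (simp add: Int_absorb2)
    finally show "(\<Sum>y\<in>Y. \<psi> x y) = 1" using a by simp
  next
    fix y assume y: "y \<in> Y"
    have "(\<Sum>x\<in>X. m x * \<psi> x y) = (\<integral>g. (\<Sum>x\<in>X. m x * k x y g) \<partial>M) / a"
      unfolding \<psi>_def using k_int[OF _ y] by (simp add: sum_divide_distrib)
    also have "(\<integral>g. (\<Sum>x\<in>X. m x * k x y g) \<partial>M) \<le> (\<integral>g. \<kappa> * m' y * indicator (D y) g \<partial>M)"
    proof (rule integral_mono)
      show "integrable M (\<lambda>g. \<Sum>x\<in>X. m x * k x y g)"
        using k_int[OF _ y] by (intro Bochner_Integration.integrable_sum integrable_mult_right) auto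
      show "integrable M (\<lambda>g. \<kappa> * m' y * indicator (D y) g)"
        using D[OF y] by (simp add: fmeasurable_def)
      fix g
      show "(\<Sum>x\<in>X. m x * k x y g) \<le> \<kappa> * m' y * indicator (D y) g"
      proof (cases "g \<in> D y \<and> (\<exists>x\<in>X. g \<in> E x)")
        case True
        then obtain x0 where x0: "x0 \<in> X" "g \<in> E x0" by blast
        have "(\<Sum>x\<in>X. m x * k x y g) = (\<Sum>x\<in>X. m x * indicator (E x) g) * m' y / R g"
          using True by (simp add: k_def sum_distrib_right sum_divide_distrib mult.assoc)
        also have "(\<Sum>x\<in>X. m x * indicator (E x) g) = (\<Sum>x\<in>{x\<in>X. g \<in> E x}. m x)"
          using fin by (simp add: sum_times_indicator)
        also have "\<dots> * m' y / R g \<le> (\<kappa> * R g) * m' y / R g"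
          using load[OF x0] R_nonneg[of g] m(2)[OF y] unfolding R_eq[symmetric]
          by (intro divide_right_mono mult_right_mono) auto
        also have "\<dots> = \<kappa> * m' y" using R_pos[OF x0] by (simp add: R_eq)
        finally show ?thesis using True by simp
      next
        case False
        then have "(\<Sum>x\<in>X. m x * k x y g) = 0" by (auto simp: k_def intro!: sum.neutral)
        then show ?thesis using \<kappa> m(2)[OF y] by simp
      qed
    qed
    also have "(\<integral>g. \<kappa> * m' y * indicator (D y) g \<partial>M) = \<kappa> * m' y * measure M (D y)"
      using D[OF y] fmeasurableD[OF D[OF y]] sets.sets_into_space by (simp add: Int_absorb2)
    finally show "(\<Sum>x\<in>X. m x * \<psi> x y) \<le> \<kappa> * m' y * measure M (D y) / a"
      using a by (simp add: divide_right_mono)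
  qed
qed

section \<open>Windows that are Folner sets, and the atoms they cut\<close>

context tame_partition
begin

text \<open>From any point of an atom, \<open>B\<close> leads to its base point and
  \<open>B + D\<close> to every base point at offset \<open>D\<close>. Thus a window that separates
  two such base points has all points of the first atom in its boundary.\<close>

definition collar :: "'a set \<Rightarrow> 'a set" where
  "collar D = B \<union> (B + D)"

lemma compact_collar: "compact D \<Longrightarrow> compact (collar D)"
  unfolding collar_def by (intro compact_Un compact_set_plus compact_B)

definition mass :: "'a set \<Rightarrow> 'a \<Rightarrow> real" where
  "mass V y = modular (- y) * measure r V"

lemma mass_nonneg: "0 \<le> mass V y"
  using modular_pos[of "- y"] by (simp add: mass_def)

lemma emeasure_eq_mass: "compact V \<Longrightarrow> emeasure r (left_translate (- y) V) = ennreal (mass V y)"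
  using emeasure_left_translate[OF borel_compact, of V "- y"] emeasure_compact_finite[of V] modular_pos[of "- y"]
  by (simp add: mass_def ennreal_mult emeasure_eq_ennreal_measure)

lemma measure_eq_mass: "compact V \<Longrightarrow> measure r (left_translate (- y) V) = mass V y"
  using emeasure_eq_mass[of V y] mass_nonneg[of V y] by (simp add: measure_def)

text \<open>The hypothesis puts every point of these atoms, shifted by \<open>y\<close>, into
  \<open>K_boundary D V\<close>; \<open>0 \<in> D\<close> ensures that the point itself lies in the
  translate. Shifting back multiplies both the boundary and \<open>V\<close> by the same
  factor.\<close>

lemma weight_boundary_atoms:
  assumes V: "compact V" "boundary_invariant r \<eta> D V" "0 \<le> \<eta>" "0 \<in> D"
    and Z: "finite Z" "Z \<subseteq> P"
    and cut: "\<And>A x. A \<in> Z \<Longrightarrow> x \<in> A \<Longrightarrow> (\<exists>d\<in>D. y + x + d \<in> V) \<and> (\<exists>d\<in>D. y + x + d \<notin> V)"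
  shows "weight Z \<le> \<eta> * mass V y"
proof -
  have "\<Union>Z \<subseteq> left_translate (- y) (K_boundary D V)"
  proof
    fix x assume "x \<in> \<Union>Z"
    then obtain A where "A \<in> Z" "x \<in> A" by blast
    from cut[OF this] obtain d d' where d: "d \<in> D" "y + x + d \<in> V" "d' \<in> D" "y + x + d' \<notin> V" by blast
    then have "left_translate (y + x) D \<inter> V \<noteq> {}" "left_translate (y + x) D \<inter> (UNIV - V) \<noteq> {}"
      by blast+
    moreover have "y + x \<in> left_translate (y + x) D" using V(4) by force
    ultimately have "y + x \<in> K_boundary D V" unfolding K_boundary_def by blast
    then show "x \<in> left_translate (- y) (K_boundary D V)" by (simp add: left_translate_eq_vimage)
  qed
  then have "ennreal (weight Z) \<le> vol r (left_translate (- y) (K_boundary D V))"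
    by (rule weight_le_vol[OF Z])
  also have "\<dots> \<le> ennreal (modular (- y)) * vol r (K_boundary D V)" by (rule vol_left_translate_le)
  also have "\<dots> \<le> ennreal (modular (- y)) * (ennreal \<eta> * vol r V)"
    using V(2) unfolding boundary_invariant_def by (rule mult_left_mono) simp
  also have "\<dots> = ennreal (\<eta> * mass V y)"
    using V modular_pos[of "- y"] emeasure_compact_finite[OF V(1)]
    by (simp add: borel_compact mass_def ennreal_mult emeasure_eq_ennreal_measure ac_simps)
  finally show ?thesis using mass_nonneg[of V y] V(3) by simp
qed

lemma zero_in_collar: "0 \<in> collar D"
  using zero_in_B by (simp add: collar_def)

lemma weight_cut:
  assumes V: "compact V" "boundary_invariant r \<eta> (collar D) V" "0 \<le> \<eta>"
    and Z: "finite Z" "Z \<subseteq> P"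
    and cut: "\<And>A. A \<in> Z \<Longrightarrow> \<exists>A'\<in>P. - rep A + rep A' \<in> D \<and> (y + rep A \<in> V) \<noteq> (y + rep A' \<in> V)"
  shows "weight Z \<le> \<eta> * mass V y"
proof (rule weight_boundary_atoms[OF V zero_in_collar Z])
  fix A x assume A: "A \<in> Z" "x \<in> A"
  obtain A' where A': "A' \<in> P" "- rep A + rep A' \<in> D" "(y + rep A \<in> V) \<noteq> (y + rep A' \<in> V)"
    using cut[OF A(1)] by blast
  have b: "- x + rep A \<in> B" using A Z diff_in_B rep_in by blast
  then have "(- x + rep A) + (- rep A + rep A') \<in> B + D" using A' by blast
  then have "- x + rep A' \<in> B + D" by (metis add.assoc add_minus_cancel)
  then have "- x + rep A \<in> collar D" "- x + rep A' \<in> collar D" using b by (auto simp: collar_def)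
  moreover have "y + x + (- x + rep A) = y + rep A" "y + x + (- x + rep A') = y + rep A'"
    by (metis add.assoc add_minus_cancel)+
  ultimately show "(\<exists>d\<in>collar D. y + x + d \<in> V) \<and> (\<exists>d\<in>collar D. y + x + d \<notin> V)"
    using A'(3) by metis
qed

lemma weight_cut_atoms:
  assumes V: "compact V" "boundary_invariant r \<eta> (collar D) V" "0 \<le> \<eta>"
    and Z: "finite Z" "Z \<subseteq> P"
    and cut: "\<And>A. A \<in> Z \<Longrightarrow> \<exists>a\<in>A. (y + rep A \<in> V) \<noteq> (y + a \<in> V)"
  shows "weight Z \<le> \<eta> * mass V y"
proof (rule weight_boundary_atoms[OF V zero_in_collar Z])
  fix A x assume A: "A \<in> Z" "x \<in> A"
  obtain a where a: "a \<in> A" "(y + rep A \<in> V) \<noteq> (y + a \<in> V)"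
    using cut[OF A(1)] by blast
  have "- x + rep A \<in> B" "- x + a \<in> B" using A Z diff_in_B rep_in a by blast+
  then have "- x + rep A \<in> collar D" "- x + a \<in> collar D" by (auto simp: collar_def)
  moreover have "y + x + (- x + rep A) = y + rep A" "y + x + (- x + a) = y + a"
    by (metis add.assoc add_minus_cancel)+
  ultimately show "(\<exists>d\<in>collar D. y + x + d \<in> V) \<and> (\<exists>d\<in>collar D. y + x + d \<notin> V)"
    using a(2) by metis
qed

text \<open>The translated \<open>V\<close> is covered by the atoms based in it and by atoms that
  meet it but are based outside; the latter are cut.\<close>

lemma weight_window_ge:
  assumes V: "compact V" "boundary_invariant r \<eta> (collar D) V" "0 \<le> \<eta>"
  shows "(1 - \<eta>) * mass V y \<le> weight (window V y)"
proof -
  define Z where "Z = {A \<in> P. A \<inter> left_translate (- y) V \<noteq> {}} - window V y"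
  have Z: "finite Z" "Z \<subseteq> P"
    using atoms_hitting_compact_finite[OF compact_left_translate[OF V(1)]] by (auto simp: Z_def)
  have "weight Z \<le> \<eta> * mass V y"
  proof (rule weight_cut_atoms[OF V Z])
    fix A assume A: "A \<in> Z"
    then obtain a where "a \<in> A" "a \<in> left_translate (- y) V" by (auto simp: Z_def)
    then have "a \<in> A" "y + a \<in> V" by (auto simp: left_translate_eq_vimage)
    moreover have "y + rep A \<notin> V" using A by (auto simp: Z_def window_def)
    ultimately show "\<exists>a\<in>A. (y + rep A \<in> V) \<noteq> (y + a \<in> V)" by blast
  qed
  moreover have "mass V y \<le> weight (window V y \<union> Z)"
  proof -
    have "left_translate (- y) V \<subseteq> \<Union>(window V y \<union> Z)"
    proof
      fix x assume "x \<in> left_translate (- y) V"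
      moreover obtain A where "A \<in> P" "x \<in> A" using atom_cover by blast
      ultimately show "x \<in> \<Union>(window V y \<union> Z)" unfolding Z_def by blast
    qed
    moreover have f: "finite (window V y \<union> Z)" "window V y \<union> Z \<subseteq> P"
      using Z finite_window[OF V(1)] window_subset by auto
    ultimately have "emeasure r (left_translate (- y) V) \<le> emeasure r (\<Union>(window V y \<union> Z))"
      by (intro emeasure_mono) (simp_all only: sets_r borel_Union)
    then have "ennreal (mass V y) \<le> ennreal (weight (window V y \<union> Z))"
      using emeasure_Union[OF f] emeasure_eq_mass[OF V(1)] by simp
    then show ?thesis by (simp add: weight_nonneg)
  qed
  moreover have "weight (window V y \<union> Z) \<le> weight (window V y) + weight Z"
    using finite_window[OF V(1)] Z(1) by (rule weight_Un_le)
  ultimately show ?thesis by (simp add: algebra_simps)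
qed

text \<open>Atoms based in the translated \<open>V\<close> either lie inside it or stick out of it,
  and the latter are cut.\<close>

lemma weight_window_le:
  assumes V: "compact V" "boundary_invariant r \<eta> (collar D) V" "0 \<le> \<eta>"
  shows "weight (window V y) \<le> (1 + \<eta>) * mass V y"
proof -
  define Z where "Z = {A \<in> window V y. \<exists>a\<in>A. y + a \<notin> V}"
  have Z: "finite Z" "Z \<subseteq> P" using finite_window[OF V(1)] window_subset by (auto simp: Z_def)
  have "weight Z \<le> \<eta> * mass V y"
    by (rule weight_cut_atoms[OF V Z]) (auto simp: Z_def window_def)
  moreover have "weight (window V y - Z) \<le> mass V y"
  proof -
    have "\<Union>(window V y - Z) \<subseteq> left_translate (- y) V"
      by (auto simp: Z_def left_translate_eq_vimage)
    then have "weight (window V y - Z) \<le> measure r (left_translate (- y) V)"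
      using finite_window[OF V(1)] window_subset[of V y] by (intro weight_le_measure compact_left_translate V) auto
    then show ?thesis using measure_eq_mass[OF V(1)] by simp
  qed
  moreover have "weight (window V y) \<le> weight (window V y - Z) + weight Z"
  proof -
    have "window V y = (window V y - Z) \<union> Z" by (auto simp: Z_def)
    then show ?thesis using weight_Un_le[of "window V y - Z" Z] finite_window[OF V(1), of y] Z by auto
  qed
  ultimately show ?thesis by (simp add: algebra_simps)
qed

text \<open>Averaging over \<open>y\<close>: each atom is caught for a set of \<open>y\<close> of
  measure \<open>measure r F\<close>, and cut for a set of measure at most \<open>\<epsilon>\<close>
  times that. So the integral of the cut weight is at most \<open>\<epsilon>\<close> times the
  integral of the caught weight, and some \<open>y\<close> that catches an atom satisfies the same
  inequality.\<close>

lemma ex_good_translate: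
  assumes F: "compact F" "0 < measure r F" "boundary_invariant r \<epsilon> D F" "0 \<le> \<epsilon>" "0 \<in> D"
    and rel: "\<And>A A'. A \<in> P \<Longrightarrow> A' \<in> P \<Longrightarrow> rel A A' \<Longrightarrow> - rep A + rep A' \<in> D"
    and U: "finite U" "U \<subseteq> P" "U \<noteq> {}"
  shows "\<exists>y. window F y \<inter> U \<noteq> {} \<and>
    weight {A \<in> U. \<exists>A'\<in>U. rel A A' \<and> (y + rep A \<in> F) \<noteq> (y + rep A' \<in> F)} \<le> \<epsilon> * weight (window F y \<inter> U)"
proof (rule ccontr)
  define cut where "cut A = {y. \<exists>A'\<in>U. rel A A' \<and> (y + rep A \<in> F) \<noteq> (y + rep A' \<in> F)}" for A
  define E where "E A = {y. y + rep A \<in> F}" for A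
  have E[measurable]: "E A \<in> sets borel" for A
    unfolding E_def by (intro borel_right_vimage borel_compact F)
  have cut_eq: "cut A = (\<Union>A'\<in>{A'\<in>U. rel A A'}. (E A - E A') \<union> (E A' - E A))" for A
    by (auto simp: cut_def E_def)
  have cut[measurable]: "cut A \<in> sets borel" for A
    unfolding cut_eq using U by (intro sets.finite_UN) auto
  have eE: "emeasure r (E A) = ennreal (measure r F)" for A
    unfolding E_def emeasure_right_vimage[OF borel_compact[OF F(1)]]
    using emeasure_compact_finite[OF F(1)] by (simp add: emeasure_eq_ennreal_measure)
  have ecut: "emeasure r (cut A) \<le> ennreal (\<epsilon> * measure r F)" if "A \<in> U" for A
  proof -
    have "cut A \<subseteq> {y. y + rep A \<in> K_boundary D F}"
    proof
      fix y assume "y \<in> cut A"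
      then obtain A' where A': "A' \<in> U" "rel A A'" "(y + rep A \<in> F) \<noteq> (y + rep A' \<in> F)"
        by (auto simp: cut_def)
      then have "- rep A + rep A' \<in> D" using rel \<open>A \<in> U\<close> U by blast
      then have "y + rep A + (- rep A + rep A') \<in> left_translate (y + rep A) D" by blast
      then have "y + rep A' \<in> left_translate (y + rep A) D" by (metis add.assoc add_minus_cancel)
      moreover have "y + rep A \<in> left_translate (y + rep A) D" using F(5) by force
      ultimately show "y \<in> {y. y + rep A \<in> K_boundary D F}"
        using A'(3) unfolding K_boundary_def by blast
    qed
    then have "vol r (cut A) \<le> vol r {y. y + rep A \<in> K_boundary D F}" by (rule outer_measure_of_mono)
    also have "\<dots> \<le> vol r (K_boundary D F)" by (rule vol_right_vimage_le)
    also have "\<dots> \<le> ennreal \<epsilon> * vol r F" using F(3) by (simp add: boundary_invariant_def)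
    also have "\<dots> = ennreal (\<epsilon> * measure r F)"
      using F emeasure_compact_finite[OF F(1)] by (simp add: borel_compact ennreal_mult emeasure_eq_ennreal_measure)
    finally show ?thesis by simp
  qed
  define f where "f y = (\<Sum>A\<in>U. ennreal (measure r A) * indicator (cut A) y)" for y
  define g where "g y = (\<Sum>A\<in>U. ennreal (\<epsilon> * measure r A) * indicator (E A) y)" for y
  have f_eq: "f y = ennreal (weight {A \<in> U. y \<in> cut A})" for y
  proof -
    have "f y = (\<Sum>A\<in>U. ennreal (measure r A * indicator (cut A) y))"
      unfolding f_def by (intro sum.cong) (auto simp: indicator_def)
    also have "\<dots> = ennreal (\<Sum>A\<in>U. measure r A * indicator (cut A) y)" by (intro sum_ennreal) auto
    also have "(\<Sum>A\<in>U. measure r A * indicator (cut A) y) = weight {A \<in> U. y \<in> cut A}"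
      unfolding weight_def using U by (simp add: sum_times_indicator)
    finally show ?thesis .
  qed
  have g_eq: "g y = ennreal (\<epsilon> * weight (window F y \<inter> U))" for y
  proof -
    have "g y = (\<Sum>A\<in>U. ennreal (\<epsilon> * (measure r A * indicator (E A) y)))"
      unfolding g_def by (intro sum.cong) (auto simp: indicator_def)
    also have "\<dots> = ennreal (\<Sum>A\<in>U. \<epsilon> * (measure r A * indicator (E A) y))"
      using F(4) by (intro sum_ennreal) auto
    also have "(\<Sum>A\<in>U. \<epsilon> * (measure r A * indicator (E A) y)) = \<epsilon> * weight {A \<in> U. y \<in> E A}"
      unfolding weight_def using U by (simp add: sum_times_indicator flip: sum_distrib_left)
    also have "{A \<in> U. y \<in> E A} = window F y \<inter> U" using U by (auto simp: E_def window_def)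
    finally show ?thesis .
  qed
  assume *: "\<not> ?thesis"
  have cut_set: "{A \<in> U. \<exists>A'\<in>U. rel A A' \<and> (y + rep A \<in> F) \<noteq> (y + rep A' \<in> F)} = {A \<in> U. y \<in> cut A}" for y
    by (auto simp: cut_def)
  have strict: "\<epsilon> * weight (window F y \<inter> U) < weight {A \<in> U. y \<in> cut A}" if "window F y \<inter> U \<noteq> {}" for y
    using * that unfolding cut_set by (meson not_le_imp_less)
  have [measurable]: "f \<in> borel_measurable r" "g \<in> borel_measurable r"
    unfolding f_def g_def by measurable
  have int_g: "(\<integral>\<^sup>+y. g y \<partial>r) = (\<Sum>A\<in>U. ennreal (\<epsilon> * measure r A) * ennreal (measure r F))"
    unfolding g_def by (subst nn_integral_sum) (auto simp: nn_integral_cmult_indicator eE)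
  have int_f: "(\<integral>\<^sup>+y. f y \<partial>r) = (\<Sum>A\<in>U. ennreal (measure r A) * emeasure r (cut A))"
    unfolding f_def by (subst nn_integral_sum) (auto simp: nn_integral_cmult_indicator)
  have le: "(\<integral>\<^sup>+y. f y \<partial>r) \<le> (\<integral>\<^sup>+y. g y \<partial>r)"
    unfolding int_f int_g
  proof (rule sum_mono)
    fix A assume "A \<in> U"
    then have "ennreal (measure r A) * emeasure r (cut A) \<le> ennreal (measure r A) * ennreal (\<epsilon> * measure r F)"
      by (intro mult_left_mono ecut) auto
    also have "\<dots> = ennreal (\<epsilon> * measure r A) * ennreal (measure r F)"
      using F(4) by (simp add: ennreal_mult[symmetric] ac_simps)
    finally show "ennreal (measure r A) * emeasure r (cut A) \<le> ennreal (\<epsilon> * measure r A) * ennreal (measure r F)" .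
  qed
  \<comment> \<open>If every nonempty catch failed, the inequality would be strict on
    \<open>E A\<close> for any \<open>A\<close> in \<open>U\<close>, a set of positive measure; the
    integrals would then differ strictly, against \<open>le\<close>.\<close>
  have "(\<integral>\<^sup>+y. g y \<partial>r) < (\<integral>\<^sup>+y. f y \<partial>r)"
  proof (rule nn_integral_less)
    show "(\<integral>\<^sup>+y. g y \<partial>r) \<noteq> \<infinity>" unfolding int_g using F(4) by (simp add: sum_ennreal flip: ennreal_mult)
    show "AE y in r. g y \<le> f y"
    proof (rule AE_I2)
      fix y
      show "g y \<le> f y"
        unfolding f_eq g_eq using strict[of y] F(4)
        by (cases "window F y \<inter> U = {}") (auto intro!: ennreal_leI simp: weight_def)
    qed
    show "\<not> (AE y in r. f y \<le> g y)"
    proof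
      assume ae: "AE y in r. f y \<le> g y"
      obtain A where A: "A \<in> U" using U by blast
      have "AE y in r. y \<notin> E A"
        using ae
      proof eventually_elim
        fix y assume "f y \<le> g y"
        then have "weight {A \<in> U. y \<in> cut A} \<le> \<epsilon> * weight (window F y \<inter> U)"
          unfolding f_eq g_eq using F(4) weight_nonneg by simp
        then have "window F y \<inter> U = {}" using strict[of y] by linarith
        then show "y \<notin> E A" using A U by (auto simp: window_def E_def)
      qed
      then have "E A \<in> null_sets r" by (simp add: AE_iff_null_sets)
      then show False using eE[of A] F(2) by (simp add: null_sets_def)
    qed
  qed measurable
  then show False using le by simp
qed

text \<open>Greedy choice: catch atoms by a good translate, then continue with the uncovered rest. A
  related pair that gets separated is charged when it is first split, to the weight caught at that
  stage; the caught sets are disjoint, so the charges add up to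
  \<open>\<epsilon> * weight U\<close>.\<close>

lemma carving:
  assumes F: "compact F" "0 < measure r F" "boundary_invariant r \<epsilon> D F" "0 \<le> \<epsilon>" "0 \<in> D"
    and rel: "\<And>A A'. A \<in> P \<Longrightarrow> A' \<in> P \<Longrightarrow> rel A A' \<Longrightarrow> - rep A + rep A' \<in> D"
    and U: "finite U" "U \<subseteq> P"
  shows "\<exists>c. (\<forall>A\<in>U. c A + rep A \<in> F) \<and> weight {A \<in> U. \<exists>A'\<in>U. rel A A' \<and> c A \<noteq> c A'} \<le> \<epsilon> * weight U"
  using U
proof (induction "card U" arbitrary: U rule: less_induct)
  case less
  show ?case
  proof (cases "U = {}")
    case False
    obtain y where y: "window F y \<inter> U \<noteq> {}"
      "weight {A \<in> U. \<exists>A'\<in>U. rel A A' \<and> (y + rep A \<in> F) \<noteq> (y + rep A' \<in> F)} \<le> \<epsilon> * weight (window F y \<inter> U)"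
      using ex_good_translate[OF F rel less.prems False] by blast
    define T where "T = window F y \<inter> U"
    have T: "A \<in> T \<longleftrightarrow> y + rep A \<in> F" if "A \<in> U" for A using that less.prems by (auto simp: T_def window_def)
    have "card (U - T) < card U" using y less.prems by (intro psubset_card_mono) (auto simp: T_def)
    then obtain c where c: "\<forall>A\<in>U - T. c A + rep A \<in> F"
      "weight {A \<in> U - T. \<exists>A'\<in>U - T. rel A A' \<and> c A \<noteq> c A'} \<le> \<epsilon> * weight (U - T)"
      using less.hyps[of "U - T"] less.prems by auto
    define c' where "c' A = (if A \<in> T then y else c A)" for A
    let ?X = "{A \<in> U. \<exists>A'\<in>U. rel A A' \<and> (y + rep A \<in> F) \<noteq> (y + rep A' \<in> F)}"
    let ?Y = "{A \<in> U - T. \<exists>A'\<in>U - T. rel A A' \<and> c A \<noteq> c A'}"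
    have "{A \<in> U. \<exists>A'\<in>U. rel A A' \<and> c' A \<noteq> c' A'} \<subseteq> ?X \<union> ?Y"
    proof
      fix A assume "A \<in> {A \<in> U. \<exists>A'\<in>U. rel A A' \<and> c' A \<noteq> c' A'}"
      then obtain A' where A: "A \<in> U" "A' \<in> U" "rel A A'" "c' A \<noteq> c' A'" by blast
      show "A \<in> ?X \<union> ?Y"
      proof (cases "(A \<in> T) = (A' \<in> T)")
        case True
        then have "A \<notin> T" "A' \<notin> T" using A(4) by (auto simp: c'_def)
        then show ?thesis using A by (auto simp: c'_def)
      next
        case False
        then have "A \<in> ?X" using A T by blast
        then show ?thesis ..
      qed
    qed
    then have "weight {A \<in> U. \<exists>A'\<in>U. rel A A' \<and> c' A \<noteq> c' A'} \<le> weight (?X \<union> ?Y)"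
      using less.prems by (intro weight_mono) auto
    also have "\<dots> \<le> weight ?X + weight ?Y" using less.prems by (intro weight_Un_le) auto
    also have "\<dots> \<le> \<epsilon> * weight T + \<epsilon> * weight (U - T)" using y(2) c(2) by (simp add: T_def)
    also have "\<dots> = \<epsilon> * weight (T \<union> (U - T))"
      using less.prems by (subst weight_Un_disjoint) (auto simp: T_def distrib_left)
    also have "T \<union> (U - T) = U" by (auto simp: T_def)
    finally have "weight {A \<in> U. \<exists>A'\<in>U. rel A A' \<and> c' A \<noteq> c' A'} \<le> \<epsilon> * weight U" .
    moreover have "\<forall>A\<in>U. c' A + rep A \<in> F" using c(1) T by (auto simp: c'_def)
    ultimately show ?thesis by blast
  qed (simp add: weight_def)
qed

end

section \<open>Optimal configurations and absorption\<close>

context tame_partition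
begin

text \<open>A partition of \<open>P\<close> given by its class map, each class fitting into one left
  translate of \<open>F\<close>. As a function on atoms it can be altered inside one window and kept
  elsewhere.\<close>

definition configuration :: "'a set \<Rightarrow> ('a set \<Rightarrow> 'a set set) \<Rightarrow> bool" where
  "configuration F cl \<longleftrightarrow> (\<forall>A\<in>P. A \<in> cl A \<and> cl A \<subseteq> P \<and> (\<forall>A'\<in>cl A. cl A' = cl A) \<and>
     (\<exists>y. \<forall>A'\<in>cl A. y + rep A' \<in> F))"

lemma configurationD:
  assumes "configuration F cl" "A \<in> P"
  shows "A \<in> cl A" "cl A \<subseteq> P" "\<And>A'. A' \<in> cl A \<Longrightarrow> cl A' = cl A"
    "\<exists>y. \<forall>A'\<in>cl A. y + rep A' \<in> F"
  using assms unfolding configuration_def by blast+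

lemma configuration_finite:
  assumes "configuration F cl" "compact F" "A \<in> P"
  shows "finite (cl A)"
proof -
  obtain y where "\<forall>A'\<in>cl A. y + rep A' \<in> F" using configurationD(4)[OF assms(1,3)] ..
  then have "cl A \<subseteq> window F y" using configurationD(2)[OF assms(1,3)] unfolding window_def by blast
  then show ?thesis using finite_window[OF assms(2)] finite_subset by blast
qed

lemma configuration_near:
  assumes "configuration F cl" "A \<in> P" "A1 \<in> cl A" "A2 \<in> cl A"
  shows "- rep A1 + rep A2 \<in> uminus ` F + F"
proof -
  obtain y where "\<forall>A'\<in>cl A. y + rep A' \<in> F" using configurationD(4)[OF assms(1,2)] ..
  then have "- (y + rep A1) + (y + rep A2) \<in> uminus ` F + F" using assms by blast
  then show ?thesis by (metis add.assoc minus_add minus_add_cancel)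
qed

text \<open>A Markov estimate: an inner boundary atom of a class touches another class or leaves
  \<open>S\<close>. In a bad class such atoms make up more than the fraction
  \<open>\<epsilon>\<^sub>3\<close>; the classes are disjoint, so summation compares all bad atoms
  with all such atoms.\<close>

lemma weight_carving_bad:
  assumes F: "compact F" "0 < measure r F" "boundary_invariant r \<epsilon>\<^sub>1 (insert 0 (reach K)) F" "0 \<le> \<epsilon>\<^sub>1"
    and S: "finite S" "S \<subseteq> P" and \<epsilon>\<^sub>3: "0 < \<epsilon>\<^sub>3"
    and edge: "weight {A \<in> S. \<exists>A'\<in>P - S. adjacent K A A'} \<le> b"
  obtains c where "\<And>A. A \<in> S \<Longrightarrow> c A + rep A \<in> F"
    "\<epsilon>\<^sub>3 * weight {A \<in> S. \<not> weight (inner_boundary K {A' \<in> S. c A' = c A}) \<le> \<epsilon>\<^sub>3 * weight {A' \<in> S. c A' = c A}} \<le> \<epsilon>\<^sub>1 * weight S + b"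
proof -
  obtain c where c: "\<forall>A\<in>S. c A + rep A \<in> F"
    "weight {A \<in> S. \<exists>A'\<in>S. adjacent K A A' \<and> c A \<noteq> c A'} \<le> \<epsilon>\<^sub>1 * weight S"
    using carving[OF F _ _ S, of "adjacent K"] adjacent_reach by auto
  define T where "T z = {A' \<in> S. c A' = z}" for z
  define bad where "bad = {A \<in> S. \<not> weight (inner_boundary K (T (c A))) \<le> \<epsilon>\<^sub>3 * weight (T (c A))}"
  define X where "X = {A \<in> S. \<exists>A'\<in>S. adjacent K A A' \<and> c A \<noteq> c A'} \<union> {A \<in> S. \<exists>A'\<in>P - S. adjacent K A A'}"
  have fin: "finite bad" "finite X" "\<And>z. finite (T z)" using S by (auto simp: bad_def X_def T_def)
  have "weight bad = (\<Sum>z\<in>c ` bad. \<Sum>A\<in>{A \<in> bad. c A = z}. measure r A)"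
    unfolding weight_def using fin by (intro sum.image_gen)
  then have "\<epsilon>\<^sub>3 * weight bad = (\<Sum>z\<in>c ` bad. \<epsilon>\<^sub>3 * weight {A \<in> bad. c A = z})"
    by (simp add: sum_distrib_left weight_def)
  also have "\<dots> \<le> (\<Sum>z\<in>c ` bad. weight {A \<in> X. c A = z})"
  proof (rule sum_mono)
    fix z assume "z \<in> c ` bad"
    then have z: "\<not> weight (inner_boundary K (T z)) \<le> \<epsilon>\<^sub>3 * weight (T z)" by (auto simp: bad_def)
    have "{A \<in> bad. c A = z} \<subseteq> T z" by (auto simp: bad_def T_def)
    then have "\<epsilon>\<^sub>3 * weight {A \<in> bad. c A = z} \<le> \<epsilon>\<^sub>3 * weight (T z)"
      using \<epsilon>\<^sub>3 fin by (intro mult_left_mono weight_mono) auto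
    also have "\<dots> \<le> weight (inner_boundary K (T z))" using z by simp
    also have "\<dots> \<le> weight {A \<in> X. c A = z}"
      using fin S by (intro weight_mono) (auto simp: inner_boundary_def T_def X_def)
    finally show "\<epsilon>\<^sub>3 * weight {A \<in> bad. c A = z} \<le> weight {A \<in> X. c A = z}" .
  qed
  also have "\<dots> \<le> (\<Sum>z\<in>c ` S. weight {A \<in> X. c A = z})"
    using S by (intro sum_mono2) (auto simp: bad_def weight_nonneg)
  also have "\<dots> = weight X"
  proof -
    have "weight X = (\<Sum>z\<in>c ` X. weight {A \<in> X. c A = z})"
      unfolding weight_def using fin by (intro sum.image_gen)
    also have "\<dots> = (\<Sum>z\<in>c ` S. weight {A \<in> X. c A = z})"
    proof (intro sum.mono_neutral_left ballI)
      show "c ` X \<subseteq> c ` S" by (auto simp: X_def)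
      fix z assume "z \<in> c ` S - c ` X"
      then have "{A \<in> X. c A = z} = {}" by blast
      then show "weight {A \<in> X. c A = z} = 0" by (simp only: weight_def sum.empty)
    qed (use S in auto)
    finally show ?thesis by simp
  qed
  also have "\<dots> \<le> \<epsilon>\<^sub>1 * weight S + b"
    unfolding X_def using c(2) edge S by (intro order_trans[OF weight_Un_le]) auto
  finally show ?thesis using that[of c] c(1) unfolding bad_def T_def by blast
qed

text \<open>
  Among all configurations take one whose bad atoms in \<open>W\<^sub>1\<close> have least total measure; recarving a
  single window shows that the bad atoms then have small density in every window inside \<open>W\<^sub>1\<close>.
\<close>
lemma optimal_configuration:
  assumes K: "compact K" and \<epsilon>\<^sub>3: "0 < \<epsilon>\<^sub>3" "\<epsilon>\<^sub>3 \<le> 1" and \<delta>: "0 < \<delta>"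
    and F: "compact F" "0 < measure r F" "boundary_invariant r (\<delta> * \<epsilon>\<^sub>3 / 8) (insert 0 (reach K)) F"
    and V: "compact V" "boundary_invariant r \<eta> (collar (insert 0 (reach K) \<union> (uminus ` F + F))) V"
    and \<eta>: "0 \<le> \<eta>" "\<eta> \<le> 1 / 2" "\<eta> \<le> \<delta> * \<epsilon>\<^sub>3 / 4"
    and W\<^sub>1: "finite W\<^sub>1" "W\<^sub>1 \<subseteq> P"
  obtains cl where "configuration F cl"
    "\<And>y. window V y \<subseteq> W\<^sub>1 \<Longrightarrow>
      weight {A \<in> window V y. \<not> weight (inner_boundary K (cl A)) \<le> \<epsilon>\<^sub>3 * weight (cl A)} \<le> \<delta> * mass V y"
proof -
  define bad where "bad cl A \<longleftrightarrow> \<not> weight (inner_boundary K (cl A)) \<le> \<epsilon>\<^sub>3 * weight (cl A)" for cl :: "'a set \<Rightarrow> 'a set set" and A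
  define wt where "wt cl = weight {A \<in> W\<^sub>1. bad cl A}" for cl
  define D where "D = insert 0 (reach K) \<union> (uminus ` F + F)"
  \<comment> \<open>The minimum exists because the values are weights of subsets of the finite set
    \<open>W\<^sub>1\<close>.\<close>
  have "wt ` {cl. configuration F cl} \<subseteq> weight ` Pow W\<^sub>1" by (auto simp: wt_def)
  then have fin: "finite (wt ` {cl. configuration F cl})" using W\<^sub>1 finite_subset by blast
  have "F \<noteq> {}" using F(2) by auto
  then obtain f where "f \<in> F" by blast
  have "configuration F (\<lambda>A. {A})"
    unfolding configuration_def
  proof (intro ballI conjI)
    fix A
    show "\<exists>y. \<forall>A'\<in>{A}. y + rep A' \<in> F"
      using \<open>f \<in> F\<close> by (intro exI[of _ "f + - rep A"]) (simp add: add.assoc)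
  qed auto
  then have "wt ` {cl. configuration F cl} \<noteq> {}" by blast
  with fin have "Min (wt ` {cl. configuration F cl}) \<in> wt ` {cl. configuration F cl}" by (rule Min_in)
  then obtain cl where cl: "configuration F cl" "wt cl = Min (wt ` {cl. configuration F cl})" by fastforce
  have min: "wt cl \<le> wt cl'" if "configuration F cl'" for cl'
    using that fin cl(2) by (simp add: Min_le)
  have "weight {A \<in> window V y. bad cl A} \<le> \<delta> * mass V y" if y: "window V y \<subseteq> W\<^sub>1" for y
  proof -
    define S where "S = window V y"
    have S: "finite S" "S \<subseteq> P" using finite_window[OF V(1)] window_subset by (auto simp: S_def)
    note cut = weight_cut[OF V(1) V(2)[folded D_def] \<eta>(1)]
    have edge: "weight {A \<in> S. \<exists>A'\<in>P - S. adjacent K A A'} \<le> \<eta> * mass V y"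
    proof (rule cut)
      fix A assume "A \<in> {A \<in> S. \<exists>A'\<in>P - S. adjacent K A A'}"
      then obtain A' where A: "A \<in> S" "A' \<in> P" "A' \<notin> S" "adjacent K A A'" by blast
      then have "- rep A + rep A' \<in> D" using adjacent_reach S by (auto simp: D_def)
      then show "\<exists>A'\<in>P. - rep A + rep A' \<in> D \<and> (y + rep A \<in> V) \<noteq> (y + rep A' \<in> V)"
        using A by (intro bexI[of _ A']) (auto simp: S_def window_def)
    qed (use S in auto)
    obtain c where c: "\<And>A. A \<in> S \<Longrightarrow> c A + rep A \<in> F"
      "\<epsilon>\<^sub>3 * weight {A \<in> S. \<not> weight (inner_boundary K {A' \<in> S. c A' = c A}) \<le> \<epsilon>\<^sub>3 * weight {A' \<in> S. c A' = c A}} \<le>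
        \<delta> * \<epsilon>\<^sub>3 / 8 * weight S + \<eta> * mass V y"
      using weight_carving_bad[OF F _ S \<epsilon>\<^sub>3(1) edge] \<delta> \<epsilon>\<^sub>3(1) by auto
    \<comment> \<open>Inside the window the new carving is used; classes that reach in from outside
      lose what they have there.\<close>
    define cl' where "cl' A = (if A \<in> S then {A' \<in> S. c A' = c A} else cl A - S)" for A
    have "configuration F cl'"
      unfolding configuration_def
    proof (intro ballI conjI)
      fix A assume A: "A \<in> P"
      note clA = configurationD[OF cl(1) A]
      show "A \<in> cl' A" using clA(1) by (simp add: cl'_def)
      show "cl' A \<subseteq> P" using clA(2) S(2) by (auto simp: cl'_def)
      show "cl' A' = cl' A" if A': "A' \<in> cl' A" for A'
      proof (cases "A \<in> S")
        case True
        then show ?thesis using A' by (simp add: cl'_def)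
      next
        case False
        then show ?thesis using A' clA(3)[of A'] by (simp add: cl'_def)
      qed
      show "\<exists>y. \<forall>A'\<in>cl' A. y + rep A' \<in> F"
      proof (cases "A \<in> S")
        case True
        have "c A + rep A' \<in> F" if "A' \<in> cl' A" for A'
          using c(1)[of A'] that True by (simp add: cl'_def)
        then show ?thesis by blast
      next
        case False
        then have "cl' A \<subseteq> cl A" by (auto simp: cl'_def)
        then show ?thesis using clA(4) by blast
      qed
    qed
    then have "wt cl \<le> wt cl'" by (rule min)
    define Str where "Str = {A \<in> W\<^sub>1 - S. cl A \<inter> S \<noteq> {}}"
    define badS where "badS = {A \<in> S. bad cl' A}"
    have fS: "finite Str" "finite badS" using W\<^sub>1 S by (auto simp: Str_def badS_def)
    have Str: "weight Str \<le> \<eta> * mass V y"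
    proof (rule cut)
      show "finite Str" by fact
      show "Str \<subseteq> P" using W\<^sub>1 by (auto simp: Str_def)
      fix A assume "A \<in> Str"
      then obtain A' where A: "A \<in> P" "A \<notin> S" "A' \<in> cl A" "A' \<in> S" using W\<^sub>1 by (auto simp: Str_def)
      then have "- rep A + rep A' \<in> D"
        using configuration_near[OF cl(1) A(1) configurationD(1)[OF cl(1) A(1)] A(3)] by (simp add: D_def)
      then show "\<exists>A'\<in>P. - rep A + rep A' \<in> D \<and> (y + rep A \<in> V) \<noteq> (y + rep A' \<in> V)"
        using A S by (intro bexI[of _ A']) (auto simp: S_def window_def)
    qed
    have "wt cl' \<le> weight ({A \<in> W\<^sub>1 - S. bad cl A} \<union> (Str \<union> badS))"
      unfolding wt_def
    proof (rule weight_mono)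
      show "finite ({A \<in> W\<^sub>1 - S. bad cl A} \<union> (Str \<union> badS))" using W\<^sub>1 fS by auto
      show "{A \<in> W\<^sub>1. bad cl' A} \<subseteq> {A \<in> W\<^sub>1 - S. bad cl A} \<union> (Str \<union> badS)"
      proof
        fix A assume A: "A \<in> {A \<in> W\<^sub>1. bad cl' A}"
        show "A \<in> {A \<in> W\<^sub>1 - S. bad cl A} \<union> (Str \<union> badS)"
        proof (cases "A \<in> S \<or> cl A \<inter> S \<noteq> {}")
          case False
          then have "cl' A = cl A" by (auto simp: cl'_def)
          then show ?thesis using A False by (auto simp: bad_def)
        qed (use A in \<open>auto simp: Str_def badS_def\<close>)
      qed
    qed
    also have "\<dots> \<le> weight {A \<in> W\<^sub>1 - S. bad cl A} + (weight Str + weight badS)"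
      using W\<^sub>1 fS by (intro order_trans[OF weight_Un_le] add_left_mono weight_Un_le) auto
    finally have "wt cl' \<le> weight {A \<in> W\<^sub>1 - S. bad cl A} + (weight Str + weight badS)" .
    moreover have "wt cl = weight {A \<in> W\<^sub>1 - S. bad cl A} + weight {A \<in> S. bad cl A}"
    proof -
      have "{A \<in> W\<^sub>1. bad cl A} = {A \<in> W\<^sub>1 - S. bad cl A} \<union> {A \<in> S. bad cl A}"
        using y by (auto simp: S_def)
      then show ?thesis unfolding wt_def using W\<^sub>1 S by (simp only:) (rule weight_Un_disjoint; auto)
    qed
    ultimately have "weight {A \<in> S. bad cl A} \<le> weight Str + weight badS" using \<open>wt cl \<le> wt cl'\<close> by linarith
    moreover have "\<epsilon>\<^sub>3 * weight badS \<le> \<delta> * \<epsilon>\<^sub>3 / 8 * weight S + \<eta> * mass V y"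
    proof -
      have "badS = {A \<in> S. \<not> weight (inner_boundary K {A' \<in> S. c A' = c A}) \<le> \<epsilon>\<^sub>3 * weight {A' \<in> S. c A' = c A}}"
        by (auto simp: badS_def bad_def cl'_def)
      then show ?thesis using c(2) by simp
    qed
    \<comment> \<open>Since \<open>weight S\<close> is at most twice the mass of the window, carving
      and edge cost \<open>\<delta> * \<epsilon>\<^sub>3 / 4\<close> each. Division by
      \<open>\<epsilon>\<^sub>3\<close> leaves \<open>\<delta> / 2\<close>, and the outside atoms
      add \<open>\<delta> / 4\<close>.\<close>
    moreover have "\<delta> * \<epsilon>\<^sub>3 / 8 * weight S + \<eta> * mass V y \<le> \<epsilon>\<^sub>3 * (\<delta> / 2 * mass V y)"
    proof -
      have "weight S \<le> (1 + \<eta>) * mass V y"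
        unfolding S_def by (rule weight_window_le[OF V \<eta>(1)])
      also have "\<dots> \<le> 2 * mass V y" using \<eta> mass_nonneg by (intro mult_right_mono) auto
      finally have "\<delta> * \<epsilon>\<^sub>3 / 8 * weight S \<le> \<delta> * \<epsilon>\<^sub>3 / 8 * (2 * mass V y)"
        using \<delta> \<epsilon>\<^sub>3 by (intro mult_left_mono) auto
      moreover have "\<eta> * mass V y \<le> \<delta> * \<epsilon>\<^sub>3 / 4 * mass V y"
        using \<eta> mass_nonneg by (intro mult_right_mono) auto
      ultimately show ?thesis by (simp add: algebra_simps)
    qed
    ultimately have "weight {A \<in> S. bad cl A} \<le> weight Str + \<delta> / 2 * mass V y"
      using \<epsilon>\<^sub>3(1) by (smt (verit) mult_le_cancel_left_pos)
    moreover have "weight Str \<le> \<delta> / 4 * mass V y"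
    proof -
      have "\<delta> * \<epsilon>\<^sub>3 \<le> \<delta>" using \<delta> \<epsilon>\<^sub>3 by simp
      then have "\<eta> \<le> \<delta> / 4" using \<eta>(3) by linarith
      then have "\<eta> * mass V y \<le> \<delta> / 4 * mass V y" using mass_nonneg by (intro mult_right_mono)
      then show ?thesis using Str by linarith
    qed
    ultimately have "weight {A \<in> S. bad cl A} \<le> (\<delta> / 4 + \<delta> / 2) * mass V y" by (simp add: distrib_right)
    also have "\<dots> \<le> \<delta> * mass V y" using \<delta> mass_nonneg by (intro mult_right_mono) auto
    finally show ?thesis by (simp add: S_def)
  qed
  then show ?thesis using that[OF cl(1)] unfolding bad_def by blast
qed

lemma measure_atom_le:
  assumes "A \<in> P"
  shows "measure r A \<le> modular (rep A) * measure r B"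
proof -
  have "weight {A} \<le> measure r (left_translate (rep A) B)"
    using assms atom_sub[OF assms rep_in[OF assms]] by (intro weight_le_measure compact_left_translate compact_B) auto
  then show ?thesis
    using measure_eq_mass[OF compact_B, of "- rep A"] by (simp add: weight_def mass_def)
qed

text \<open>The bad atoms in window \<open>g\<close> are spread over the atoms of \<open>Y\<close>
  in window \<open>- h + g\<close>, whose mass is \<open>modular h\<close> times as large; this
  factor cancels against the measure of \<open>D t\<close>, and the fractional load of
  \<open>t\<close> is at most \<open>4 * \<delta> * measure r t\<close>. Rounding doubles it and
  adds \<open>4 * \<beta>\<close>, where \<open>\<beta>\<close> bounds a single absorbed atom
  relative to its class.\<close>

lemma absorption:
  assumes V: "compact V" "0 < measure r V"
    and h: "\<And>k k'. k \<in> V \<Longrightarrow> k' \<in> V \<Longrightarrow> modular k \<le> modular h * modular k'"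
    and X: "finite X" "X \<subseteq> P" and Y: "finite Y" "Y \<subseteq> P" and \<delta>: "0 \<le> \<delta>" and \<beta>: "0 \<le> \<beta>"
    and sparse: "\<And>g x. x \<in> X \<Longrightarrow> g + rep x \<in> V \<Longrightarrow> weight (window V g \<inter> X) \<le> \<delta> * mass V g"
    and rich: "\<And>g x. x \<in> X \<Longrightarrow> g + rep x \<in> V \<Longrightarrow> mass V (- h + g) \<le> 4 * weight (window V (- h + g) \<inter> Y)"
    and cl: "\<And>t. t \<in> Y \<Longrightarrow> finite (cl t) \<and> t \<in> cl t"
    and big: "\<And>t. t \<in> Y \<Longrightarrow> modular (rep t) * measure r B \<le> \<beta> * weight (cl t)"
  shows "\<exists>f. (\<forall>x\<in>X. \<exists>t\<in>Y. f x = cl t \<and> (\<exists>g. g + rep x \<in> V \<and> - h + g + rep t \<in> V)) \<and>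
    (\<forall>T\<in>cl ` Y. weight {x \<in> X. f x = T} \<le> (8 * \<delta> + 4 * \<beta>) * weight T)"
proof -
  define E where "E x = {g. g + rep x \<in> V}" for x
  define D where "D t = {g. - h + g + rep t \<in> V}" for t
  have D_eq: "D t = {g. g + rep t \<in> left_translate h V}" for t
    by (simp add: D_def left_translate_eq_vimage add.assoc)
  have E: "E x \<in> fmeasurable r" "measure r (E x) = measure r V" for x
  proof -
    have "emeasure r (E x) = emeasure r V"
      unfolding E_def by (rule emeasure_right_vimage[OF borel_compact[OF V(1)]])
    then show "E x \<in> fmeasurable r" "measure r (E x) = measure r V"
      using emeasure_compact_finite[OF V(1)] borel_right_vimage[OF borel_compact[OF V(1)], of "rep x"]
      by (auto intro!: fmeasurableI simp: measure_def E_def)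
  qed
  have D: "D t \<in> fmeasurable r" "measure r (D t) = modular h * measure r V" for t
  proof -
    have b: "left_translate h V \<in> sets borel" using V(1) by (rule borel_left_translate_compact)
    have "emeasure r (D t) = emeasure r (left_translate h V)"
      unfolding D_eq by (rule emeasure_right_vimage[OF b])
    then show "D t \<in> fmeasurable r" "measure r (D t) = modular h * measure r V"
      using emeasure_compact_finite[OF compact_left_translate[OF V(1)]] borel_right_vimage[OF b]
        measure_eq_mass[OF V(1), of "- h"]
      by (auto intro!: fmeasurableI simp: measure_def D_eq mass_def)
  qed
  have mass_h: "mass V (- h + g) = modular h * mass V g" for g
    by (simp add: mass_def minus_add modular_add ac_simps)
  have mass_pos: "0 < mass V g" for g using V(2) modular_pos by (simp add: mass_def)
  have winX: "(\<Sum>x\<in>{x \<in> X. g \<in> E x}. measure r x) = weight (window V g \<inter> X)" for g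
    unfolding weight_def using X by (intro sum.cong) (auto simp: E_def window_def)
  have winY: "(\<Sum>t\<in>{t \<in> Y. g \<in> D t}. measure r t) = weight (window V (- h + g) \<inter> Y)" for g
    unfolding weight_def using Y by (intro sum.cong) (auto simp: D_def window_def)
  obtain \<psi> :: "'a set \<Rightarrow> 'a set \<Rightarrow> real" where \<psi>:
    "\<And>x t. x \<in> X \<Longrightarrow> t \<in> Y \<Longrightarrow> 0 \<le> \<psi> x t"
    "\<And>x. x \<in> X \<Longrightarrow> (\<Sum>t\<in>Y. \<psi> x t) = 1"
    "\<And>t. t \<in> Y \<Longrightarrow> (\<Sum>x\<in>X. measure r x * \<psi> x t) \<le> (4 * \<delta> / modular h) * measure r t * measure r (D t) / measure r V"
    "\<And>x t. x \<in> X \<Longrightarrow> t \<in> Y \<Longrightarrow> 0 < \<psi> x t \<Longrightarrow> E x \<inter> D t \<noteq> {}"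
  proof (rule fractional_transport[where M = r and X = X and Y = Y and E = E and D = D and m = "measure r"
        and m' = "measure r" and a = "measure r V" and \<kappa> = "4 * \<delta> / modular h"])
    show "0 \<le> 4 * \<delta> / modular h" using \<delta> modular_pos[of h] by simp
    fix g x assume x: "x \<in> X" "g \<in> E x"
    then have "g + rep x \<in> V" by (simp add: E_def)
    note s = sparse[OF x(1) this] and ri = rich[OF x(1) this]
    show "0 < (\<Sum>t\<in>{t \<in> Y. g \<in> D t}. measure r t)"
      unfolding winY using ri mass_pos[of "- h + g"] by linarith
    have "\<delta> * mass V g = \<delta> / modular h * mass V (- h + g)"
      using modular_pos[of h] by (simp add: mass_h)
    also have "\<dots> \<le> \<delta> / modular h * (4 * weight (window V (- h + g) \<inter> Y))"
      using \<delta> modular_pos[of h] ri by (intro mult_left_mono) auto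
    finally show "(\<Sum>x\<in>{x \<in> X. g \<in> E x}. measure r x) \<le>
        4 * \<delta> / modular h * (\<Sum>t\<in>{t \<in> Y. g \<in> D t}. measure r t)"
      unfolding winX winY using s by (simp add: ac_simps)
  qed (use X Y E D V atom_pos in auto)
  have \<psi>_load: "(\<Sum>x\<in>X. measure r x * \<psi> x t) \<le> 4 * \<delta> * measure r t" if "t \<in> Y" for t
    using \<psi>(3)[OF that] V(2) modular_pos[of h] by (simp add: D(2))
  \<comment> \<open>Targets are merged into classes before rounding: one extra item may be too much
    for an atom, but is little for its whole class.\<close>
  define \<phi> where "\<phi> x T = (\<Sum>t\<in>{t \<in> Y. cl t = T}. \<psi> x t)" for x T
  have witness: "\<exists>t\<in>Y. T = cl t \<and> (\<exists>g. g + rep x \<in> V \<and> - h + g + rep t \<in> V)"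
    if x: "x \<in> X" and pos: "0 < \<phi> x T" for x T
  proof -
    have "\<exists>t\<in>{t \<in> Y. cl t = T}. 0 < \<psi> x t"
    proof (rule ccontr)
      assume "\<not> ?thesis"
      then have "\<phi> x T \<le> 0" unfolding \<phi>_def by (intro sum_nonpos) (auto simp: not_less)
      then show False using pos by simp
    qed
    then obtain t where "t \<in> Y" "cl t = T" "0 < \<psi> x t" by blast
    then show ?thesis using \<psi>(4)[OF x] by (fastforce simp: E_def D_def)
  qed
  have "\<exists>f. (\<forall>x\<in>X. f x \<in> cl ` Y \<and> 0 < \<phi> x (f x)) \<and>
    (\<forall>T\<in>cl ` Y. (\<Sum>x\<in>{x \<in> X. f x = T}. measure r x) \<le>
      2 * (\<Sum>x\<in>X. measure r x * \<phi> x T) + 4 * (\<beta> * weight T))"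
  proof (rule weighted_assignment_rounding)
    show "finite X" "finite (cl ` Y)" using X Y by auto
    show "0 \<le> \<phi> x T" if "x \<in> X" for x T unfolding \<phi>_def using \<psi>(1) that by (intro sum_nonneg) auto
    show "(\<Sum>T\<in>cl ` Y. \<phi> x T) = 1" if "x \<in> X" for x
      unfolding \<phi>_def using \<psi>(2)[OF that] sum.image_gen[OF Y(1), of "\<psi> x" cl] by simp
    show "0 < measure r x" if "x \<in> X" for x using that X atom_pos by blast
    show "0 \<le> \<beta> * weight T" for T using \<beta> weight_nonneg by simp
    fix x T assume x: "x \<in> X" and pos: "0 < \<phi> x T"
    obtain t g where t: "t \<in> Y" "T = cl t" and g: "g + rep x \<in> V" "- h + g + rep t \<in> V"
      using witness[OF x pos] by blast
    \<comment> \<open>This is what the shift by \<open>h\<close> is for: \<open>modular h\<close>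
      cancels against \<open>modular (- h)\<close>, so the target has at least the modular value of
      \<open>x\<close>. Hence the size of \<open>x\<close>, bounded through \<open>B\<close>, is
      small compared with the class of \<open>t\<close>.\<close>
    have "modular (g + rep x) \<le> modular h * modular (- h + g + rep t)" using g by (rule h)
    then have "modular (rep x) \<le> modular (rep t)"
      using modular_pos[of g] modular_pos[of h] by (simp add: modular_add modular_uminus field_simps)
    have "measure r x \<le> modular (rep x) * measure r B" using x X by (intro measure_atom_le) auto
    also have "\<dots> \<le> modular (rep t) * measure r B" by (intro mult_right_mono) (auto, fact)
    also have "\<dots> \<le> \<beta> * weight T" using big t by simp
    finally show "measure r x \<le> \<beta> * weight T" .
  qed
  then obtain f where f: "\<And>x. x \<in> X \<Longrightarrow> f x \<in> cl ` Y \<and> 0 < \<phi> x (f x)"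
    "\<And>T. T \<in> cl ` Y \<Longrightarrow> weight {x \<in> X. f x = T} \<le> 2 * (\<Sum>x\<in>X. measure r x * \<phi> x T) + 4 * (\<beta> * weight T)"
    unfolding weight_def by blast
  show ?thesis
  proof (intro exI[of _ f] conjI ballI)
    show "\<exists>t\<in>Y. f x = cl t \<and> (\<exists>g. g + rep x \<in> V \<and> - h + g + rep t \<in> V)" if "x \<in> X" for x
      using witness[OF that] f(1)[OF that] by blast
    fix T assume T: "T \<in> cl ` Y"
    have "(\<Sum>x\<in>X. measure r x * \<phi> x T) = (\<Sum>t\<in>{t \<in> Y. cl t = T}. \<Sum>x\<in>X. measure r x * \<psi> x t)"
      unfolding \<phi>_def sum_distrib_left by (rule sum.swap)
    also have "\<dots> \<le> (\<Sum>t\<in>{t \<in> Y. cl t = T}. 4 * \<delta> * measure r t)"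
      by (intro sum_mono \<psi>_load) auto
    also have "\<dots> = 4 * \<delta> * weight {t \<in> Y. cl t = T}" by (simp add: weight_def sum_distrib_left)
    also have "\<dots> \<le> 4 * \<delta> * weight T"
      using \<delta> T cl by (intro mult_left_mono weight_mono) auto
    finally show "weight {x \<in> X. f x = T} \<le> (8 * \<delta> + 4 * \<beta>) * weight T"
      using f(2)[OF T] by (simp add: algebra_simps)
  qed
qed

end

section \<open>Coarsening to invariant atoms\<close>

context tame_partition
begin

lemma compact_diff: "compact E \<Longrightarrow> compact G \<Longrightarrow> compact (uminus ` E + G :: 'a set)"
  by (intro compact_set_plus compact_uminus_image)

lemma diff_mem:
  assumes "g + a \<in> E" "g + b \<in> G"
  shows "- a + b \<in> uminus ` E + (G :: 'a set)"
proof -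
  have "- (g + a) + (g + b) \<in> uminus ` E + G" using assms by blast
  then show ?thesis by (metis add.assoc minus_add minus_add_cancel)
qed

lemma inner_boundary_mono: "K \<subseteq> K' \<Longrightarrow> inner_boundary K T \<subseteq> inner_boundary K' T"
  unfolding inner_boundary_def adjacent_def by blast

lemma inner_boundary_Un: "inner_boundary K (T \<union> L) \<subseteq> inner_boundary K T \<union> L"
  unfolding inner_boundary_def by blast

text \<open>The common translate of \<open>configuration\<close> is replaced by a bound on pairwise
  offsets. It involves finitely many atoms near \<open>A\<close>, as compactness requires, and
  remains valid for classes enlarged by absorption.\<close>

definition grouping :: "'a set \<Rightarrow> ('a set \<Rightarrow> 'a set set) \<Rightarrow> bool" where
  "grouping D cl \<longleftrightarrow> (\<forall>A\<in>P. A \<in> cl A \<and> cl A \<subseteq> P \<and>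
     (\<forall>A'\<in>cl A. cl A' = cl A \<and> - rep A + rep A' \<in> D))"

lemma groupingD:
  assumes "grouping D cl" "A \<in> P"
  shows "A \<in> cl A" "cl A \<subseteq> P" "\<And>A'. A' \<in> cl A \<Longrightarrow> cl A' = cl A"
    "\<And>A'. A' \<in> cl A \<Longrightarrow> - rep A + rep A' \<in> D"
proof -
  note * = bspec[OF assms(1)[unfolded grouping_def] assms(2)]
  show "A \<in> cl A" by (rule conjunct1[OF *])
  show "cl A \<subseteq> P" by (rule conjunct1[OF conjunct2[OF *]])
  show "cl A' = cl A" if "A' \<in> cl A" for A'
    by (rule conjunct1[OF bspec[OF conjunct2[OF conjunct2[OF *]] that]])
  show "- rep A + rep A' \<in> D" if "A' \<in> cl A" for A'
    by (rule conjunct2[OF bspec[OF conjunct2[OF conjunct2[OF *]] that]])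
qed

text \<open>
  The bad atoms in \<open>X\<close> are absorbed by good classes according to \<open>f\<close>; all other bad atoms
  become singletons.
\<close>
lemma regroup:
  assumes configuration: "configuration F cl"
    and good: "\<And>A. good A \<longleftrightarrow> weight (inner_boundary K\<^sub>1 (cl A)) \<le> \<epsilon>\<^sub>3 * weight (cl A)"
    and X: "X \<subseteq> P" "finite X" "\<And>x. x \<in> X \<Longrightarrow> \<not> good x"
    and Y: "Y \<subseteq> P" "\<And>t. t \<in> Y \<Longrightarrow> good t" "\<And>A. A \<in> W\<^sub>0 \<Longrightarrow> A \<in> X \<or> A \<in> Y"
    and W\<^sub>0: "W\<^sub>0 \<subseteq> P" and F: "compact F"
    and f: "\<And>x. x \<in> X \<Longrightarrow> \<exists>t\<in>Y. f x = cl t \<and> - rep x + rep t \<in> E \<and> - rep t + rep x \<in> E"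
    and load: "\<And>T. T \<in> cl ` Y \<Longrightarrow> weight {x \<in> X. f x = T} \<le> \<epsilon>\<^sub>2 * weight T"
    and E: "0 \<in> E" and \<epsilon>: "\<epsilon>\<^sub>3 \<le> \<epsilon>\<^sub>2" and K: "K \<subseteq> K\<^sub>1"
  shows "\<exists>cl'. grouping (insert 0 (E + (uminus ` F + F) + E)) cl' \<and>
    (\<forall>A\<in>W\<^sub>0. finite (cl' A) \<and> weight (inner_boundary K (cl' A)) \<le> 2 * \<epsilon>\<^sub>2 * weight (cl' A))"
proof -
  \<comment> \<open>\<open>key\<close> is the class that owns or absorbs the atom, and
    \<open>grp\<close> adds to a class everything sent to it. Class values serve as names, since
    \<open>cl\<close> is constant on a class.\<close>
  define key where "key A = (if A \<in> X then f A else cl A)" for A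
  define grp where "grp T = T \<union> {x \<in> X. f x = T}" for T
  define cl' where "cl' A = (if A \<in> X \<or> good A then grp (key A) else {A})" for A
  note clD = configurationD[OF configuration]
  have good_cong: "good A' \<longleftrightarrow> good A" if "A \<in> P" "A' \<in> cl A" for A A'
    using clD(3)[OF that] good by simp
  have key: "\<exists>t\<in>P. good t \<and> key A = cl t" if "A \<in> P" "A \<in> X \<or> good A" for A
    using that f Y X(3) unfolding key_def by (metis subsetD)
  have key_cl: "key A' = cl t" if "t \<in> P" "good t" "A' \<in> grp (cl t)" for t A'
  proof (cases "A' \<in> X")
    case True
    then have "A' \<notin> cl t" using X(3) good_cong that by blast
    then show ?thesis using that True by (auto simp: grp_def key_def)
  next
    case False
    then have "A' \<in> cl t" using that by (auto simp: grp_def)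
    then show ?thesis using False clD(3)[OF that(1)] by (simp add: key_def)
  qed
  have grp_good: "A' \<in> P \<and> (A' \<in> X \<or> good A')" if "t \<in> P" "good t" "A' \<in> grp (cl t)" for t A'
    using that clD(2)[OF that(1)] good_cong[OF that(1)] X(1) unfolding grp_def by blast
  have anchor: "\<exists>a\<in>cl t. - rep A + rep a \<in> E \<and> - rep a + rep A \<in> E"
    if t: "t \<in> P" "A \<in> grp (cl t)" for t A
  proof (cases "A \<in> cl t")
    case True
    then show ?thesis using E by (intro bexI[of _ A]) auto
  next
    case False
    then have A: "A \<in> X" "f A = cl t" using t by (auto simp: grp_def)
    obtain u where "u \<in> Y" "f A = cl u" "- rep A + rep u \<in> E" "- rep u + rep A \<in> E"
      using f[OF A(1)] by blast
    moreover have "u \<in> cl u" using \<open>u \<in> Y\<close> Y(1) clD(1) by blast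
    ultimately show ?thesis using A(2) by metis
  qed
  have near: "- rep A + rep A' \<in> E + (uminus ` F + F) + E"
    if t: "t \<in> P" "A \<in> grp (cl t)" "A' \<in> grp (cl t)" for t A A'
  proof -
    obtain a a' where a: "a \<in> cl t" "- rep A + rep a \<in> E" "a' \<in> cl t" "- rep a' + rep A' \<in> E"
      using anchor[OF t(1,2)] anchor[OF t(1,3)] by blast
    then have "- rep a + rep a' \<in> uminus ` F + F" using configuration_near[OF configuration t(1)] by blast
    from set_plus_intro[OF set_plus_intro[OF a(2) this] a(4)]
    have "(- rep A + rep a) + (- rep a + rep a') + (- rep a' + rep A') \<in> E + (uminus ` F + F) + E" .
    then show ?thesis by (metis add.assoc add_minus_cancel)
  qed
  have "grouping (insert 0 (E + (uminus ` F + F) + E)) cl'"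
    unfolding grouping_def
  proof (intro ballI conjI)
    fix A assume A: "A \<in> P"
    show "A \<in> cl' A"
      using clD(1)[OF A] by (auto simp: cl'_def grp_def key_def)
    show "cl' A \<subseteq> P"
    proof (cases "A \<in> X \<or> good A")
      case True
      then obtain t where "t \<in> P" "good t" "key A = cl t" using key[OF A] by blast
      then show ?thesis using grp_good True by (auto simp: cl'_def)
    qed (use A in \<open>simp add: cl'_def\<close>)
    fix A' assume A': "A' \<in> cl' A"
    have "cl' A' = cl' A \<and> - rep A + rep A' \<in> insert 0 (E + (uminus ` F + F) + E)"
    proof (cases "A \<in> X \<or> good A")
      case True
      then obtain t where t: "t \<in> P" "good t" "key A = cl t" using key[OF A] by blast
      have g: "A \<in> grp (cl t)" "A' \<in> grp (cl t)"
        using True A' t \<open>A \<in> cl' A\<close> by (simp_all add: cl'_def)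
      then have "cl' A' = cl' A"
        using True grp_good[OF t(1,2) g(2)] key_cl[OF t(1,2) g(2)] t(3) by (simp add: cl'_def)
      then show ?thesis using near[OF t(1) g] by simp
    qed (use A' in \<open>simp add: cl'_def\<close>)
    then show "cl' A' = cl' A" "- rep A + rep A' \<in> insert 0 (E + (uminus ` F + F) + E)" by auto
  qed
  moreover have "finite (cl' A) \<and> weight (inner_boundary K (cl' A)) \<le> 2 * \<epsilon>\<^sub>2 * weight (cl' A)" if A: "A \<in> W\<^sub>0" for A
  proof -
    have "\<exists>t\<in>Y. key A = cl t"
      using Y(3)[OF A] f X(3) Y(2) unfolding key_def by metis
    then obtain t where t: "t \<in> Y" "key A = cl t" "t \<in> P" using Y(1) by blast
    define T where "T = cl t"
    define L where "L = {x \<in> X. f x = T}"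
    have eq: "cl' A = T \<union> L"
      using Y(2,3) A t by (auto simp: cl'_def grp_def T_def L_def)
    have fin: "finite T" "finite L" using configuration_finite[OF configuration F t(3)] X(2) by (auto simp: T_def L_def)
    \<comment> \<open>All absorbed atoms are counted as boundary. This adds at most
      \<open>\<epsilon>\<^sub>2 * weight T\<close> to the
      \<open>\<epsilon>\<^sub>3 * weight T\<close> of the good class.\<close>
    have "inner_boundary K (T \<union> L) \<subseteq> inner_boundary K\<^sub>1 T \<union> L" using inner_boundary_Un inner_boundary_mono[OF K] by blast
    then have "weight (inner_boundary K (T \<union> L)) \<le> weight (inner_boundary K\<^sub>1 T \<union> L)"
      using fin by (intro weight_mono) (auto simp: inner_boundary_def)
    also have "\<dots> \<le> weight (inner_boundary K\<^sub>1 T) + weight L" using fin by (intro weight_Un_le) (auto simp: inner_boundary_def)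
    also have "\<dots> \<le> \<epsilon>\<^sub>3 * weight T + \<epsilon>\<^sub>2 * weight T"
      using good[of t] Y(2)[OF t(1)] load[of T] t(1) by (intro add_mono) (auto simp: T_def L_def)
    also have "\<dots> \<le> 2 * \<epsilon>\<^sub>2 * weight T"
      using mult_right_mono[OF \<epsilon> weight_nonneg[of T]] by simp
    also have "\<dots> \<le> 2 * \<epsilon>\<^sub>2 * weight (T \<union> L)"
    proof (rule mult_left_mono)
      show "weight T \<le> weight (T \<union> L)" using fin by (intro weight_mono) auto
      have "0 < weight T" using weight_pos[OF fin(1)] clD(1,2)[OF t(3)] by (auto simp: T_def)
      moreover have "0 \<le> weight L" by (rule weight_nonneg)
      moreover have "weight L \<le> \<epsilon>\<^sub>2 * weight T" using load[of T] t(1) by (auto simp: T_def L_def)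
      ultimately show "0 \<le> 2 * \<epsilon>\<^sub>2" by (smt (verit) mult_neg_pos)
    qed
    finally show ?thesis using eq fin by simp
  qed
  ultimately show ?thesis by blast
qed

text \<open>All choices, up to \<open>V\<close> and the shift \<open>h\<close>, are made before the
  finite region is given. Therefore \<open>D\<close> is uniform in \<open>W\<^sub>0\<close>, which
  the passage to the whole partition needs.\<close>

lemma finite_invariant_grouping:
  assumes folner: "\<And>\<epsilon> D. 0 < \<epsilon> \<Longrightarrow> compact D \<Longrightarrow>
      \<exists>F. compact F \<and> 0 < measure r F \<and> boundary_invariant r \<epsilon> D F"
    and infinite: "\<And>M. \<exists>K. compact K \<and> M \<le> measure r K"
    and K: "compact K" and \<epsilon>: "0 < \<epsilon>"
  obtains D where "compact D"
    "\<And>W\<^sub>0. finite W\<^sub>0 \<Longrightarrow> W\<^sub>0 \<subseteq> P \<Longrightarrow> \<exists>cl. grouping D cl \<and>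
      (\<forall>A\<in>W\<^sub>0. weight (inner_boundary K (cl A)) \<le> \<epsilon> * weight (cl A))"
proof -
  define \<epsilon>\<^sub>2 where "\<epsilon>\<^sub>2 = \<epsilon> / 2"
  have \<epsilon>\<^sub>2: "0 < \<epsilon>\<^sub>2" using \<epsilon> by (simp add: \<epsilon>\<^sub>2_def)
  \<comment> \<open>A good class at \<open>t\<close> weighs at least half of
    \<open>modular (rep t) * measure r K\<^sub>1\<close>. The factor 16 makes a single atom, bounded
    through \<open>B\<close>, at most \<open>\<epsilon>\<^sub>2 / 8\<close> of such a class.\<close>
  obtain K' where K': "compact K'" "16 * measure r B / \<epsilon>\<^sub>2 \<le> measure r K'" using infinite by blast
  define K\<^sub>1 where "K\<^sub>1 = K \<union> K'"
  have K\<^sub>1: "compact K\<^sub>1" "K \<subseteq> K\<^sub>1" using K K' by (auto simp: K\<^sub>1_def)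
  have "measure r K' \<le> measure r K\<^sub>1"
    using K\<^sub>1 K' emeasure_compact_finite
    by (intro measure_mono_fmeasurable fmeasurableI) (auto simp: K\<^sub>1_def borel_compact)
  then have "16 * measure r B / \<epsilon>\<^sub>2 \<le> measure r K\<^sub>1" using K'(2) by linarith
  then have rK\<^sub>1: "16 * measure r B \<le> \<epsilon>\<^sub>2 * measure r K\<^sub>1" using \<epsilon>\<^sub>2 by (simp add: field_simps)
  define N where "N = C * measure r (reach K\<^sub>1)"
  have N: "0 \<le> N" using C_pos by (simp add: N_def)
  \<comment> \<open>The bound by \<open>1 / (N + 1)\<close> makes every good class satisfy the
    hypothesis of \<open>weight_ge_of_small_inner_boundary\<close>; the bound by
    \<open>\<epsilon>\<^sub>2\<close> serves \<open>regroup\<close>.\<close>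
  define \<epsilon>\<^sub>3 where "\<epsilon>\<^sub>3 = min \<epsilon>\<^sub>2 (1 / (N + 1))"
  have \<epsilon>\<^sub>3: "0 < \<epsilon>\<^sub>3" "\<epsilon>\<^sub>3 \<le> 1" "\<epsilon>\<^sub>3 \<le> \<epsilon>\<^sub>2" "N * \<epsilon>\<^sub>3 \<le> 1"
  proof -
    show "0 < \<epsilon>\<^sub>3" "\<epsilon>\<^sub>3 \<le> \<epsilon>\<^sub>2" using \<epsilon>\<^sub>2 N by (auto simp: \<epsilon>\<^sub>3_def)
    have le: "\<epsilon>\<^sub>3 \<le> 1 / (N + 1)" by (simp add: \<epsilon>\<^sub>3_def)
    also have "\<dots> \<le> 1" using N by simp
    finally show "\<epsilon>\<^sub>3 \<le> 1" .
    have "N * \<epsilon>\<^sub>3 \<le> N * (1 / (N + 1))" using N le by (intro mult_left_mono)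
    also have "\<dots> \<le> 1" using N by simp
    finally show "N * \<epsilon>\<^sub>3 \<le> 1" .
  qed
  \<comment> \<open>With \<open>\<eta> \<le> 1 / 2\<close>, the bound \<open>1 / 4\<close> leaves a
    quarter of each window to good atoms, as \<open>absorption\<close> asks. The bound
    \<open>\<epsilon>\<^sub>2 / 16\<close> makes \<open>8 * \<delta>\<close> at most
    \<open>\<epsilon>\<^sub>2 / 2\<close>; the rounding term
    \<open>4 * (\<epsilon>\<^sub>2 / 8)\<close> is the other half.\<close>
  define \<delta> where "\<delta> = min (1 / 4) (\<epsilon>\<^sub>2 / 16)"
  have \<delta>: "0 < \<delta>" "\<delta> \<le> 1 / 4" "\<delta> \<le> \<epsilon>\<^sub>2 / 16" using \<epsilon>\<^sub>2 by (auto simp: \<delta>_def)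
  define \<eta> where "\<eta> = min (1 / 2) (\<delta> * \<epsilon>\<^sub>3 / 4)"
  have \<eta>: "0 < \<eta>" "\<eta> \<le> 1 / 2" "\<eta> \<le> \<delta> * \<epsilon>\<^sub>3 / 4" using \<delta> \<epsilon>\<^sub>3 by (auto simp: \<eta>_def)
  have "compact (insert 0 (reach K\<^sub>1))" using K\<^sub>1 by (intro compact_insert compact_reach)
  then obtain F where F: "compact F" "0 < measure r F"
    "boundary_invariant r (\<delta> * \<epsilon>\<^sub>3 / 8) (insert 0 (reach K\<^sub>1)) F"
    using folner[of "\<delta> * \<epsilon>\<^sub>3 / 8"] \<delta> \<epsilon>\<^sub>3 by auto
  have "compact (collar (insert 0 (reach K\<^sub>1) \<union> (uminus ` F + F)))"
    using K\<^sub>1 F by (intro compact_collar compact_Un compact_insert compact_reach compact_diff)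
  then obtain V where V: "compact V" "0 < measure r V"
    "boundary_invariant r \<eta> (collar (insert 0 (reach K\<^sub>1) \<union> (uminus ` F + F))) V"
    using folner[of \<eta>] \<eta> by auto
  obtain h where h: "\<And>k k'. k \<in> V \<Longrightarrow> k' \<in> V \<Longrightarrow> modular k \<le> modular h * modular k'"
    using modular_dominating[OF V(1)] by blast
  define V' where "V' = left_translate h V"
  have V': "compact V'" unfolding V'_def by (rule compact_left_translate[OF V(1)])
  have V'_iff: "- h + g + x \<in> V \<longleftrightarrow> g + x \<in> V'" for g x
    by (simp add: V'_def left_translate_eq_vimage add.assoc)
  define E where "E = insert 0 ((uminus ` V + V') \<union> (uminus ` V' + V))"
  have E: "compact E" unfolding E_def using V V' by (intro compact_insert compact_Un compact_diff)
  define D where "D = insert 0 (E + (uminus ` F + F) + E)"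
  show ?thesis
  proof (rule that)
    show "compact D" unfolding D_def using E F by (intro compact_insert compact_set_plus compact_diff)
    fix W\<^sub>0 assume W\<^sub>0: "finite W\<^sub>0" "W\<^sub>0 \<subseteq> P"
    \<comment> \<open>\<open>W\<^sub>1\<close> must contain each window that catches an atom of
      \<open>W\<^sub>0\<close>, and also its shift by \<open>h\<close>, so that sparsity holds in
      both.\<close>
    define Dw where "Dw = insert 0 ((uminus ` V + V) \<union> (uminus ` V + V'))"
    have Dw: "compact Dw" unfolding Dw_def using V V' by (intro compact_insert compact_Un compact_diff)
    define W\<^sub>1 where "W\<^sub>1 = (\<Union>x\<in>W\<^sub>0. {A \<in> P. - rep x + rep A \<in> Dw})"
    have W\<^sub>1: "finite W\<^sub>1" "W\<^sub>1 \<subseteq> P" "W\<^sub>0 \<subseteq> W\<^sub>1"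
      using W\<^sub>0 near_finite[OF Dw] by (auto simp: W\<^sub>1_def Dw_def)
    have window\<^sub>1: "window V g \<subseteq> W\<^sub>1" "window V (- h + g) \<subseteq> W\<^sub>1" if "x \<in> W\<^sub>0" "g + rep x \<in> V" for x g
    proof -
      have "- rep x + rep A \<in> Dw" if "A \<in> window V g" for A
        using diff_mem[OF \<open>g + rep x \<in> V\<close>, of "rep A" V] that by (auto simp: window_def Dw_def)
      then show "window V g \<subseteq> W\<^sub>1" using \<open>x \<in> W\<^sub>0\<close> by (fastforce simp: W\<^sub>1_def window_def)
      have "- rep x + rep A \<in> Dw" if "A \<in> window V (- h + g)" for A
        using diff_mem[OF \<open>g + rep x \<in> V\<close>, of "rep A" V'] that by (auto simp: window_def Dw_def V'_iff)
      then show "window V (- h + g) \<subseteq> W\<^sub>1" using \<open>x \<in> W\<^sub>0\<close> by (fastforce simp: W\<^sub>1_def window_def)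
    qed
    obtain cl where cl: "configuration F cl" "\<And>y. window V y \<subseteq> W\<^sub>1 \<Longrightarrow>
        weight {A \<in> window V y. \<not> weight (inner_boundary K\<^sub>1 (cl A)) \<le> \<epsilon>\<^sub>3 * weight (cl A)} \<le> \<delta> * mass V y"
      using optimal_configuration[OF K\<^sub>1(1) \<epsilon>\<^sub>3(1,2) \<delta>(1) F V(1,3) less_imp_le[OF \<eta>(1)] \<eta>(2,3) W\<^sub>1(1,2)] by blast
    define good where "good A \<longleftrightarrow> weight (inner_boundary K\<^sub>1 (cl A)) \<le> \<epsilon>\<^sub>3 * weight (cl A)" for A
    define X where "X = {A \<in> W\<^sub>0. \<not> good A}"
    define Y where "Y = {A \<in> W\<^sub>1. good A}"
    have sparse: "weight {A \<in> window V y. \<not> good A} \<le> \<delta> * mass V y" if "window V y \<subseteq> W\<^sub>1" for y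
      using cl(2)[OF that] by (simp add: good_def)
    have fin: "finite X" "X \<subseteq> P" "finite Y" "Y \<subseteq> P"
      using W\<^sub>0 W\<^sub>1 by (auto simp: X_def Y_def)
    have "\<exists>f. (\<forall>x\<in>X. \<exists>t\<in>Y. f x = cl t \<and> (\<exists>g. g + rep x \<in> V \<and> - h + g + rep t \<in> V)) \<and>
      (\<forall>T\<in>cl ` Y. weight {x \<in> X. f x = T} \<le> (8 * \<delta> + 4 * (\<epsilon>\<^sub>2 / 8)) * weight T)"
    proof (rule absorption[OF V(1,2) _ fin less_imp_le[OF \<delta>(1)], where \<beta> = "\<epsilon>\<^sub>2 / 8" and cl = cl])
      show "modular k \<le> modular h * modular k'" if "k \<in> V" "k' \<in> V" for k k' using that by (rule h)
      show "0 \<le> \<epsilon>\<^sub>2 / 8" using \<epsilon>\<^sub>2 by simp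
      fix g x assume x: "x \<in> X" "g + rep x \<in> V"
      then have "x \<in> W\<^sub>0" by (simp add: X_def)
      note w = window\<^sub>1[OF this x(2)]
      have "weight (window V g \<inter> X) \<le> weight {A \<in> window V g. \<not> good A}"
        using finite_window[OF V(1)] by (intro weight_mono) (auto simp: X_def)
      then show "weight (window V g \<inter> X) \<le> \<delta> * mass V g" using sparse[OF w(1)] by linarith
      let ?y = "- h + g"
      have "(1 - \<eta>) * mass V ?y \<le> weight (window V ?y)" by (rule weight_window_ge[OF V(1,3) less_imp_le[OF \<eta>(1)]])
      also have "\<dots> \<le> weight ((window V ?y \<inter> Y) \<union> {A \<in> window V ?y. \<not> good A})"
        using finite_window[OF V(1)] w(2) by (intro weight_mono) (auto simp: Y_def)
      also have "\<dots> \<le> weight (window V ?y \<inter> Y) + weight {A \<in> window V ?y. \<not> good A}"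
        using finite_window[OF V(1)] by (intro weight_Un_le) auto
      also have "\<dots> \<le> weight (window V ?y \<inter> Y) + \<delta> * mass V ?y" using sparse[OF w(2)] by simp
      finally have "(1 - \<eta> - \<delta>) * mass V ?y \<le> weight (window V ?y \<inter> Y)" by (simp add: algebra_simps)
      moreover have "1 / 4 * mass V ?y \<le> (1 - \<eta> - \<delta>) * mass V ?y"
        using \<eta>(2) \<delta>(2) mass_nonneg by (intro mult_right_mono) auto
      ultimately show "mass V ?y \<le> 4 * weight (window V ?y \<inter> Y)" by linarith
    next
      fix t assume "t \<in> Y"
      then have t: "t \<in> P" "good t" using fin by (auto simp: Y_def)
      note clt = configurationD[OF cl(1) t(1)]
      have fcl: "finite (cl t)" by (rule configuration_finite[OF cl(1) F(1) t(1)])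
      then show "finite (cl t) \<and> t \<in> cl t" using clt by blast
      have "N * weight (inner_boundary K\<^sub>1 (cl t)) \<le> N * (\<epsilon>\<^sub>3 * weight (cl t))"
        using t(2) N unfolding good_def by (intro mult_left_mono)
      also have "\<dots> \<le> weight (cl t)"
        using mult_right_mono[OF \<epsilon>\<^sub>3(4) weight_nonneg[of "cl t"]] by (simp add: mult.assoc)
      finally have "modular (rep t) * measure r K\<^sub>1 \<le> 2 * weight (cl t)"
        unfolding N_def by (intro weight_ge_of_small_inner_boundary fcl clt K\<^sub>1)
      then have "\<epsilon>\<^sub>2 * (modular (rep t) * measure r K\<^sub>1) \<le> \<epsilon>\<^sub>2 * (2 * weight (cl t))"
        using \<epsilon>\<^sub>2 by (intro mult_left_mono) auto
      moreover have "modular (rep t) * (16 * measure r B) \<le> modular (rep t) * (\<epsilon>\<^sub>2 * measure r K\<^sub>1)"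
        using rK\<^sub>1 modular_pos[of "rep t"] by (intro mult_left_mono) auto
      ultimately show "modular (rep t) * measure r B \<le> \<epsilon>\<^sub>2 / 8 * weight (cl t)"
        by (simp add: mult.left_commute)
    qed
    then obtain f where
      f: "\<forall>x\<in>X. \<exists>t\<in>Y. f x = cl t \<and> (\<exists>g. g + rep x \<in> V \<and> - h + g + rep t \<in> V)"
        "\<forall>T\<in>cl ` Y. weight {x \<in> X. f x = T} \<le> (8 * \<delta> + 4 * (\<epsilon>\<^sub>2 / 8)) * weight T" by (elim exE conjE)
    have "\<exists>cl'. grouping (insert 0 (E + (uminus ` F + F) + E)) cl' \<and>
      (\<forall>A\<in>W\<^sub>0. finite (cl' A) \<and> weight (inner_boundary K (cl' A)) \<le> 2 * \<epsilon>\<^sub>2 * weight (cl' A))"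
    proof (rule regroup[OF cl(1), where good = good and X = X and Y = Y and f = f])
      show "\<exists>t\<in>Y. f x = cl t \<and> - rep x + rep t \<in> E \<and> - rep t + rep x \<in> E" if x: "x \<in> X" for x
      proof -
        obtain t g where t: "t \<in> Y" "f x = cl t" "g + rep x \<in> V" "g + rep t \<in> V'"
          using bspec[OF f(1) x] unfolding V'_iff by blast
        then have "- rep x + rep t \<in> E" "- rep t + rep x \<in> E"
          using diff_mem[OF t(3,4)] diff_mem[OF t(4,3)] by (auto simp: E_def)
        then show ?thesis using t by blast
      qed
      show "weight {x \<in> X. f x = T} \<le> \<epsilon>\<^sub>2 * weight T" if "T \<in> cl ` Y" for T
      proof -
        have "(8 * \<delta> + 4 * (\<epsilon>\<^sub>2 / 8)) * weight T \<le> \<epsilon>\<^sub>2 * weight T"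
          using \<delta>(3) weight_nonneg by (intro mult_right_mono) auto
        then show ?thesis using bspec[OF f(2) that] by linarith
      qed
      show "good A \<longleftrightarrow> weight (inner_boundary K\<^sub>1 (cl A)) \<le> \<epsilon>\<^sub>3 * weight (cl A)" for A by (simp add: good_def)
    qed (use W\<^sub>0 W\<^sub>1 F K\<^sub>1 \<epsilon>\<^sub>3 in \<open>auto simp: X_def Y_def E_def\<close>)
    then show "\<exists>cl. grouping D cl \<and> (\<forall>A\<in>W\<^sub>0. weight (inner_boundary K (cl A)) \<le> \<epsilon> * weight (cl A))"
      by (auto simp: D_def \<epsilon>\<^sub>2_def)
  qed
qed

text \<open>One Boolean variable per pair of atoms says whether the second belongs to the class of
  the first. Restricting classes to the finite sets \<open>near A\<close> builds in the offset bound
  and makes each requirement depend on finitely many variables.\<close>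

lemma invariant_grouping:
  assumes D: "compact D"
    and local: "\<And>W\<^sub>0. finite W\<^sub>0 \<Longrightarrow> W\<^sub>0 \<subseteq> P \<Longrightarrow> \<exists>cl. grouping D cl \<and>
      (\<forall>A\<in>W\<^sub>0. weight (inner_boundary K (cl A)) \<le> \<epsilon> * weight (cl A))"
  shows "\<exists>cl. grouping D cl \<and> (\<forall>A\<in>P. weight (inner_boundary K (cl A)) \<le> \<epsilon> * weight (cl A))"
proof -
  define near where "near A = {A' \<in> P. - rep A + rep A' \<in> D}" for A
  have near: "finite (near A)" "near A \<subseteq> P" for A using near_finite[OF D] by (auto simp: near_def)
  define cls where "cls e A = {A' \<in> near A. e (A, A')}" for e A
  define Q where "Q A e \<longleftrightarrow> A \<in> cls e A \<and> (\<forall>A'\<in>cls e A. cls e A' = cls e A) \<and>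
    weight (inner_boundary K (cls e A)) \<le> \<epsilon> * weight (cls e A)" for A e
  have "\<exists>e. \<forall>A\<in>P. Q A e"
  proof (rule boolean_compactness)
    fix A assume "A \<in> P"
    \<comment> \<open>The requirement at \<open>A\<close> reads its own class and, for consistency,
      the classes of the atoms that may belong to it.\<close>
    define J where "J = ({A} \<times> near A) \<union> (\<Union>A'\<in>near A. {A'} \<times> near A')"
    have "Q A e'" if "\<forall>j\<in>J. e j = e' j" "Q A e" for e e'
    proof -
      have 1: "cls e A = cls e' A" using that(1) by (auto simp: cls_def J_def)
      have 2: "cls e A' = cls e' A'" if "A' \<in> near A" for A'
        using \<open>\<forall>j\<in>J. e j = e' j\<close> that by (auto simp: cls_def J_def)
      have "A' \<in> near A" if "A' \<in> cls e A" for A' using that by (simp add: cls_def)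
      then show ?thesis using that(2) 1 2 unfolding Q_def by metis
    qed
    moreover have "finite J" using near by (simp add: J_def)
    ultimately show "\<exists>J. finite J \<and> (\<forall>f g. (\<forall>j\<in>J. f j = g j) \<longrightarrow> Q A f \<longrightarrow> Q A g)" by blast
  next
    fix W\<^sub>0 assume W\<^sub>0: "finite W\<^sub>0" "W\<^sub>0 \<subseteq> P"
    obtain cl where cl: "grouping D cl" "\<forall>A\<in>W\<^sub>0. weight (inner_boundary K (cl A)) \<le> \<epsilon> * weight (cl A)"
      using local[OF W\<^sub>0] by blast
    define e where "e p \<longleftrightarrow> snd p \<in> cl (fst p)" for p
    have cls: "cls e A = cl A" if "A \<in> P" for A
    proof -
      have "cl A \<subseteq> near A"
        using groupingD(2,4)[OF cl(1) that] unfolding near_def by blast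
      then show ?thesis by (auto simp: cls_def e_def)
    qed
    have "Q A e" if A: "A \<in> W\<^sub>0" for A
    proof -
      have "A \<in> P" using A W\<^sub>0 by blast
      note g = groupingD[OF cl(1) this]
      have "cls e A' = cl A" if "A' \<in> cl A" for A'
        using cls[of A'] that g(2,3) by blast
      then show ?thesis using cls[OF \<open>A \<in> P\<close>] cl(2) A g(1) unfolding Q_def by simp
    qed
    then show "\<exists>e. \<forall>A\<in>W\<^sub>0. Q A e" by blast
  qed
  then obtain e where e: "\<And>A. A \<in> P \<Longrightarrow> Q A e" by blast
  have "grouping D (cls e)"
    unfolding grouping_def
  proof (intro ballI conjI)
    fix A assume "A \<in> P"
    then have q: "Q A e" by (rule e)
    then show "A \<in> cls e A" unfolding Q_def by blast
    show "cls e A \<subseteq> P" unfolding cls_def near_def by blast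
    fix A' assume A': "A' \<in> cls e A"
    then show "cls e A' = cls e A" using q unfolding Q_def by blast
    show "- rep A + rep A' \<in> D" using A' unfolding cls_def near_def by blast
  qed
  moreover have "\<forall>A\<in>P. weight (inner_boundary K (cls e A)) \<le> \<epsilon> * weight (cls e A)" using e unfolding Q_def by blast
  ultimately show ?thesis by blast
qed

text \<open>The constant \<open>C\<close> is unchanged: the bound for \<open>modular p\<close> by
  the old atom containing \<open>p\<close> carries over to the larger new atom. Only the compact set
  \<open>B\<close> grows.\<close>

lemma coarsening:
  assumes folner: "\<And>\<epsilon> D. 0 < \<epsilon> \<Longrightarrow> compact D \<Longrightarrow>
      \<exists>F. compact F \<and> 0 < measure r F \<and> boundary_invariant r \<epsilon> D F"
    and infinite: "\<And>M. \<exists>K. compact K \<and> M \<le> measure r K"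
    and K: "compact K" and \<epsilon>: "0 < \<epsilon>"
  shows "\<exists>P' B'. tame P' B' C \<and> (\<forall>A\<in>P. \<exists>A'\<in>P'. A \<subseteq> A') \<and> (\<forall>A\<in>P'. invariant_set r \<epsilon> K A)"
proof -
  define M where "M = C * measure r (reach K)"
  have M: "0 \<le> M" using C_pos by (simp add: M_def)
  \<comment> \<open>Passing from inner to outer boundary costs the factor \<open>M\<close>; adding
    one avoids division by zero.\<close>
  have "0 < \<epsilon> / (M + 1)" using M \<epsilon> by simp
  from finite_invariant_grouping[OF folner infinite K this] obtain D where D: "compact D"
    "\<And>W\<^sub>0. finite W\<^sub>0 \<Longrightarrow> W\<^sub>0 \<subseteq> P \<Longrightarrow> \<exists>cl. grouping D cl \<and>
      (\<forall>A\<in>W\<^sub>0. weight (inner_boundary K (cl A)) \<le> \<epsilon> / (M + 1) * weight (cl A))" by metis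
  have "\<exists>cl. grouping D cl \<and> (\<forall>A\<in>P. weight (inner_boundary K (cl A)) \<le> \<epsilon> / (M + 1) * weight (cl A))"
    by (rule invariant_grouping[OF D(1)]) (rule D(2))
  then obtain cl where gr: "grouping D cl" and "\<forall>A\<in>P. weight (inner_boundary K (cl A)) \<le> \<epsilon> / (M + 1) * weight (cl A)"
    by (elim exE conjE)
  then have inv: "\<And>A. A \<in> P \<Longrightarrow> weight (inner_boundary K (cl A)) \<le> \<epsilon> / (M + 1) * weight (cl A)" by (elim bspec)
  note cl = groupingD[OF gr]
  have fin: "finite (cl A)" if "A \<in> P" for A
    using cl(2,4)[OF that] by (intro finite_subset[OF _ near_finite[OF D(1), of A]]) blast
  define P' where "P' = (\<lambda>A. \<Union>(cl A)) ` P"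
  \<comment> \<open>From a point to the base point of its old atom, on to another base point of the
    class, and from there to a point of that atom.\<close>
  define B' where "B' = B + D + B"
  have "partition_on UNIV P'"
  proof (rule partition_onI)
    have "x \<in> \<Union>P'" for x
    proof -
      obtain A where "A \<in> P" "x \<in> A" using atom_cover by blast
      then show ?thesis using cl(1) unfolding P'_def by blast
    qed
    then show "\<Union>P' = UNIV" by blast
    show "{} \<notin> P'"
      using cl(1) rep_in unfolding P'_def by blast
    fix p q assume p: "p \<in> P'" "q \<in> P'" "p \<noteq> q"
    then obtain A A' where A: "A \<in> P" "A' \<in> P" "p = \<Union>(cl A)" "q = \<Union>(cl A')" by (auto simp: P'_def)
    show "disjnt p q"
    proof (rule ccontr)
      assume "\<not> disjnt p q"
      then obtain x a a' where x: "a \<in> cl A" "a' \<in> cl A'" "x \<in> a" "x \<in> a'"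
        using A by (auto simp: disjnt_def)
      then have "a = a'" using atom_disjoint[of a a' x] cl(2)[OF A(1)] cl(2)[OF A(2)] by blast
      then have "cl A = cl A'" using x cl(3)[OF A(1)] cl(3)[OF A(2)] by metis
      then show False using A p by simp
    qed
  qed
  moreover have "compact B'" unfolding B'_def by (intro compact_set_plus compact_B D)
  moreover have "A' \<in> sets borel \<and> (\<forall>p\<in>A'. A' \<subseteq> left_translate p B' \<and> modular p \<le> C * measure r A')"
    if A': "A' \<in> P'" for A'
  proof -
    obtain A where A: "A \<in> P" "A' = \<Union>(cl A)" using A' by (auto simp: P'_def)
    show ?thesis
    proof (intro conjI ballI)
      show b: "A' \<in> sets borel" unfolding A(2) by (intro borel_Union fin cl A)
      fix p assume "p \<in> A'"
      then obtain a where a: "a \<in> cl A" "p \<in> a" "a \<in> P" using A cl(2) by blast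
      have "modular p \<le> C * measure r a" using a by (intro modular_le)
      also have "\<dots> \<le> C * measure r A'"
      proof (intro mult_left_mono measure_mono_fmeasurable)
        show "a \<subseteq> A'" using a A by blast
        have "emeasure r A' < \<infinity>" unfolding A(2) using emeasure_Union[OF fin cl(2)] A by simp
        then show "A' \<in> fmeasurable r" using b by (intro fmeasurableI) simp_all
      qed (use a borel_P C_pos in auto)
      finally show "modular p \<le> C * measure r A'" .
      show "A' \<subseteq> left_translate p B'"
      proof
        fix q assume "q \<in> A'"
        then obtain a' where a': "a' \<in> cl A" "q \<in> a'" "a' \<in> P" using A cl(2) by blast
        have "a' \<in> cl a" using a' a cl(3)[OF A(1)] by simp
        then have "- rep a + rep a' \<in> D" using cl(4)[OF a(3)] by blast
        moreover have "- p + rep a \<in> B" "- rep a' + q \<in> B" using a a' diff_in_B rep_in by blast+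
        ultimately have "(- p + rep a) + (- rep a + rep a') + (- rep a' + q) \<in> B'"
          unfolding B'_def by (metis set_plus_intro)
        then have "- p + q \<in> B'" by (metis add.assoc add_minus_cancel)
        then show "q \<in> left_translate p B'" by (simp only: left_translate_eq_vimage mem_Collect_eq)
      qed
    qed
  qed
  ultimately have "tame P' B' C" using C_pos unfolding tame_def by blast
  moreover have "\<forall>A\<in>P. \<exists>A'\<in>P'. A \<subseteq> A'" using cl(1) unfolding P'_def by blast
  moreover have "\<forall>A\<in>P'. invariant_set r \<epsilon> K A"
  proof
    fix A' assume "A' \<in> P'"
    then obtain A where A: "A \<in> P" "A' = \<Union>(cl A)" by (auto simp: P'_def)
    have "M * weight (inner_boundary K (cl A)) \<le> M * (\<epsilon> / (M + 1) * weight (cl A))" using inv[OF A(1)] M by (rule mult_left_mono)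
    also have "\<dots> = (M / (M + 1)) * (\<epsilon> * weight (cl A))" by simp
    also have "\<dots> \<le> 1 * (\<epsilon> * weight (cl A))"
      using M \<epsilon> weight_nonneg by (intro mult_right_mono) auto
    finally show "invariant_set r \<epsilon> K A'"
      unfolding A(2) M_def using \<epsilon> by (intro invariant_set_Union fin cl A K) auto
  qed
  ultimately show ?thesis by blast
qed

end

section \<open>Construction of the filtration\<close>

context lc_haar
begin

lemma measure_left_translate:
  assumes "compact E"
  shows "measure r (left_translate g E) = modular g * measure r E"
  using emeasure_left_translate[OF borel_compact[OF assms], of g] modular_pos[of g]
  by (simp add: measure_def enn2real_mult)

lemma tame_mono:
  assumes t: "tame P B C" and B: "B \<subseteq> B'" "compact B'"
  shows "tame P B' C"
proof -
  have "left_translate p B \<subseteq> left_translate p B'" for p using B by blast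
  then show ?thesis using t B(2) unfolding tame_def by (meson subset_trans)
qed

text \<open>Zorn's lemma gives a maximal set \<open>N\<close> of disjoint translates of
  \<open>unit_nbhd\<close>. By maximality the translates of \<open>Q\<close> by \<open>N\<close>
  cover the group. Each atom lies between a translate of \<open>unit_nbhd\<close> and the
  corresponding one of \<open>Q\<close>, and is thus both large and bounded.\<close>

lemma ex_tame: "\<exists>P B C. tame P B C"
proof -
  obtain W where W: "open W" "0 \<in> W" "W \<subseteq> unit_nbhd" using unit_nbhd(2) by blast
  let ?U = "unit_nbhd"
  note U = unit_nbhd(1)
  define \<A> where "\<A> = {N. \<forall>m\<in>N. \<forall>n\<in>N. m \<noteq> n \<longrightarrow> left_translate m ?U \<inter> left_translate n ?U = {}}"
  have "\<exists>N\<in>\<A>. \<forall>X\<in>\<A>. N \<subseteq> X \<longrightarrow> X = N"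
  proof (rule subset_Zorn_nonempty)
    have "{} \<in> \<A>" unfolding \<A>_def by blast
    then show "\<A> \<noteq> {}" by blast
    fix \<C> assume \<C>: "\<C> \<noteq> {}" "subset.chain \<A> \<C>"
    show "\<Union>\<C> \<in> \<A>"
      unfolding \<A>_def
    proof (intro CollectI ballI impI)
      fix m n assume mn: "m \<in> \<Union>\<C>" "n \<in> \<Union>\<C>" "m \<noteq> n"
      then obtain X Y where XY: "X \<in> \<C>" "m \<in> X" "Y \<in> \<C>" "n \<in> Y" by blast
      have "\<C> \<subseteq> \<A>" "X \<subseteq> Y \<or> Y \<subseteq> X" using XY \<C>(2) by (auto simp: subset_chain_def)
      then have "\<exists>Z\<in>\<A>. m \<in> Z \<and> n \<in> Z"
      proof (elim disjE)
        assume "X \<subseteq> Y"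
        then show ?thesis using XY \<open>\<C> \<subseteq> \<A>\<close> by (intro bexI[of _ Y]) auto
      next
        assume "Y \<subseteq> X"
        then show ?thesis using XY \<open>\<C> \<subseteq> \<A>\<close> by (intro bexI[of _ X]) auto
      qed
      then obtain Z where "Z \<in> \<A>" "m \<in> Z" "n \<in> Z" by blast
      then show "left_translate m ?U \<inter> left_translate n ?U = {}" using mn(3) unfolding \<A>_def by blast
    qed
  qed
  then obtain N where N: "N \<in> \<A>" "\<And>X. X \<in> \<A> \<Longrightarrow> N \<subseteq> X \<Longrightarrow> X = N" by blast
  have disj: "left_translate m ?U \<inter> left_translate n ?U = {}" if "m \<in> N" "n \<in> N" "m \<noteq> n" for m n
    using N(1) that unfolding \<A>_def by blast
  have in_U: "n \<in> left_translate n ?U" for n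
  proof -
    have "n + 0 \<in> left_translate n ?U" using W by blast
    then show ?thesis by simp
  qed
  define Q where "Q = ?U + uminus ` ?U"
  have Q: "compact Q" unfolding Q_def by (intro compact_set_plus compact_uminus_image U)
  have "?U \<subseteq> Q"
  proof
    fix u assume "u \<in> ?U"
    then have "u + - 0 \<in> Q" unfolding Q_def using W by blast
    then show "u \<in> Q" by simp
  qed
  then have UQ: "left_translate n ?U \<subseteq> left_translate n Q" for n by blast
  have cover: "\<exists>n\<in>N. x \<in> left_translate n Q" for x
  proof (cases "x \<in> N")
    case True
    then show ?thesis using in_U UQ by blast
  next
    case False
    then have "insert x N \<notin> \<A>" using N(2)[of "insert x N"] by blast
    then obtain n where n: "n \<in> N" "left_translate x ?U \<inter> left_translate n ?U \<noteq> {}"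
      using disj unfolding \<A>_def by blast
    then obtain u u' where u: "u \<in> ?U" "u' \<in> ?U" "x + u = n + u'" by blast
    then have "x = n + (u' + - u)" by (metis add.assoc add.right_inverse add.right_neutral)
    moreover have "u' + - u \<in> Q" unfolding Q_def using u by blast
    ultimately show ?thesis using n(1) by blast
  qed
  \<comment> \<open>The translates of the open set \<open>W\<close> are disjoint, and second
    countability allows only countably many.\<close>
  have "countable N"
  proof -
    have "countable ((\<lambda>n. left_translate n W) ` N)"
    proof (rule countable_disjoint_open_subsets)
      fix S assume "S \<in> (\<lambda>n. left_translate n W) ` N"
      then obtain n where S: "S = left_translate n W" by blast
      have "open ((\<lambda>x. - n + x) -` W)" by (intro open_vimage W continuous_intros)
      then show "open S" unfolding S by (simp only: left_translate_eq_vimage vimage_def)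
    next
      show "disjoint ((\<lambda>n. left_translate n W) ` N)"
        unfolding disjoint_def using disj W(3) by blast
    qed
    moreover have "inj_on (\<lambda>n. left_translate n W) N"
    proof (rule inj_onI, rule ccontr)
      fix m n assume mn: "m \<in> N" "n \<in> N" "left_translate m W = left_translate n W" "m \<noteq> n"
      have "m + 0 \<in> left_translate m W" using W by blast
      then have "m + 0 \<in> left_translate m ?U" "m + 0 \<in> left_translate n ?U" using mn(3) W(3) by blast+
      then show False using disj[OF mn(1,2,4)] by blast
    qed
    ultimately show ?thesis by (rule countable_image_inj_on)
  qed
  then have inj: "inj_on (to_nat_on N) N" by (rule inj_on_to_nat_on)
  define core where "core = (\<Union>m\<in>N. left_translate m ?U)"
  define before where "before n = (\<Union>m\<in>{m\<in>N. to_nat_on N m < to_nat_on N n}. left_translate m Q)" for n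
  \<comment> \<open>A point of no core translate goes to the first translate of \<open>Q\<close>
    that contains it; points of the core stay in their own translate.\<close>
  define A where "A n = left_translate n ?U \<union> (left_translate n Q - core - before n)" for n
  have A_sub: "left_translate n ?U \<subseteq> A n" "A n \<subseteq> left_translate n Q" for n
    using UQ unfolding A_def by blast+
  have A_borel: "A n \<in> sets borel" for n
  proof -
    have "core \<in> sets borel" unfolding core_def
      using \<open>countable N\<close> borel_left_translate_compact[OF U] by (intro sets.countable_UN') blast+
    moreover have "before n \<in> sets borel" unfolding before_def
    proof (intro sets.countable_UN')
      show "countable {m \<in> N. to_nat_on N m < to_nat_on N n}"
        by (rule countable_subset[OF _ \<open>countable N\<close>]) blast
    qed (use borel_left_translate_compact[OF Q] in blast)
    ultimately show ?thesis unfolding A_def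
      by (intro sets.Un sets.Diff borel_left_translate_compact U Q)
  qed
  define P where "P = A ` N"
  have part: "partition_on UNIV P"
  proof (rule partition_onI)
    have "x \<in> \<Union>P" for x
    proof (cases "x \<in> core")
      case True
      then show ?thesis using A_sub unfolding core_def P_def by blast
    next
      case False
      define R where "R k \<longleftrightarrow> (\<exists>n\<in>N. to_nat_on N n = k \<and> x \<in> left_translate n Q)" for k
      have "\<exists>k. R k" using cover unfolding R_def by blast
      then have "R (LEAST k. R k)" by (rule LeastI_ex)
      then obtain n where n: "n \<in> N" "to_nat_on N n = (LEAST k. R k)" "x \<in> left_translate n Q"
        unfolding R_def by blast
      have "x \<notin> before n"
      proof
        assume "x \<in> before n"
        then obtain m where m: "m \<in> N" "to_nat_on N m < to_nat_on N n" "x \<in> left_translate m Q"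
          unfolding before_def by blast
        then have "R (to_nat_on N m)" unfolding R_def by blast
        then show False using m(2) n(2) not_less_Least[of "to_nat_on N m" R] by simp
      qed
      then show ?thesis using n False unfolding A_def P_def by blast
    qed
    then show "\<Union>P = UNIV" by blast
    show "{} \<notin> P" using in_U A_sub(1) unfolding P_def by blast
    fix p q assume "p \<in> P" "q \<in> P" "p \<noteq> q"
    then obtain m n where mn: "m \<in> N" "n \<in> N" "p = A m" "q = A n" "m \<noteq> n" unfolding P_def by blast
    have "A m \<inter> A n = {}"
    proof -
      have "to_nat_on N m < to_nat_on N n \<or> to_nat_on N n < to_nat_on N m"
        using inj mn by (metis inj_onD linorder_neqE_nat)
      moreover have "x \<in> core"
        if x: "x \<in> A m" "x \<in> A n" and less: "m \<in> N" "n \<in> N" "to_nat_on N m < to_nat_on N n" for x m n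
      proof -
        have "left_translate m Q \<subseteq> before n" unfolding before_def using less by blast
        then have "x \<in> before n" using x(1) A_sub(2) by blast
        then have "x \<in> left_translate n ?U" using x(2) unfolding A_def by blast
        then show ?thesis unfolding core_def using less(2) by blast
      qed
      ultimately have "A m \<inter> A n \<subseteq> core" using mn(1,2) by blast
      then have "A m \<inter> A n \<subseteq> left_translate m ?U \<inter> left_translate n ?U"
        unfolding A_def by blast
      then show ?thesis using disj[OF mn(1,2,5)] by blast
    qed
    then show "disjnt p q" using mn by (simp add: disjnt_def)
  qed
  define B where "B = uminus ` Q + Q"
  have B: "compact B" unfolding B_def by (intro compact_set_plus compact_uminus_image Q)
  obtain M where M: "M > 0" "\<And>q. q \<in> Q \<Longrightarrow> modular q \<le> M" using modular_bounded[OF Q] by blast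
  have rU: "0 < measure r ?U" using measure_unit_nbhd_pos[of 0] by simp
  \<comment> \<open>For \<open>p = n + q\<close>, \<open>modular p\<close> is at most
    \<open>M * modular n\<close>, and \<open>modular n * measure r ?U\<close> is the measure of the
    core translate inside \<open>A n\<close>.\<close>
  define C where "C = M / measure r ?U"
  have C: "0 < C" using M rU by (simp add: C_def)
  have "A n \<in> sets borel \<and> (\<forall>p\<in>A n. A n \<subseteq> left_translate p B \<and> modular p \<le> C * measure r (A n))" for n
  proof (intro conjI ballI)
    show "A n \<in> sets borel" by (rule A_borel)
    fix p assume "p \<in> A n"
    then obtain q where q: "q \<in> Q" "p = n + q" using A_sub(2) by blast
    have "left_translate n Q \<subseteq> left_translate p B"
    proof
      fix x assume "x \<in> left_translate n Q"
      then obtain q' where q': "q' \<in> Q" "x = n + q'" by blast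
      then have "x = p + (- q + q')" unfolding q(2) by (metis add.assoc add_minus_cancel)
      moreover have "- q + q' \<in> B" unfolding B_def using q q' by blast
      ultimately show "x \<in> left_translate p B" by blast
    qed
    then show "A n \<subseteq> left_translate p B" using A_sub(2)[of n] by (rule subset_trans[rotated])
    have "modular n * measure r ?U = measure r (left_translate n ?U)"
      using measure_left_translate[OF U] by simp
    also have "\<dots> \<le> measure r (A n)"
    proof (rule measure_mono_fmeasurable[OF A_sub(1)])
      show "left_translate n ?U \<in> sets r" using borel_left_translate_compact[OF U] by (simp only: sets_r)
      have "emeasure r (A n) \<le> emeasure r (left_translate n Q)"
        using A_sub(2) borel_left_translate_compact[OF Q] by (intro emeasure_mono) (simp_all only: sets_r)
      also have "\<dots> < \<infinity>" by (rule emeasure_left_translate_compact[OF Q])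
      finally show "A n \<in> fmeasurable r" using A_borel by (intro fmeasurableI) (simp_all only: sets_r)
    qed
    finally have "modular n \<le> measure r (A n) / measure r ?U" using rU by (simp add: field_simps)
    then have "modular n * M \<le> measure r (A n) / measure r ?U * M" using M by (intro mult_right_mono) auto
    moreover have "modular p \<le> modular n * M"
      unfolding q(2) modular_add using M(2)[OF q(1)] modular_pos[of n] by (intro mult_left_mono) auto
    ultimately show "modular p \<le> C * measure r (A n)" by (simp add: C_def mult.commute)
  qed
  then have "tame P B C" using part B C unfolding tame_def P_def by blast
  then show ?thesis by blast
qed

text \<open>A compact set in a noncompact group misses some right translate of
  \<open>unit_nbhd\<close>; adjoining it increases the measure by a fixed amount.\<close>

lemma large_compact:
  assumes "\<not> compact (UNIV :: 'a set)"
  shows "\<exists>K. compact K \<and> M \<le> measure r K"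
proof -
  have rU: "0 < measure r unit_nbhd" using measure_unit_nbhd_pos[of 0] by simp
  have fm: "K \<in> fmeasurable r" if "compact K" for K
    using emeasure_compact_finite[OF that] borel_compact[OF that] by (intro fmeasurableI) auto
  have "\<exists>K. compact K \<and> real n * measure r unit_nbhd \<le> measure r K" for n
  proof (induction n)
    case 0 show ?case by (intro exI[of _ "{}"]) simp
  next
    case (Suc n)
    then obtain K where K: "compact K" "real n * measure r unit_nbhd \<le> measure r K" by blast
    have "compact (uminus ` unit_nbhd + K)"
      by (intro compact_set_plus compact_uminus_image unit_nbhd K)
    then have "uminus ` unit_nbhd + K \<noteq> UNIV" using assms by metis
    then obtain g where g: "g \<notin> uminus ` unit_nbhd + K" by blast
    have c: "compact (right_translate unit_nbhd g)"
      by (intro compact_continuous_image continuous_intros unit_nbhd)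
    have "right_translate unit_nbhd g \<inter> K = {}"
    proof (rule ccontr)
      assume "\<not> ?thesis"
      then obtain u where u: "u \<in> unit_nbhd" "u + g \<in> K" by blast
      then have "- u + (u + g) \<in> uminus ` unit_nbhd + K" by blast
      then show False using g by (simp add: add.assoc[symmetric])
    qed
    then have "measure r (right_translate unit_nbhd g \<union> K) = measure r (right_translate unit_nbhd g) + measure r K"
      using fm[OF c] fm[OF K(1)] by (intro measure_Un3[THEN trans]) simp_all
    moreover have "measure r (right_translate unit_nbhd g) = measure r unit_nbhd"
      unfolding right_translate_eq_vimage measure_def
      by (simp only: emeasure_right_vimage[OF borel_compact[OF unit_nbhd(1)]])
    ultimately show ?case
      using K c by (intro exI[of _ "right_translate unit_nbhd g \<union> K"]) (auto simp: algebra_simps)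
  qed
  moreover obtain n where "M \<le> real n * measure r unit_nbhd"
    using rU by (metis ex_less_of_nat_mult less_imp_le)
  ultimately show ?thesis by (meson order_trans)
qed

text \<open>In a compact group the whole group serves as the only atom. It has nothing outside to
  spill into, and it is large enough for the old \<open>C\<close> because it contains every old
  atom.\<close>

lemma tame_coarsening:
  assumes t: "tame P B C"
    and folner: "\<And>\<epsilon> D. 0 < \<epsilon> \<Longrightarrow> compact D \<Longrightarrow>
      \<exists>F. compact F \<and> 0 < measure r F \<and> boundary_invariant r \<epsilon> D F"
    and K: "compact K" and \<epsilon>: "0 < \<epsilon>"
  shows "\<exists>P' B'. tame P' B' C \<and> (\<forall>A\<in>P. \<exists>A'\<in>P'. A \<subseteq> A') \<and> (\<forall>A\<in>P'. invariant_set r \<epsilon> K A)"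
proof (cases "compact (UNIV :: 'a set)")
  case False
  interpret tame_partition r P B C by unfold_locales (rule t)
  show ?thesis using folner large_compact[OF False] K \<epsilon> by (rule coarsening)
next
  case True
  interpret tame_partition r P B C by unfold_locales (rule t)
  have "modular p \<le> C * measure r UNIV" for p
  proof -
    obtain A where A: "A \<in> P" "p \<in> A" using atom_cover by blast
    have "modular p \<le> C * measure r A" using A by (rule modular_le)
    also have "\<dots> \<le> C * measure r UNIV"
      using C_pos emeasure_compact_finite[OF True] borel_P[OF A(1)]
      by (intro mult_left_mono measure_mono_fmeasurable fmeasurableI) auto
    finally show ?thesis .
  qed
  moreover have "UNIV \<subseteq> left_translate p UNIV" for p
    by (simp add: left_translate_eq_vimage)
  moreover have "partition_on UNIV {UNIV :: 'a set}" by (intro partition_onI) auto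
  ultimately have "tame {UNIV} UNIV C" using True C_pos unfolding tame_def by auto
  moreover have "invariant_set r \<epsilon> K UNIV" by (simp add: invariant_set_def)
  ultimately show ?thesis by blast
qed

lemma tame_atom:
  assumes t: "tame P B C" and A: "A \<in> P"
  shows "A \<in> sets r" "0 < vol r A" "vol r A < \<infinity>" "\<exists>\<gamma>. A \<subseteq> left_translate \<gamma> B"
proof -
  interpret tame_partition r P B C by unfold_locales (rule t)
  show "A \<in> sets r" using borel_P[OF A] by simp
  then have v: "vol r A = emeasure r A" by simp
  show "0 < vol r A" unfolding v emeasure_atom[OF A] using atom_pos[OF A] by simp
  show "vol r A < \<infinity>" unfolding v by (rule atom_finite[OF A])
  show "\<exists>\<gamma>. A \<subseteq> left_translate \<gamma> B" using atom_sub[OF A rep_in[OF A]] by blast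
qed

text \<open>In \<open>ennreal\<close> a quotient of equal values is one only away from zero and
  infinity, so positivity and finiteness of the translates must be checked.\<close>

lemma lower_banach_density_UNIV:
  assumes "compact K" "0 < vol r K"
  shows "1 \<le> lower_banach_density r UNIV"
proof -
  have "vol r (left_translate g K \<inter> UNIV) / vol r (left_translate g K) = 1" for g
  proof -
    have v: "vol r (left_translate g K) = ennreal (modular g) * emeasure r K"
      using borel_left_translate_compact[OF assms(1), of g] emeasure_left_translate[OF borel_compact[OF assms(1)], of g]
      by simp
    have "emeasure r K \<noteq> 0" "emeasure r K \<noteq> \<infinity>"
      using assms emeasure_compact_finite[OF assms(1)] by (auto simp: borel_compact)
    then have "vol r (left_translate g K) \<noteq> 0" "vol r (left_translate g K) \<noteq> \<infinity>"
      unfolding v using modular_pos[of g] by (auto simp: ennreal_mult_eq_top_iff)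
    then show ?thesis
      unfolding Int_UNIV_right by (intro ennreal_divide_self) (simp_all add: less_top)
  qed
  then have "1 \<le> (INF g. vol r (left_translate g K \<inter> UNIV) / vol r (left_translate g K))"
    by (simp only: INF_const) simp
  also have "\<dots> \<le> lower_banach_density r UNIV"
    unfolding lower_banach_density_def using assms by (intro SUP_upper) simp
  finally show ?thesis .
qed

end

section \<open>Monotonicity in the compact set and the tolerance, and the final iteration\<close>

lemma boundary_invariant_mono:
  assumes "boundary_invariant r \<epsilon> K E" "K' \<subseteq> K" "\<epsilon> \<le> \<epsilon>'"
  shows "boundary_invariant r \<epsilon>' K' E"
proof -
  have "K_boundary K' E \<subseteq> K_boundary K E"
  proof
    fix x assume "x \<in> K_boundary K' E"
    then obtain g where g: "x \<in> left_translate g K'" "left_translate g K' \<inter> E \<noteq> {}"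
      "left_translate g K' \<inter> (UNIV - E) \<noteq> {}" unfolding K_boundary_def by blast
    have "left_translate g K' \<subseteq> left_translate g K" using assms(2) by blast
    then have "x \<in> left_translate g K" "left_translate g K \<inter> E \<noteq> {}"
      "left_translate g K \<inter> (UNIV - E) \<noteq> {}" using g by blast+
    then show "x \<in> K_boundary K E" unfolding K_boundary_def by blast
  qed
  then have "vol r (K_boundary K' E) \<le> vol r (K_boundary K E)" by (rule outer_measure_of_mono)
  also have "\<dots> \<le> ennreal \<epsilon> * vol r E" using assms(1) by (simp add: boundary_invariant_def)
  also have "\<dots> \<le> ennreal \<epsilon>' * vol r E" using assms(3) by (intro mult_right_mono ennreal_leI) auto
  finally show ?thesis by (simp add: boundary_invariant_def)
qed

lemma invariant_set_mono:
  assumes "invariant_set r \<epsilon> K E" "K' \<subseteq> K" "\<epsilon> \<le> \<epsilon>'"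
  shows "invariant_set r \<epsilon>' K' E"
proof -
  have le: "ennreal \<epsilon> * vol r E \<le> ennreal \<epsilon>' * vol r E"
    using assms(3) by (intro mult_right_mono ennreal_leI) auto
  have "E + K' - E \<subseteq> E + K - E" "E + uminus ` K' - E \<subseteq> E + uminus ` K - E"
    using assms(2) by (auto simp: set_plus_def)
  then have "vol r (E + K' - E) \<le> vol r (E + K - E)"
    "vol r (E + uminus ` K' - E) \<le> vol r (E + uminus ` K - E)"
    by (auto intro: outer_measure_of_mono)
  then show ?thesis using assms(1) le unfolding invariant_set_def by (meson order_trans)
qed


theorem theorem1:
  fixes r :: "'a::{topological_group_add, t2_space, second_countable_topology} measure"
    and F :: "nat \<Rightarrow> 'a set"
  assumes "locally_compact_space (euclidean :: 'a topology)"
    and "right_haar_measure r"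
    and "amenable r"
    and "folner_sequence r F"
  shows "\<exists>s :: nat \<Rightarrow> nat. strict_mono s \<and> admissible_folner_sequence r (F \<circ> s)"
proof -
  interpret lc_haar r using assms(1,2) by unfold_locales
  have F: "compact (F n)" "0 < vol r (F n)" for n using assms(4) by (auto simp: folner_sequence_def)
  have ev: "\<forall>\<^sub>F n in sequentially. boundary_invariant r \<epsilon> D (F n)" if "0 < \<epsilon>" "compact D" for \<epsilon> D
    using assms(4) that by (auto simp: folner_sequence_def)
  have F_pos: "0 < measure r (F n)" for n
    using F[of n] emeasure_compact_finite[OF F(1)[of n]]
    by (simp add: borel_compact emeasure_eq_ennreal_measure)
  have next_index: "\<exists>n>m. boundary_invariant r \<epsilon> D (F n)" if \<epsilon>D: "0 < \<epsilon>" "compact D" for \<epsilon> D m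
  proof -
    obtain n where "\<And>k. k \<ge> n \<Longrightarrow> boundary_invariant r \<epsilon> D (F k)"
      using ev[OF \<epsilon>D] unfolding eventually_sequentially by blast
    then have "boundary_invariant r \<epsilon> D (F (max n (Suc m)))" by simp
    then show ?thesis by (intro exI[of _ "max n (Suc m)"]) simp
  qed
  have folner: "\<exists>E. compact E \<and> 0 < measure r E \<and> boundary_invariant r \<epsilon> D E" if "0 < \<epsilon>" "compact D" for \<epsilon> D
    using next_index[OF that] F(1) F_pos by blast
  obtain P\<^sub>0 B\<^sub>0 C where tame\<^sub>0: "tame P\<^sub>0 B\<^sub>0 C" using ex_tame by blast
  have compact_of_tame: "compact B" if "tame P B C" for P B using that by (simp add: tame_def)
  \<comment> \<open>A state holds the partition, its bounding set, a compact set that collects the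
    Folner sets chosen so far, and the last index. The index is chosen after the bounding set of its
    level, which it has to respect.\<close>
  define inv where "inv n S \<longleftrightarrow> (case S of (P, B, K, m) \<Rightarrow>
      tame P B C \<and> compact K \<and> F m \<subseteq> K \<and> boundary_invariant r (1 / 2 ^ n) B (F m))"
    for n :: nat and S :: "'a set set \<times> 'a set \<times> 'a set \<times> nat"
  \<comment> \<open>The new partition is made invariant under the old \<open>K\<close>, that is,
    under the Folner sets already fixed.\<close>
  define step where "step n S S' \<longleftrightarrow> (case S of (P, B, K, m) \<Rightarrow> case S' of (P', B', K', m') \<Rightarrow>
      (\<forall>A\<in>P. \<exists>A'\<in>P'. A \<subseteq> A') \<and> B \<subseteq> B' \<and> K \<subseteq> K' \<and> m < m' \<and>
      (\<forall>A\<in>P'. invariant_set r (1 / 2 ^ Suc n) K A))"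
    for n :: nat and S S' :: "'a set set \<times> 'a set \<times> 'a set \<times> nat"
  have "\<exists>S. \<forall>n. inv n (S n) \<and> step n (S n) (S (Suc n))"
  proof (rule dependent_nat_choice)
    obtain m where "boundary_invariant r 1 B\<^sub>0 (F m)"
      using next_index[of 1 B\<^sub>0] compact_of_tame[OF tame\<^sub>0] by auto
    then have "inv 0 (P\<^sub>0, B\<^sub>0, F m, m)" using tame\<^sub>0 F by (simp add: inv_def)
    then show "\<exists>S. inv 0 S" ..
  next
    fix S n assume "inv n S"
    moreover obtain P B K m where S: "S = (P, B, K, m)" by (metis prod.exhaust)
    ultimately have inv: "tame P B C" "compact K" by (simp_all add: inv_def)
    have "\<exists>P' B'. tame P' B' C \<and> (\<forall>A\<in>P. \<exists>A'\<in>P'. A \<subseteq> A') \<and> (\<forall>A\<in>P'. invariant_set r (1 / 2 ^ Suc n) K A)"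
      by (rule tame_coarsening[OF inv(1) folner inv(2)]) simp_all
    then obtain P' B' where P': "tame P' B' C" "\<forall>A\<in>P. \<exists>A'\<in>P'. A \<subseteq> A'"
      "\<forall>A\<in>P'. invariant_set r (1 / 2 ^ Suc n) K A" by (elim exE conjE)
    \<comment> \<open>The union makes the bounding sets increase, so boundary invariance against the
      latest one covers all earlier ones.\<close>
    have c: "compact (B \<union> B')" using compact_of_tame inv(1) P'(1) by blast
    then obtain m' where m': "m' > m" "boundary_invariant r (1 / 2 ^ Suc n) (B \<union> B') (F m')"
      using next_index[of "1 / 2 ^ Suc n"] by auto
    have "tame P' (B \<union> B') C" using tame_mono[OF P'(1) _ c] by blast
    then have "inv (Suc n) (P', B \<union> B', K \<union> F m', m')"
      using m'(2) inv(2) F(1)[of m'] unfolding inv_def prod.case by blast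
    moreover have "step n S (P', B \<union> B', K \<union> F m', m')"
      using P'(2,3) m'(1) unfolding step_def S prod.case by blast
    ultimately show "\<exists>S'. inv (Suc n) S' \<and> step n S S'" by blast
  qed
  then obtain S where S: "\<And>n. inv n (S n)" "\<And>n. step n (S n) (S (Suc n))" by blast
  define P where "P n = fst (S n)" for n
  define B where "B n = fst (snd (S n))" for n
  define K where "K n = fst (snd (snd (S n)))" for n
  define s where "s n = snd (snd (snd (S n)))" for n
  have inv: "tame (P n) (B n) C" "F (s n) \<subseteq> K n" "boundary_invariant r (1 / 2 ^ n) (B n) (F (s n))" for n
    using S(1)[of n] unfolding inv_def P_def B_def K_def s_def by (auto simp: case_prod_beta)
  have step: "\<forall>A\<in>P n. \<exists>A'\<in>P (Suc n). A \<subseteq> A'" "B n \<subseteq> B (Suc n)" "K n \<subseteq> K (Suc n)" "s n < s (Suc n)"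
    "\<forall>A\<in>P (Suc n). invariant_set r (1 / 2 ^ Suc n) (K n) A" for n
    using S(2)[of n] unfolding step_def P_def B_def K_def s_def case_prod_beta by blast+
  have B_mono: "B k \<subseteq> B n" if "k \<le> n" for k n using step(2) that by (rule lift_Suc_mono_le)
  have K_mono: "K k \<subseteq> K n" if "k \<le> n" for k n using step(3) that by (rule lift_Suc_mono_le)
  have s: "strict_mono s" using step(4) by (rule strict_mono_Suc_iff[THEN iffD2, OF allI])
  \<comment> \<open>One tolerance per level is stricter than all those required there. With the
    roles of the indices exchanged, the same inequality serves the atoms.\<close>
  have pow_ge: "1 / 2 ^ n \<le> (2 powi (int k - int n) :: real)" for k n :: nat
  proof -
    have "(2 powi (int k - int n) :: real) = 2 ^ k / 2 ^ n" by (simp add: power_int_diff)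
    then show ?thesis by (simp add: divide_right_mono)
  qed
  have folner_s: "folner_sequence r (F \<circ> s)"
    unfolding folner_sequence_def
  proof (intro conjI allI impI)
    show "compact ((F \<circ> s) n)" "0 < vol r ((F \<circ> s) n)" for n using F by simp_all
    fix \<epsilon> :: real and D :: "'a set" assume "0 < \<epsilon>" "compact D"
    then show "\<forall>\<^sub>F n in sequentially. boundary_invariant r \<epsilon> D ((F \<circ> s) n)"
      using eventually_subseq[OF s ev] by simp
  qed
  have coarser: "\<exists>A'\<in>P m. A \<subseteq> A'" if "n \<le> m" "A \<in> P n" for n m A
    using that
  proof (induction m rule: dec_induct)
    case (step m)
    then obtain A' where "A' \<in> P m" "A \<subseteq> A'" by blast
    moreover obtain A'' where "A'' \<in> P (Suc m)" "A' \<subseteq> A''"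
      using \<open>\<And>n. \<forall>A\<in>P n. \<exists>A'\<in>P (Suc n). A \<subseteq> A'\<close> \<open>A' \<in> P m\<close> by blast
    ultimately show ?case by blast
  qed blast
  have "atomic_filtration r P"
    unfolding atomic_filtration_def
    using inv(1) tame_atom(1-3)[OF inv(1)] coarser by (auto simp: tame_def)
  moreover have "boundary_invariant r (2 powi (int k - int n)) (B k) ((F \<circ> s) n)" if "k \<le> n" for n k
    using boundary_invariant_mono[OF inv(3) B_mono[OF that] pow_ge] by simp
  ultimately have filtered: "filtered_folner_sequence r (F \<circ> s) B P"
    unfolding filtered_folner_sequence_def
    using folner_s compact_of_tame[OF inv(1)] tame_atom(4)[OF inv(1)] by blast
  \<comment> \<open>At level \<open>Suc j\<close> the atoms are invariant under \<open>K j\<close>,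
    which contains \<open>F (s n)\<close> for all \<open>n \<le> j\<close>; level \<open>0\<close>
    carries no condition.\<close>
  have "admissible_atoms r (F \<circ> s) P k = P k" for k
  proof -
    have "invariant_set r (2 powi (int n - int k)) ((F \<circ> s) n) A" if A: "A \<in> P k" and n: "n < k" for A n
    proof -
      obtain j where j: "k = Suc j" "n \<le> j" using n by (cases k) auto
      then have "F (s n) \<subseteq> K j" using inv(2)[of n] K_mono[of n j] by blast
      moreover have "invariant_set r (1 / 2 ^ Suc j) (K j) A" using step(5)[of j] A j by blast
      ultimately show ?thesis using invariant_set_mono[OF _ _ pow_ge[of k n]] pow_ge[of k n] j
        by (auto intro: invariant_set_mono pow_ge)
    qed
    then show ?thesis by (auto simp: admissible_atoms_def)
  qed
  moreover have "\<Union>(P k) = UNIV" for k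
  proof -
    have "partition_on UNIV (P k)" using inv(1)[of k] by (simp only: tame_def)
    then show ?thesis by (rule partition_onD1[symmetric])
  qed
  ultimately have Adm: "Adm r (F \<circ> s) P = UNIV" by (simp add: Adm_def)
  \<comment> \<open>The density is one, so any value strictly between zero and one would do in place
    of \<open>1 / 2\<close>.\<close>
  have "ennreal (1 - 1 / 2) \<le> ennreal 1" by (rule ennreal_leI) simp
  also have "\<dots> = 1" by simp
  also have "\<dots> \<le> lower_banach_density r UNIV" by (rule lower_banach_density_UNIV[OF F])
  finally have "c_admissible r (1 / 2) (F \<circ> s) B P" using filtered Adm by (simp add: c_admissible_def)
  then have "admissible r (F \<circ> s) B P" unfolding admissible_def by (intro exI[of _ "1 / 2"]) simp
  then show ?thesis using s folner_s unfolding admissible_folner_sequence_def by blast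
qed

end
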